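(* Let $(\mathcal B,H,D)$ be a $C^2$-spectral triple, let $\mathcal X$ be a finitely generated projective $\mathbb Z/2$-graded inner product module over $\mathcal B_2$ with inner-product preserving injection $v:\mathcal X\to\mathcal B_2^{2N}$ as in the context, and let $\nabla:\mathcal X\to\mathcal X_v\otimes^{\mathrm{alg}}_{\mathcal B_1}\Omega^1_u(\mathcal B_1,\mathcal B_2)$ be a $C^2$-connection. Then the curvature operator $R_{\nabla_D}=(1\otimes_\nabla D)^2-1\otimes_\nabla D^2$ extends to a bounded operator on $X\otimes_BH$. Moreover, if $\nabla^v$ is the Grassmann connection of the frame $\{x_i\}$, $x_i=v^*(e_i)$, and $\omega(x):=\nabla(x)-\nabla^v(x)$ is the connection form of $\nabla$, then $$R_{\nabla_D}=v^*[D,p][D,p]v+\omega_D^2+v^*\,\pi_D\big(\delta(v\omega v^* )\big)\,v,\qquad p=vv^*.$$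
   Context: Conventions. Algebras are unital and trivially graded, modules are $\mathbb Z/2$-graded with grading $\gamma$, commutators are graded. A $C^2$-spectral triple $(\mathcal B,H,D)$: a $*$-algebra $\mathcal B$ faithfully represented on a graded Hilbert space $H$ (by even operators), $D$ odd self-adjoint, $b(D\pm i)^{-1}$ compact, $b\,\mathrm{Dom}\,D\subset\mathrm{Dom}\,D$, $[D,b]$ bounded, and there is a core $\mathcal C\subset\mathrm{Dom}\,D^2$ for $D^2$ such that for $b\in\mathcal B$, $b:\mathcal C\to\mathrm{Dom}\,D^2$ and $[D^2,b](D\pm i)^{-1}$ is bounded on $(D\pm i)\mathcal C$. $B$ is the $C^*$-closure of $\mathcal B$. With $\pi^1_D(b)=\begin{pmatrix}b&0\\ [D,b]&b\end{pmatrix}$, $\pi^2_D(b)=\begin{pmatrix}(D+i)b(D+i)^{-1}&0\\ [D^2,b](D+i)^{-1}&b\end{pmatrix}$, let $\mathcal B_1$, $\mathcal B_2$ be the completions of $\mathcal B$ in $\|b\|_1=\|\pi_D^1(b)\|$ and $\|b\|_2=\max\{\|\pi_D^1(b)\|,\|\pi^2_D(b)\|,\|\pi^2_D(b^* )\|\}$. $\Omega^1_u(\mathcal B_1,\mathcal B_2)=\ker(m:\mathcal B_1\otimes^h\mathcal B_2\to\mathcal B_1)$ with $\otimes^h$ the Haagerup tensor product and $m$ multiplication; $\delta(b)=1\otimes b-b\otimes1$, $\delta(a\delta(b))=\delta(a)\delta(b)$, $\pi_D(a\delta(b))=a[D,b]$, $\pi_D(\delta(a)\delta(b))=[D,a][D,b]$,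 $\pi_{D^2}(a\delta(b))=a[D^2,b]$. Module. $\mathcal B_2^{2N}$ has standard basis $e_i$, $1\le|i|\le N$, with $e_i$ even for $i>0$ and odd for $i<0$. $v:\mathcal X\to\mathcal B_2^{2N}$ is an even inner-product preserving injection of right $\mathcal B_2$-modules inducing $\mathcal X\cong p\mathcal B_2^{2N}$ with $p=vv^*\in M_{2N}(\mathcal B_2)$ a projection; $X$ is the $C^*$-module completion ($X$ is a full Hilbert $B$-module, $v:X\cong pB^{2N}$); $\mathcal X_v$ is the completion of $\mathcal X$ in $\|x\|_v=\|v(x)\|_{\mathcal B_1^{2N}}$. The Grassmann connection is $\nabla^v(x)=\sum_i\gamma(x_i)\otimes\delta(\langle x_i,x\rangle)$. A $C^2$-connection is a linear map $\nabla:\mathcal X\to\mathcal X_v\otimes^{\mathrm{alg}}_{\mathcal B_1}\Omega^1_u(\mathcal B_1,\mathcal B_2)$ with $\nabla(\gamma x)=(\gamma\otimes1)\nabla(x)$ and $\nabla(xb)=\nabla(x)b+\gamma(x)\otimes\delta(b)$. Operators. $\nabla_D=(1\otimes\pi_D)\circ\nabla$, $\nabla_{D^2}=(\gamma\otimes\pi_{D^2})\circ\nabla$; $1\otimes_\nabla D(x\otimes h)=\gamma(x)\otimes Dh+\nabla_D(x)h$ (closure, from $\mathcal X\otimes^{\mathrm{alg}}_{\mathcal B_2}\mathrm{Dom}\,D$) and $1\otimes_\nabla D^2(x\otimes h)=x\otimes D^2h+\nabla_{D^2}(x)h$; $R_{\nabla_D}$ is defined on $\mathcal X\otimes^{\mathrm{alg}}_{\mathcal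 B_2}\mathrm{Dom}\,D^2\subset X\otimes_BH$. Here $v$ also denotes $v\otimes1:X\otimes_BH\to H^{2N}$, and $D$ also denotes the diagonal operator $\gamma\otimes D$ on $H^{2N}$. $\omega_D$ is the operator $x\otimes h\mapsto(1\otimes\pi_D)(\omega(x))h$. $v\omega v^*$ is the matrix of universal one-forms $(\langle e_i,v\omega(v^*e_j)\rangle)_{ij}$, and $\pi_D(\delta(v\omega v^* ))$ is the operator on $H^{2N}$ given by $e_j\otimes h\mapsto\sum_i\gamma(e_i)\otimes\pi_D(\delta((v\omega v^* )_{ij}))h$. *)

theory Defs
  imports "HOL-Analysis.Analysis" "HOL-Library.Multiset"
begin

section \<open>Complex Hilbert spaces\<close>

class complex_vector = real_vector +
  fixes scaleC :: "complex \<Rightarrow> 'a \<Rightarrow> 'a"  (infixr \<open>*\<^sub>C\<close> 75)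
  assumes scaleC_add_right: "c *\<^sub>C (x + y) = c *\<^sub>C x + c *\<^sub>C y"
    and scaleC_add_left: "(c + d) *\<^sub>C x = c *\<^sub>C x + d *\<^sub>C x"
    and scaleC_scaleC: "c *\<^sub>C d *\<^sub>C x = (c * d) *\<^sub>C x"
    and scaleC_of_real: "of_real r *\<^sub>C x = r *\<^sub>R x"

lemma scaleC_one: "1 *\<^sub>C x = (x :: 'a :: complex_vector)"
  using scaleC_of_real[of 1 x] by simp

interpretation complex_vector: vector_space "scaleC :: complex \<Rightarrow> 'a \<Rightarrow> 'a :: complex_vector"
  by unfold_locales (simp_all add: scaleC_add_right scaleC_add_left scaleC_scaleC scaleC_one)

abbreviation cspan :: "'a :: complex_vector set \<Rightarrow> 'a set"
  where "cspan \<equiv> complex_vector.span"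

abbreviation csubspace :: "'a :: complex_vector set \<Rightarrow> bool"
  where "csubspace \<equiv> complex_vector.subspace"

class complex_normed_vector = complex_vector + real_normed_vector +
  assumes norm_scaleC: "norm (c *\<^sub>C x) = cmod c * norm x"

class complex_banach = complex_normed_vector + complete_space

text \<open>The inner product is conjugate linear in the first variable.\<close>

class complex_inner = complex_vector + real_inner +
  fixes cinner :: "'a \<Rightarrow> 'a \<Rightarrow> complex"
  assumes cinner_commute: "cinner x y = cnj (cinner y x)"
    and cinner_add_right: "cinner x (y + z) = cinner x y + cinner x z"
    and cinner_scaleC_right: "cinner x (c *\<^sub>C y) = c * cinner x y"
    and inner_eq_Re_cinner: "inner x y = Re (cinner x y)"
begin

subclass complex_normed_vector
proof
  fix c x
  have a: "cinner (c *\<^sub>C x) (c *\<^sub>C x) = of_real ((cmod c)\<^sup>2) * cinner x x"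
  proof -
    have "cinner (c *\<^sub>C x) (c *\<^sub>C x) = c * cinner (c *\<^sub>C x) x"
      by (rule cinner_scaleC_right)
    also have "cinner (c *\<^sub>C x) x = cnj (c * cinner x x)"
      by (subst cinner_commute, subst cinner_scaleC_right, rule refl)
    also have "c * cnj (c * cinner x x) = (c * cnj c) * cnj (cinner x x)"
      by (simp add: algebra_simps)
    also have "cnj (cinner x x) = cinner x x"
      by (rule cinner_commute[symmetric])
    finally show ?thesis by (simp only: complex_norm_square)
  qed
  have "inner (c *\<^sub>C x) (c *\<^sub>C x) = (cmod c)\<^sup>2 * inner x x"
    unfolding inner_eq_Re_cinner a by simp
  then show "norm (c *\<^sub>C x) = cmod c * norm x"
    by (simp add: norm_eq_sqrt_inner real_sqrt_mult)
qed

end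

class chilbert_space = complex_inner + complete_space
begin
subclass complex_banach ..
end

instantiation prod :: (complex_vector, complex_vector) complex_vector
begin
definition scaleC_prod :: "complex \<Rightarrow> 'a \<times> 'b \<Rightarrow> 'a \<times> 'b"
  where "scaleC_prod c z = (c *\<^sub>C fst z, c *\<^sub>C snd z)"
instance
  by standard
    (simp_all add: scaleC_prod_def prod_eq_iff scaleC_add_right scaleC_add_left scaleC_scaleC
      scaleC_of_real)
end

instantiation vec :: (complex_inner, finite) complex_inner
begin
definition scaleC_vec :: "complex \<Rightarrow> 'a ^ 'b \<Rightarrow> 'a ^ 'b"
  where "scaleC_vec c \<xi> = (\<chi> i. c *\<^sub>C \<xi> $ i)"
definition cinner_vec :: "'a ^ 'b \<Rightarrow> 'a ^ 'b \<Rightarrow> complex"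
  where "cinner_vec \<xi> \<eta> = (\<Sum>i\<in>UNIV. cinner (\<xi> $ i) (\<eta> $ i))"
instance
proof
  fix \<xi> \<eta> :: "'a ^ 'b"
  have "(\<Sum>i\<in>UNIV. cinner (\<xi> $ i) (\<eta> $ i)) = (\<Sum>i\<in>UNIV. cnj (cinner (\<eta> $ i) (\<xi> $ i)))"
    by (intro sum.cong refl cinner_commute)
  then show "cinner \<xi> \<eta> = cnj (cinner \<eta> \<xi>)"
    by (simp add: cinner_vec_def)
qed (simp_all add: scaleC_vec_def cinner_vec_def vec_eq_iff scaleC_add_right scaleC_add_left
    scaleC_scaleC scaleC_of_real cinner_add_right cinner_scaleC_right sum.distrib sum_distrib_left
    inner_vec_def inner_eq_Re_cinner)
end

instance vec :: (chilbert_space, finite) chilbert_space ..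

instantiation blinfun :: (real_normed_vector, complex_normed_vector) complex_normed_vector
begin
lift_definition scaleC_blinfun :: "complex \<Rightarrow> ('a \<Rightarrow>\<^sub>L 'b) \<Rightarrow> ('a \<Rightarrow>\<^sub>L 'b)"
  is "\<lambda>c A x. c *\<^sub>C A x"
proof -
  fix c :: complex and A :: "'a \<Rightarrow> 'b"
  assume "bounded_linear A"
  then interpret bounded_linear A .
  from bounded obtain K where K: "\<And>x. norm (A x) \<le> norm x * K" by blast
  show "bounded_linear (\<lambda>x. c *\<^sub>C A x)"
  proof (rule bounded_linear_intro[where K = "cmod c * K"])
    show "c *\<^sub>C A (r *\<^sub>R x) = r *\<^sub>R (c *\<^sub>C A x)" for r x
      by (simp add: scaleR scaleC_of_real[symmetric] scaleC_scaleC mult.commute)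
    show "norm (c *\<^sub>C A x) \<le> norm x * (cmod c * K)" for x
      using mult_left_mono[OF K, of "cmod c" x] by (simp add: norm_scaleC mult_ac)
  qed (simp add: add scaleC_add_right)
qed
instance
proof
  fix c :: complex and A :: "'a \<Rightarrow>\<^sub>L 'b"
  have le: "norm (c *\<^sub>C A) \<le> cmod c * norm A" for c and A :: "'a \<Rightarrow>\<^sub>L 'b"
    by (rule norm_blinfun_bound)
      (auto simp: scaleC_blinfun.rep_eq norm_scaleC mult.assoc intro!: mult_left_mono norm_blinfun)
  show "norm (c *\<^sub>C A) = cmod c * norm A"
  proof (cases "c = 0")
    case True
    then show ?thesis using le[of c A] by simp
  next
    case False
    have "inverse c *\<^sub>C c *\<^sub>C A = A"
      using False by (intro blinfun_eqI) (simp add: scaleC_blinfun.rep_eq scaleC_scaleC scaleC_one)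
    then have "norm A \<le> inverse (cmod c) * norm (c *\<^sub>C A)"
      using le[of "inverse c" "c *\<^sub>C A"] by (simp add: norm_inverse)
    then have "cmod c * norm A \<le> norm (c *\<^sub>C A)"
      using False by (simp add: field_simps)
    with le[of c A] show ?thesis by simp
  qed
qed (auto intro!: blinfun_eqI simp: scaleC_blinfun.rep_eq blinfun.add_left blinfun.scaleR_left
    scaleC_add_right scaleC_add_left scaleC_scaleC scaleC_of_real)
end

definition bounded_clinear :: "('a :: complex_normed_vector \<Rightarrow> 'b :: complex_normed_vector) \<Rightarrow> bool"
  where "bounded_clinear f \<longleftrightarrow> bounded_linear f \<and> (\<forall>c x. f (c *\<^sub>C x) = c *\<^sub>C f x)"

definition cadj :: "('a :: complex_inner \<Rightarrow>\<^sub>L 'b :: complex_inner) \<Rightarrow> ('b \<Rightarrow>\<^sub>L 'a)"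
  where "cadj A = (THE B :: 'b \<Rightarrow>\<^sub>L 'a. \<forall>x y. cinner (A x) y = cinner x (B y))"

definition compact_op :: "('a :: real_normed_vector \<Rightarrow>\<^sub>L 'b :: real_normed_vector) \<Rightarrow> bool"
  where "compact_op A \<longleftrightarrow> compact (closure (blinfun_apply A ` cball 0 1))"

text \<open>An unbounded operator is given by its domain and a function that is only relevant there.\<close>

definition selfadjoint_on :: "'h :: complex_inner set \<Rightarrow> ('h \<Rightarrow> 'h) \<Rightarrow> bool"
  where "selfadjoint_on V D \<longleftrightarrow>
    csubspace V \<and> closure V = UNIV \<and>
    (\<forall>x\<in>V. \<forall>y\<in>V. D (x + y) = D x + D y) \<and>
    (\<forall>c. \<forall>x\<in>V. D (c *\<^sub>C x) = c *\<^sub>C D x) \<and>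
    (\<forall>x\<in>V. \<forall>y\<in>V. cinner (D x) y = cinner x (D y)) \<and>
    (\<forall>y z. (\<forall>x\<in>V. cinner (D x) y = cinner x z) \<longrightarrow> y \<in> V)"

text \<open>The bounded extension of \<open>D b - b D\<close>. It is only used for odd \<open>D\<close> and even \<open>b\<close>, where this
  is the graded commutator.\<close>

definition bcomm :: "'h set \<Rightarrow> ('h \<Rightarrow> 'h) \<Rightarrow> ('h :: complex_inner \<Rightarrow>\<^sub>L 'h) \<Rightarrow> ('h \<Rightarrow>\<^sub>L 'h)"
  where "bcomm V D b = (THE A :: 'h \<Rightarrow>\<^sub>L 'h. \<forall>h\<in>V. A h = D (b h) - b (D h))"

definition matrix_op ::
    "('i :: finite \<Rightarrow> 'i \<Rightarrow> ('h :: real_normed_vector \<Rightarrow>\<^sub>L 'h)) \<Rightarrow> (('h ^ 'i) \<Rightarrow>\<^sub>L ('h ^ 'i))"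
  where "matrix_op A = Blinfun (\<lambda>\<xi>. \<chi> i. \<Sum>j\<in>UNIV. A i j (\<xi> $ j))"

text \<open>The operator norms of the column \<open>\<xi> \<mapsto> (a i \<xi>)\<close> and of the row
  \<open>(\<xi> i) \<mapsto> (\<Sum>i. a i (\<xi> i))\<close> with respect to Hilbert direct sums.\<close>

definition col_norm ::
    "'i set \<Rightarrow> ('i \<Rightarrow> ('a :: real_normed_vector \<Rightarrow>\<^sub>L 'b :: real_normed_vector)) \<Rightarrow> real"
  where "col_norm I a =
    Inf {C. 0 \<le> C \<and> (\<forall>\<xi>. L2_set (\<lambda>i. norm (a i \<xi>)) I \<le> C * norm \<xi>)}"

definition row_norm ::
    "'i set \<Rightarrow> ('i \<Rightarrow> ('a :: real_normed_vector \<Rightarrow>\<^sub>L 'b :: real_normed_vector)) \<Rightarrow> real"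
  where "row_norm I a =
    Inf {C. 0 \<le> C \<and> (\<forall>\<xi>. norm (\<Sum>i\<in>I. a i (\<xi> i)) \<le> C * L2_set (\<lambda>i. norm (\<xi> i)) I)}"

text \<open>The completion of \<open>A\<close> in a norm \<open>nrm\<close> which dominates the ambient norm (up to a constant)
  and for which completing creates no kernel over the ambient space: the limits of the
  \<open>nrm\<close>-Cauchy sequences.\<close>

definition completion_in :: "('a :: real_normed_vector \<Rightarrow> real) \<Rightarrow> 'a set \<Rightarrow> 'a set"
  where "completion_in nrm A = {x. \<exists>s. (\<forall>n. s n \<in> A) \<and> s \<longlonglongrightarrow> x \<and>
    (\<forall>e>0. \<exists>K. \<forall>m\<ge>K. \<forall>n\<ge>K. nrm (s m - s n) < e)}"

section \<open>Algebraic tensor products\<close>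

text \<open>The tensor product of a right module \<open>M\<close> and a left module \<open>N\<close> over \<open>R\<close>, with right action
  \<open>ra\<close> and left action \<open>la\<close>, consists of the formal finite sums of pairs modulo the congruence
  \<open>tensor_eq M N R ra la\<close>. The rule \<open>zero\<close> makes the quotient monoid a group.\<close>

inductive tensor_eq :: "'a :: ab_group_add set \<Rightarrow> 'b :: ab_group_add set \<Rightarrow> 'r set \<Rightarrow>
    ('a \<Rightarrow> 'r \<Rightarrow> 'a) \<Rightarrow> ('r \<Rightarrow> 'b \<Rightarrow> 'b) \<Rightarrow> ('a \<times> 'b) multiset \<Rightarrow> ('a \<times> 'b) multiset \<Rightarrow> bool"
  for M N R ra la where
  refl: "set_mset u \<subseteq> M \<times> N \<Longrightarrow> tensor_eq M N R ra la u u"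
| sym: "tensor_eq M N R ra la u u' \<Longrightarrow> tensor_eq M N R ra la u' u"
| trans: "tensor_eq M N R ra la u u' \<Longrightarrow> tensor_eq M N R ra la u' u'' \<Longrightarrow>
    tensor_eq M N R ra la u u''"
| plus: "tensor_eq M N R ra la u u' \<Longrightarrow> set_mset w \<subseteq> M \<times> N \<Longrightarrow>
    tensor_eq M N R ra la (u + w) (u' + w)"
| add_left: "x \<in> M \<Longrightarrow> x' \<in> M \<Longrightarrow> y \<in> N \<Longrightarrow>
    tensor_eq M N R ra la {#(x + x', y)#} {#(x, y), (x', y)#}"
| add_right: "x \<in> M \<Longrightarrow> y \<in> N \<Longrightarrow> y' \<in> N \<Longrightarrow>
    tensor_eq M N R ra la {#(x, y + y')#} {#(x, y), (x, y')#}"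
| zero: "y \<in> N \<Longrightarrow> tensor_eq M N R ra la {#(0, y)#} {#}"
| balanced: "x \<in> M \<Longrightarrow> r \<in> R \<Longrightarrow> y \<in> N \<Longrightarrow>
    tensor_eq M N R ra la {#(ra x r, y)#} {#(x, la r y)#}"

text \<open>The map on tensors (that is, on classes of formal sums) induced by a balanced map \<open>f\<close>.\<close>

definition tensor_lift ::
    "('a \<Rightarrow> 'b \<Rightarrow> 'c :: comm_monoid_add) \<Rightarrow> ('a \<times> 'b) multiset set \<Rightarrow> 'c"
  where "tensor_lift f U = (THE s. \<forall>u\<in>U. s = (\<Sum>(x, y)\<in>#u. f x y))"

section \<open>Spectral triples and the algebras \<open>B\<^sub>1\<close>, \<open>B\<^sub>2\<close>\<close>

record (overloaded) 'h striple =
  grH :: "'h \<Rightarrow>\<^sub>L 'h"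
  Dom :: "'h set"
  Dop :: "'h \<Rightarrow> 'h"
  Alg :: "('h \<Rightarrow>\<^sub>L 'h) set"

definition Dom2 :: "'h :: real_normed_vector striple \<Rightarrow> 'h set"
  where "Dom2 T = {h \<in> Dom T. Dop T h \<in> Dom T}"

definition resolv :: "'h :: chilbert_space striple \<Rightarrow> complex \<Rightarrow> ('h \<Rightarrow>\<^sub>L 'h)"
  where "resolv T z = Blinfun (\<lambda>k. THE h. h \<in> Dom T \<and> Dop T h + z *\<^sub>C h = k)"

definition C2_spectral_triple :: "'h :: chilbert_space striple \<Rightarrow> bool"
  where "C2_spectral_triple T \<longleftrightarrow>
    bounded_clinear (blinfun_apply (grH T)) \<and>
    (\<forall>h. grH T (grH T h) = h) \<and>
    (\<forall>h k. cinner (grH T h) (grH T k) = cinner h k) \<and>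
    (\<forall>b\<in>Alg T. bounded_clinear (blinfun_apply b) \<and> (\<forall>h. b (grH T h) = grH T (b h))) \<and>
    csubspace (Alg T) \<and> id_blinfun \<in> Alg T \<and>
    (\<forall>a\<in>Alg T. \<forall>b\<in>Alg T. a o\<^sub>L b \<in> Alg T) \<and> (\<forall>b\<in>Alg T. cadj b \<in> Alg T) \<and>
    selfadjoint_on (Dom T) (Dop T) \<and>
    (\<forall>h\<in>Dom T. grH T h \<in> Dom T \<and> Dop T (grH T h) = - grH T (Dop T h)) \<and>
    (\<forall>b\<in>Alg T. compact_op (b o\<^sub>L resolv T \<i>) \<and> compact_op (b o\<^sub>L resolv T (- \<i>))) \<and>
    (\<forall>b\<in>Alg T. (\<forall>h\<in>Dom T. b h \<in> Dom T) \<and>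
      (\<exists>A :: 'h \<Rightarrow>\<^sub>L 'h. \<forall>h\<in>Dom T. A h = Dop T (b h) - b (Dop T h))) \<and>
    (\<exists>C. csubspace C \<and> C \<subseteq> Dom2 T \<and>
      (\<forall>h\<in>Dom2 T. (h, Dop T (Dop T h)) \<in> closure {(c, Dop T (Dop T c)) |c. c \<in> C}) \<and>
      (\<forall>b\<in>Alg T. (\<forall>c\<in>C. b c \<in> Dom2 T) \<and>
        (\<forall>z\<in>{\<i>, - \<i>}. \<exists>K. \<forall>c\<in>C.
          norm (Dop T (Dop T (b c)) - b (Dop T (Dop T c))) \<le> K * norm (Dop T c + z *\<^sub>C c))))"

abbreviation comm1 :: "'h :: chilbert_space striple \<Rightarrow> ('h \<Rightarrow>\<^sub>L 'h) \<Rightarrow> ('h \<Rightarrow>\<^sub>L 'h)"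
  where "comm1 T b \<equiv> bcomm (Dom T) (Dop T) b"

text \<open>The bounded extension of \<open>[D\<^sup>2, b] (D + i)\<inverse>\<close>. As \<open>D\<^sup>2\<close> is closed, boundedness on
  \<open>(D + i) C\<close> for a core \<open>C\<close> forces \<open>b (Dom D\<^sup>2) \<subseteq> Dom D\<^sup>2\<close>, so that this does not depend on the core.\<close>

definition comm2R :: "'h :: chilbert_space striple \<Rightarrow> ('h \<Rightarrow>\<^sub>L 'h) \<Rightarrow> ('h \<Rightarrow>\<^sub>L 'h)"
  where "comm2R T b = (THE A :: 'h \<Rightarrow>\<^sub>L 'h. \<forall>h\<in>Dom2 T. b h \<in> Dom2 T \<longrightarrow>
    A (Dop T h + \<i> *\<^sub>C h) = Dop T (Dop T (b h)) - b (Dop T (Dop T h)))"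

definition pi1 :: "'h :: chilbert_space striple \<Rightarrow> ('h \<Rightarrow>\<^sub>L 'h) \<Rightarrow> (('h \<times> 'h) \<Rightarrow>\<^sub>L ('h \<times> 'h))"
  where "pi1 T b = Blinfun (\<lambda>(h, k). (b h, comm1 T b h + b k))"

definition pi2 :: "'h :: chilbert_space striple \<Rightarrow> ('h \<Rightarrow>\<^sub>L 'h) \<Rightarrow> (('h \<times> 'h) \<Rightarrow>\<^sub>L ('h \<times> 'h))"
  where "pi2 T b = Blinfun (\<lambda>(h, k).
    (Dop T (b (resolv T \<i> h)) + \<i> *\<^sub>C b (resolv T \<i> h), comm2R T b h + b k))"

definition norm1 :: "'h :: chilbert_space striple \<Rightarrow> ('h \<Rightarrow>\<^sub>L 'h) \<Rightarrow> real"
  where "norm1 T b = norm (pi1 T b)"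

definition norm2 :: "'h :: chilbert_space striple \<Rightarrow> ('h \<Rightarrow>\<^sub>L 'h) \<Rightarrow> real"
  where "norm2 T b = Max {norm (pi1 T b), norm (pi2 T b), norm (pi2 T (cadj b))}"

definition Balg :: "'h :: chilbert_space striple \<Rightarrow> ('h \<Rightarrow>\<^sub>L 'h) set"
  where "Balg T = closure (Alg T)"

text \<open>Since \<open>D\<close> and \<open>D\<^sup>2\<close> are closed, both completions embed into \<open>B \<subseteq> B(H)\<close>, and \<open>[D, b]\<close>,
  \<open>[D\<^sup>2, b] (D + i)\<inverse>\<close> and the two norms are given on them by the same formulas as on \<open>Alg T\<close>.\<close>

definition B1 :: "'h :: chilbert_space striple \<Rightarrow> ('h \<Rightarrow>\<^sub>L 'h) set"
  where "B1 T = completion_in (norm1 T) (Alg T)"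

definition B2 :: "'h :: chilbert_space striple \<Rightarrow> ('h \<Rightarrow>\<^sub>L 'h) set"
  where "B2 T = completion_in (norm2 T) (Alg T)"

section \<open>The Haagerup tensor product and one-forms\<close>

text \<open>The norm of a column \<open>b\<close> over \<open>B\<^sub>2\<close>: the maximum of the norms of the columns \<open>\<pi>\<^sup>1 b\<close> and
  \<open>\<pi>\<^sup>2 b\<close> and of the row \<open>\<pi>\<^sup>2 (b\<^sup>*)\<close>.\<close>

definition col_norm2 :: "'h :: chilbert_space striple \<Rightarrow> 'i set \<Rightarrow> ('i \<Rightarrow> ('h \<Rightarrow>\<^sub>L 'h)) \<Rightarrow> real"
  where "col_norm2 T I b = Max {col_norm I (\<lambda>i. pi1 T (b i)), col_norm I (\<lambda>i. pi2 T (b i)),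
    row_norm I (\<lambda>i. pi2 T (cadj (b i)))}"

definition haagerup_norm ::
    "'h :: chilbert_space striple \<Rightarrow> (('h \<Rightarrow>\<^sub>L 'h) \<times> ('h \<Rightarrow>\<^sub>L 'h)) multiset \<Rightarrow> real"
  where "haagerup_norm T u =
    Inf {row_norm {..<length l} (\<lambda>k. pi1 T (fst (l ! k))) *
         col_norm2 T {..<length l} (\<lambda>k. snd (l ! k)) |l.
      tensor_eq (B1 T) (B2 T) (UNIV :: complex set) (\<lambda>a c. c *\<^sub>C a) scaleC u (mset l)}"

text \<open>\<open>\<theta> a b = a \<otimes> b\<close> exhibits the Banach space \<open>'w\<close> as \<open>B\<^sub>1 \<otimes>\<^sup>h B\<^sub>2\<close>, the completion of the
  algebraic tensor product in the Haagerup norm.\<close>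

definition is_haagerup_tensor :: "'h :: chilbert_space striple \<Rightarrow>
    (('h \<Rightarrow>\<^sub>L 'h) \<Rightarrow> ('h \<Rightarrow>\<^sub>L 'h) \<Rightarrow> 'w :: complex_banach) \<Rightarrow> bool"
  where "is_haagerup_tensor T \<theta> \<longleftrightarrow>
    (\<forall>a\<in>B1 T. \<forall>a'\<in>B1 T. \<forall>b\<in>B2 T. \<theta> (a + a') b = \<theta> a b + \<theta> a' b) \<and>
    (\<forall>a\<in>B1 T. \<forall>b\<in>B2 T. \<forall>b'\<in>B2 T. \<theta> a (b + b') = \<theta> a b + \<theta> a b') \<and>
    (\<forall>c. \<forall>a\<in>B1 T. \<forall>b\<in>B2 T. \<theta> (c *\<^sub>C a) b = c *\<^sub>C \<theta> a b \<and> \<theta> a (c *\<^sub>C b) = c *\<^sub>C \<theta> a b) \<and>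
    (\<forall>u. set_mset u \<subseteq> B1 T \<times> B2 T \<longrightarrow> norm (\<Sum>(a, b)\<in>#u. \<theta> a b) = haagerup_norm T u) \<and>
    closure (cspan {\<theta> a b |a b. a \<in> B1 T \<and> b \<in> B2 T}) = UNIV"

text \<open>The continuous linear map on the Haagerup tensor product given by \<open>\<Phi>\<close> on elementary tensors.\<close>

definition haagerup_ext :: "'h :: chilbert_space striple \<Rightarrow>
    (('h \<Rightarrow>\<^sub>L 'h) \<Rightarrow> ('h \<Rightarrow>\<^sub>L 'h) \<Rightarrow> 'w :: complex_banach) \<Rightarrow>
    (('h \<Rightarrow>\<^sub>L 'h) \<Rightarrow> ('h \<Rightarrow>\<^sub>L 'h) \<Rightarrow> 'z :: complex_normed_vector) \<Rightarrow> 'w \<Rightarrow> 'z"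
  where "haagerup_ext T \<theta> \<Phi> =
    (THE F. bounded_clinear F \<and> (\<forall>a\<in>B1 T. \<forall>b\<in>B2 T. F (\<theta> a b) = \<Phi> a b))"

context
  fixes T :: "'h :: chilbert_space striple"
    and \<theta> :: "('h \<Rightarrow>\<^sub>L 'h) \<Rightarrow> ('h \<Rightarrow>\<^sub>L 'h) \<Rightarrow> 'w :: complex_banach"
begin

definition lmult :: "('h \<Rightarrow>\<^sub>L 'h) \<Rightarrow> 'w \<Rightarrow> 'w"
  where "lmult a = haagerup_ext T \<theta> (\<lambda>a' b. \<theta> (a o\<^sub>L a') b)"

definition rmult :: "'w \<Rightarrow> ('h \<Rightarrow>\<^sub>L 'h) \<Rightarrow> 'w"
  where "rmult \<eta> b = haagerup_ext T \<theta> (\<lambda>a b'. \<theta> a (b' o\<^sub>L b)) \<eta>"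

definition Omega1 :: "'w set"
  where "Omega1 = {\<eta>. haagerup_ext T \<theta> (\<lambda>a b. a o\<^sub>L b) \<eta> = 0}"

definition udelta :: "('h \<Rightarrow>\<^sub>L 'h) \<Rightarrow> 'w"
  where "udelta b = \<theta> id_blinfun b - \<theta> b id_blinfun"

text \<open>As \<open>a \<delta>(b) = a \<otimes> b - a b \<otimes> 1\<close> and \<open>[D, 1] = [D\<^sup>2, 1] = 0\<close>, on one-forms the following
  are the continuous maps with \<open>a \<delta>(b) \<mapsto> a [D, b]\<close>, \<open>a \<delta>(b) \<mapsto> [D, a] [D, b]\<close> and
  \<open>a \<delta>(b) \<mapsto> a [D\<^sup>2, b]\<close>, respectively; the operators in the image of the last one have domain
  \<open>Dom D\<close> and are bounded when multiplied by \<open>(D + i)\<inverse>\<close> from the right.\<close>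

definition piD :: "'w \<Rightarrow> ('h \<Rightarrow>\<^sub>L 'h)"
  where "piD = haagerup_ext T \<theta> (\<lambda>a b. a o\<^sub>L comm1 T b)"

definition piD_delta :: "'w \<Rightarrow> ('h \<Rightarrow>\<^sub>L 'h)"
  where "piD_delta = haagerup_ext T \<theta> (\<lambda>a b. comm1 T a o\<^sub>L comm1 T b)"

definition piD2 :: "'w \<Rightarrow> 'h \<Rightarrow> 'h"
  where "piD2 \<eta> h = haagerup_ext T \<theta> (\<lambda>a b. a o\<^sub>L comm2R T b) \<eta> (Dop T h + \<i> *\<^sub>C h)"

end

section \<open>Modules and connections\<close>

text \<open>The index \<open>i > 0\<close> is rendered as \<open>Inl i\<close> and the index \<open>- i < 0\<close> as \<open>Inr i\<close>, with
  \<open>N = CARD('n)\<close>.\<close>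

definition parity :: "'n + 'n \<Rightarrow> real"
  where "parity i = (case i of Inl _ \<Rightarrow> 1 | Inr _ \<Rightarrow> - 1)"

text \<open>The whole type \<open>'x\<close> is the Hilbert module \<open>X\<close>; the \<open>B\<^sub>2\<close>-module whose completion it is, is the
  subset \<open>Xc\<close>. The field \<open>vv\<close> is the continuous extension of \<open>v\<close> to \<open>X\<close>.\<close>

record (overloaded) ('h, 'x, 'n) smodule =
  act :: "'x \<Rightarrow> ('h \<Rightarrow>\<^sub>L 'h) \<Rightarrow> 'x"
  ip :: "'x \<Rightarrow> 'x \<Rightarrow> ('h \<Rightarrow>\<^sub>L 'h)"
  grX :: "'x \<Rightarrow> 'x"
  Xc :: "'x set"
  vv :: "'x \<Rightarrow> 'n + 'n \<Rightarrow> ('h \<Rightarrow>\<^sub>L 'h)"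

definition full_graded_hilbert_module ::
    "'h :: chilbert_space striple \<Rightarrow> ('h, 'x :: complex_banach, 'n) smodule \<Rightarrow> bool"
  where "full_graded_hilbert_module T E \<longleftrightarrow>
    (\<forall>x y. \<forall>b\<in>Balg T. act E (x + y) b = act E x b + act E y b) \<and>
    (\<forall>x. \<forall>a\<in>Balg T. \<forall>b\<in>Balg T. act E x (a + b) = act E x a + act E x b) \<and>
    (\<forall>x. \<forall>a\<in>Balg T. \<forall>b\<in>Balg T. act E (act E x a) b = act E x (a o\<^sub>L b)) \<and>
    (\<forall>x c. act E x (c *\<^sub>C id_blinfun) = c *\<^sub>C x) \<and>
    (\<forall>x y. ip E x y \<in> Balg T) \<and>
    (\<forall>x y z. ip E x (y + z) = ip E x y + ip E x z) \<and>
    (\<forall>x y. \<forall>b\<in>Balg T. ip E x (act E y b) = ip E x y o\<^sub>L b) \<and>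
    (\<forall>x y. ip E y x = cadj (ip E x y)) \<and>
    (\<forall>x h. 0 \<le> Re (cinner h (ip E x x h))) \<and>
    (\<forall>x. norm x = sqrt (norm (ip E x x))) \<and>
    closure (cspan {ip E x y |x y. True}) = Balg T \<and>
    (\<forall>x. grX E (grX E x) = x) \<and>
    (\<forall>x y. grX E (x + y) = grX E x + grX E y) \<and>
    (\<forall>x. \<forall>b\<in>Balg T. grX E (act E x b) = act E (grX E x) b) \<and>
    (\<forall>x y. ip E (grX E x) (grX E y) = ip E x y)"

definition stdbasis :: "'i \<Rightarrow> 'i \<Rightarrow> ('h :: real_normed_vector \<Rightarrow>\<^sub>L 'h)"
  where "stdbasis j i = (if i = j then id_blinfun else 0)"

context
  fixes E :: "('h :: chilbert_space, 'x :: complex_banach, 'n :: finite) smodule"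
begin

definition vadj :: "('n + 'n \<Rightarrow> ('h \<Rightarrow>\<^sub>L 'h)) \<Rightarrow> 'x"
  where "vadj \<xi> = (THE x. x \<in> Xc E \<and>
    (\<forall>y\<in>Xc E. ip E y x = (\<Sum>i\<in>UNIV. cadj (vv E y i) o\<^sub>L \<xi> i)))"

definition frame :: "'n + 'n \<Rightarrow> 'x"
  where "frame j = vadj (stdbasis j)"

text \<open>The matrix of \<open>p = v v\<^sup>*\<close>.\<close>

definition pmat :: "'n + 'n \<Rightarrow> 'n + 'n \<Rightarrow> ('h \<Rightarrow>\<^sub>L 'h)"
  where "pmat i j = vv E (vadj (stdbasis j)) i"

end

definition C2_module ::
    "'h :: chilbert_space striple \<Rightarrow> ('h, 'x :: complex_banach, 'n :: finite) smodule \<Rightarrow> bool"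
  where "C2_module T E \<longleftrightarrow>
    full_graded_hilbert_module T E \<and>
    csubspace (Xc E) \<and> closure (Xc E) = UNIV \<and>
    (\<forall>x\<in>Xc E. grX E x \<in> Xc E \<and> (\<forall>b\<in>B2 T. act E x b \<in> Xc E)) \<and>
    (\<forall>x\<in>Xc E. \<forall>y\<in>Xc E. ip E x y \<in> B2 T) \<and>
    (\<forall>x y i. vv E (x + y) i = vv E x i + vv E y i) \<and>
    (\<forall>x i. \<forall>b\<in>Balg T. vv E (act E x b) i = vv E x i o\<^sub>L b) \<and>
    (\<forall>x y. ip E x y = (\<Sum>i\<in>UNIV. cadj (vv E x i) o\<^sub>L vv E y i)) \<and>
    (\<forall>x i. vv E (grX E x) i = parity i *\<^sub>R vv E x i) \<and>
    (\<forall>x i. vv E x i \<in> Balg T) \<and>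
    (\<forall>x\<in>Xc E. \<forall>i. vv E x i \<in> B2 T) \<and>
    (\<forall>\<xi>. (\<forall>i. \<xi> i \<in> B2 T) \<longrightarrow>
      (\<exists>x\<in>Xc E. \<forall>y\<in>Xc E. ip E y x = (\<Sum>i\<in>UNIV. cadj (vv E y i) o\<^sub>L \<xi> i))) \<and>
    vv E ` Xc E = {\<lambda>i. \<Sum>j\<in>UNIV. pmat E i j o\<^sub>L \<xi> j |\<xi>. \<forall>i. \<xi> i \<in> B2 T}"

text \<open>The completion of the module in \<open>\<parallel>v(x)\<parallel>\<close>, the norm being that of the column space
  \<open>B\<^sub>1\<^sup>2\<^sup>N\<close>; it embeds into \<open>X\<close> because \<open>B\<^sub>1\<close> embeds into \<open>B\<close>.\<close>

definition Xv :: "'h :: chilbert_space striple \<Rightarrow>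
    ('h, 'x :: complex_banach, 'n :: finite) smodule \<Rightarrow> 'x set"
  where "Xv T E = completion_in (\<lambda>x. col_norm UNIV (\<lambda>i. pi1 T (vv E x i))) (Xc E)"

context
  fixes T :: "'h :: chilbert_space striple"
    and E :: "('h, 'x :: complex_banach, 'n :: finite) smodule"
    and \<theta> :: "('h \<Rightarrow>\<^sub>L 'h) \<Rightarrow> ('h \<Rightarrow>\<^sub>L 'h) \<Rightarrow> 'w :: complex_banach"
begin

definition conn_eq :: "('x \<times> 'w) multiset \<Rightarrow> ('x \<times> 'w) multiset \<Rightarrow> bool"
  where "conn_eq = tensor_eq (Xv T E) (Omega1 T \<theta>) (B1 T) (act E) (lmult T \<theta>)"

text \<open>The values of a connection are classes of formal sums in
  \<open>X\<^sub>v \<otimes> \<Omega>\<^sup>1\<close>, balanced over \<open>B\<^sub>1\<close>; as they are classes, every membership \<open>u \<in> nab x\<close> below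
  says that \<open>u\<close> represents \<open>nab x\<close>.\<close>

definition C2_connection :: "('x \<Rightarrow> ('x \<times> 'w) multiset set) \<Rightarrow> bool"
  where "C2_connection nab \<longleftrightarrow>
    (\<forall>x\<in>Xc E. \<exists>u. set_mset u \<subseteq> Xv T E \<times> Omega1 T \<theta> \<and> nab x = {u'. conn_eq u u'}) \<and>
    (\<forall>x\<in>Xc E. \<forall>y\<in>Xc E. \<forall>u\<in>nab x. \<forall>u'\<in>nab y. u + u' \<in> nab (x + y)) \<and>
    (\<forall>c. \<forall>x\<in>Xc E. \<forall>u\<in>nab x. image_mset (\<lambda>(y, \<eta>). (c *\<^sub>C y, \<eta>)) u \<in> nab (c *\<^sub>C x)) \<and>
    (\<forall>x\<in>Xc E. \<forall>u\<in>nab x. image_mset (\<lambda>(y, \<eta>). (grX E y, \<eta>)) u \<in> nab (grX E x)) \<and>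
    (\<forall>x\<in>Xc E. \<forall>b\<in>B2 T. \<forall>u\<in>nab x.
      image_mset (\<lambda>(y, \<eta>). (y, rmult T \<theta> \<eta> b)) u + {#(grX E x, udelta \<theta> b)#} \<in> nab (act E x b))"

definition grassmann :: "'x \<Rightarrow> ('x \<times> 'w) multiset set"
  where "grassmann x =
    {u. conn_eq (\<Sum>i\<in>UNIV. {#(grX E (frame E i), udelta \<theta> (ip E (frame E i) x))#}) u}"

definition conn_form :: "('x \<Rightarrow> ('x \<times> 'w) multiset set) \<Rightarrow> 'x \<Rightarrow> ('x \<times> 'w) multiset set"
  where "conn_form nab x =
    {w. \<exists>u\<in>nab x. \<exists>u'\<in>grassmann x. conn_eq (u + image_mset (\<lambda>(y, \<eta>). (- y, \<eta>)) u') w}"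

text \<open>The matrix \<open>v \<omega> v\<^sup>*\<close> of universal one-forms.\<close>

definition form_matrix ::
    "('x \<Rightarrow> ('x \<times> 'w) multiset set) \<Rightarrow> 'n + 'n \<Rightarrow> 'n + 'n \<Rightarrow> 'w"
  where "form_matrix nab i j =
    tensor_lift (\<lambda>y \<eta>. lmult T \<theta> (vv E y i) \<eta>) (conn_form nab (frame E j))"

end

section \<open>Operators on \<open>X \<otimes>\<^sub>B H\<close> and on \<open>H\<^sup>2\<^sup>N\<close>\<close>

text \<open>\<open>\<tau> x h = x \<otimes> h\<close> exhibits the Hilbert space \<open>'k\<close> as the interior tensor product.\<close>

definition is_interior_tensor :: "'h :: chilbert_space striple \<Rightarrow>
    ('h, 'x :: complex_banach, 'n :: finite) smodule \<Rightarrow>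
    ('x \<Rightarrow> 'h \<Rightarrow> 'k :: chilbert_space) \<Rightarrow> bool"
  where "is_interior_tensor T E \<tau> \<longleftrightarrow>
    (\<forall>x y h. \<tau> (x + y) h = \<tau> x h + \<tau> y h) \<and>
    (\<forall>x h k. \<tau> x (h + k) = \<tau> x h + \<tau> x k) \<and>
    (\<forall>c x h. \<tau> (c *\<^sub>C x) h = c *\<^sub>C \<tau> x h \<and> \<tau> x (c *\<^sub>C h) = c *\<^sub>C \<tau> x h) \<and>
    (\<forall>x h. \<forall>b\<in>Balg T. \<tau> (act E x b) h = \<tau> x (b h)) \<and>
    (\<forall>x h y k. cinner (\<tau> x h) (\<tau> y k) = cinner h (ip E x y k)) \<and>
    closure (cspan {\<tau> x h |x h. True}) = UNIV"

context
  fixes T :: "'h :: chilbert_space striple"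
    and E :: "('h, 'x :: complex_banach, 'n :: finite) smodule"
    and \<theta> :: "('h \<Rightarrow>\<^sub>L 'h) \<Rightarrow> ('h \<Rightarrow>\<^sub>L 'h) \<Rightarrow> 'w :: complex_banach"
    and \<tau> :: "'x \<Rightarrow> 'h \<Rightarrow> 'k :: chilbert_space"
    and nab :: "'x \<Rightarrow> ('x \<times> 'w) multiset set"
begin

definition nablaD :: "'x \<Rightarrow> 'h \<Rightarrow> 'k"
  where "nablaD x h = tensor_lift (\<lambda>y \<eta>. \<tau> y (piD T \<theta> \<eta> h)) (nab x)"

definition nablaD2 :: "'x \<Rightarrow> 'h \<Rightarrow> 'k"
  where "nablaD2 x h = tensor_lift (\<lambda>y \<eta>. \<tau> (grX E y) (piD2 T \<theta> \<eta> h)) (nab x)"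

text \<open>Unbounded operators on \<open>X \<otimes>\<^sub>B H\<close> are given by their graphs.\<close>

definition tensor_D :: "('k \<times> 'k) set"
  where "tensor_D = closure (cspan
    {(\<tau> x h, \<tau> (grX E x) (Dop T h) + nablaD x h) |x h. x \<in> Xc E \<and> h \<in> Dom T})"

definition tensor_D2 :: "('k \<times> 'k) set"
  where "tensor_D2 = cspan
    {(\<tau> x h, \<tau> x (Dop T (Dop T h)) + nablaD2 x h) |x h. x \<in> Xc E \<and> h \<in> Dom2 T}"

text \<open>The algebraic tensor product with \<open>Dom D\<^sup>2\<close>, as a subspace of \<open>X \<otimes>\<^sub>B H\<close>.\<close>

definition curvature_dom :: "'k set"
  where "curvature_dom = cspan {\<tau> x h |x h. x \<in> Xc E \<and> h \<in> Dom2 T}"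

definition curvature :: "('k \<times> 'k) set"
  where "curvature = {(\<zeta>, \<alpha> - \<beta>) |\<zeta> \<alpha> \<beta>.
    \<zeta> \<in> curvature_dom \<and> (\<zeta>, \<alpha>) \<in> tensor_D O tensor_D \<and> (\<zeta>, \<beta>) \<in> tensor_D2}"

definition omegaD :: "'k \<Rightarrow>\<^sub>L 'k"
  where "omegaD = (THE A :: 'k \<Rightarrow>\<^sub>L 'k. \<forall>x\<in>Xc E. \<forall>h.
    A (\<tau> x h) = tensor_lift (\<lambda>y \<eta>. \<tau> y (piD T \<theta> \<eta> h)) (conn_form T E \<theta> nab x))"

definition vtensor :: "'k \<Rightarrow>\<^sub>L ('h ^ ('n + 'n))"
  where "vtensor = (THE A :: 'k \<Rightarrow>\<^sub>L ('h ^ ('n + 'n)). \<forall>x h. A (\<tau> x h) = (\<chi> i. vv E x i h))"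

text \<open>The commutator \<open>[D, p]\<close> on \<open>H\<^sup>2\<^sup>N\<close>, where \<open>D\<close> stands for \<open>\<gamma> \<otimes> D\<close>.\<close>

definition commDp :: "('h ^ ('n + 'n)) \<Rightarrow>\<^sub>L ('h ^ ('n + 'n))"
  where "commDp = bcomm {\<xi>. \<forall>i. \<xi> $ i \<in> Dom T} (\<lambda>\<xi>. \<chi> i. parity i *\<^sub>R Dop T (\<xi> $ i))
    (matrix_op (pmat E))"

definition piD_delta_form :: "('h ^ ('n + 'n)) \<Rightarrow>\<^sub>L ('h ^ ('n + 'n))"
  where "piD_delta_form =
    matrix_op (\<lambda>i j. parity i *\<^sub>R piD_delta T \<theta> (form_matrix T E \<theta> nab i j))"

end

definition bounded_extension :: "'k :: complex_normed_vector set \<Rightarrow> ('k \<times> 'k) set \<Rightarrow>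
    ('k \<Rightarrow>\<^sub>L 'k) \<Rightarrow> bool"
  where "bounded_extension V G R \<longleftrightarrow>
    bounded_clinear (blinfun_apply R) \<and> G = {(\<zeta>, R \<zeta>) |\<zeta>. \<zeta> \<in> V}"

end

theory Submission
  imports Defs
begin

text \<open>
  Everything is transported to \<open>H\<^sup>2\<^sup>N\<close> by the isometry \<open>v\<close>, whose adjoint sends \<open>e\<^sub>j \<otimes> h\<close> to
  \<open>x\<^sub>j \<otimes> h\<close>, with \<open>v\<^sup>* v = 1\<close> and \<open>v v\<^sup>* = p\<close>. The Leibniz rule
  \<open>\<langle>x\<^sub>i, x\<rangle> D + [D, \<langle>x\<^sub>i, x\<rangle>] = D \<langle>x\<^sub>i, x\<rangle>\<close> shows that the Grassmann connection turns \<open>D\<close> into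
  the compression \<open>v\<^sup>* D v\<close> and \<open>D\<^sup>2\<close> into \<open>v\<^sup>* D\<^sup>2 v\<close>. Hence \<open>1 \<otimes>\<^sub>\<nabla> D = v\<^sup>* D v + \<omega>\<^sub>D\<close> and
  \<open>1 \<otimes>\<^sub>\<nabla> D\<^sup>2 = v\<^sup>* D\<^sup>2 v + (\<gamma> \<otimes> \<pi>\<^bsub>D\<^sup>2\<^esub>)(\<omega>)\<close> (lemmas \<open>conn_D_\<tau>\<close> and \<open>conn_D2_\<tau>\<close>). Squaring the
  first and subtracting the second leaves three kinds of terms.

  The difference \<open>v\<^sup>* D p D v - v\<^sup>* D\<^sup>2 v\<close> is \<open>v\<^sup>* [D, p] [D, p] v\<close>, by the algebra of a
  projection (\<open>U_commDp_commDp\<close>). The term \<open>\<omega>\<^sub>D\<^sup>2\<close> is bounded as it stands. The mixed terms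
  \<open>v\<^sup>* D v \<omega>\<^sub>D + \<omega>\<^sub>D v\<^sup>* D v - (\<gamma> \<otimes> \<pi>\<^bsub>D\<^sup>2\<^esub>)(\<omega>)\<close> may be unbounded one by one, but their sum is
  not: on a universal one-form \<open>\<eta>\<close>, \<open>D \<pi>\<^sub>D(\<eta>) + \<pi>\<^sub>D(\<eta>) D = \<pi>\<^sub>D(\<delta>(\<eta>)) + \<pi>\<^bsub>D\<^sup>2\<^esub>(\<eta>)\<close> (\<open>D_piD\<close>),
  which for \<open>\<eta> = a \<delta>(b)\<close> is the expansion of \<open>[D\<^sup>2, b]\<close> as \<open>D [D, b] + [D, b] D\<close>. Applied to the
  matrix \<open>v \<omega> v\<^sup>*\<close>, which commutes with the grading, this turns the mixed terms into
  \<open>v\<^sup>* \<pi>\<^sub>D(\<delta>(v \<omega> v\<^sup>*)) v\<close> (\<open>DN_M\<close>, \<open>curvature_apply\<close>).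

  The square is that of the closure of \<open>1 \<otimes>\<^sub>\<nabla> D\<close>, which is single-valued because \<open>v\<^sup>* D v\<close> is
  symmetric on a dense domain and \<open>\<omega>\<^sub>D\<close> is bounded (\<open>tensor_D_unique\<close>). That the square is
  defined on the algebraic tensor product with \<open>Dom D\<^sup>2\<close> is seen by writing \<open>\<omega>\<^sub>D \<zeta>\<close> as
  \<open>v\<^sup>* (v \<omega>\<^sub>D \<zeta>)\<close>, a sum of vectors \<open>x\<^sub>j \<otimes> k\<^sub>j\<close> with \<open>k\<^sub>j\<close> in the domain of \<open>D\<close>
  (\<open>conn_D_in_domD\<close>).

  The maps \<open>\<pi>\<^sub>D\<close>, \<open>\<pi>\<^sub>D \<circ> \<delta>\<close> and \<open>\<pi>\<^bsub>D\<^sup>2\<^esub> (D + i)\<inverse>\<close> are built from entries of the representations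
  \<open>\<pi>\<^sup>1\<close> and \<open>\<pi>\<^sup>2\<close>, hence are bounded for the Haagerup norm and extend to the completed tensor
  product (\<open>haagerup_bounded_compose\<close>, \<open>haagerup_ext\<close>); identities between them are checked on
  elementary tensors and extended by continuity, using that \<open>D\<close> and \<open>D\<^sup>2\<close> are closed. For the
  same reason the elements of \<open>B\<^sub>1\<close> preserve the domain of \<open>D\<close>, those of \<open>B\<^sub>2\<close> also that of
  \<open>D\<^sup>2\<close>, and their commutators are the limits of the commutators of approximating elements of
  the algebra.
\<close>

section \<open>Complex inner product spaces\<close>

instance complex_banach \<subseteq> banach ..

instance blinfun :: (real_normed_vector, complex_banach) complex_banach ..

lemma scaleC_minus_one: "(- 1) *\<^sub>C x = - (x :: 'a :: complex_vector)"
  using scaleC_of_real[of "-1" x] by simp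

lemma scaleR_scaleC: "r *\<^sub>R x = of_real r *\<^sub>C (x :: 'a :: complex_vector)"
  by (simp add: scaleC_of_real)

lemma tendsto_scaleC:
  fixes f :: "'b \<Rightarrow> 'a :: complex_normed_vector"
  assumes "(f \<longlongrightarrow> l) F"
  shows "((\<lambda>x. c *\<^sub>C f x) \<longlongrightarrow> c *\<^sub>C l) F"
proof -
  have "bounded_linear (\<lambda>x :: 'a. c *\<^sub>C x)"
    by (rule bounded_linear_intro[where K = "cmod c"])
      (simp_all add: scaleC_add_right scaleR_scaleC scaleC_scaleC norm_scaleC mult.commute)
  from bounded_linear.tendsto[OF this assms] show ?thesis .
qed

lemma continuous_on_scaleC [continuous_intros]:
  fixes f :: "'b :: topological_space \<Rightarrow> 'a :: complex_normed_vector"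
  assumes "continuous_on S f"
  shows "continuous_on S (\<lambda>x. c *\<^sub>C f x)"
  using assms unfolding continuous_on_def by (auto intro: tendsto_scaleC)

lemma cinner_add_left: "cinner (x + y) z = cinner x z + cinner y z"
  by (subst (1 2 3) cinner_commute) (simp add: cinner_add_right)

lemma cinner_scaleC_left: "cinner (c *\<^sub>C x) y = cnj c * cinner x y"
  by (subst (1 2) cinner_commute) (simp add: cinner_scaleC_right)

lemma cinner_zero_right [simp]: "cinner x 0 = 0"
  using cinner_scaleC_right[of x 0 0] by simp

lemma cinner_zero_left [simp]: "cinner 0 x = 0"
  using cinner_scaleC_left[of 0 0 x] by simp

lemma cinner_minus_right: "cinner x (- y) = - cinner x y"
  using cinner_scaleC_right[of x "-1" y] by (simp add: scaleC_minus_one)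

lemma cinner_minus_left: "cinner (- x) y = - cinner x y"
  using cinner_scaleC_left[of "-1" x y] by (simp add: scaleC_minus_one)

lemma cinner_diff_right: "cinner x (y - z) = cinner x y - cinner x z"
  using cinner_add_right[of x y "- z"] by (simp add: cinner_minus_right)

lemma cinner_diff_left: "cinner (x - y) z = cinner x z - cinner y z"
  using cinner_add_left[of x "- y" z] by (simp add: cinner_minus_left)

lemma cinner_sum_right: "cinner x (sum f A) = (\<Sum>a\<in>A. cinner x (f a))"
  by (induction A rule: infinite_finite_induct) (simp_all add: cinner_add_right)

lemma cinner_sum_left: "cinner (sum f A) x = (\<Sum>a\<in>A. cinner (f a) x)"
  by (induction A rule: infinite_finite_induct) (simp_all add: cinner_add_left)

lemma cinner_self: "cinner x x = of_real ((norm x)\<^sup>2)"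
proof -
  have "Im (cinner x x) = 0"
    using cinner_commute[of x x] by (metis complex_cnj_cancel_iff equation_minus_iff cnj.simps(2)
      add.inverse_neutral neg_equal_zero)
  moreover have "Re (cinner x x) = (norm x)\<^sup>2"
    by (simp add: inner_eq_Re_cinner[symmetric] power2_norm_eq_inner)
  ultimately show ?thesis by (simp add: complex_eq_iff)
qed

lemma norm_square_cinner: "(norm x)\<^sup>2 = cmod (cinner x x)"
  unfolding cinner_self norm_of_real by simp

lemma cinner_self_eq_zero [simp]: "cinner x x = 0 \<longleftrightarrow> x = 0"
  by (simp add: cinner_self)

text \<open>Rotating \<open>y\<close> by a phase makes the inner product real, which reduces the claim to the
  Cauchy--Schwarz inequality of the underlying real space.\<close>

lemma cmod_cinner_le: "cmod (cinner x y) \<le> norm x * norm y"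
proof (cases "cinner x y = 0")
  case False
  define u where "u = cnj (cinner x y) / cmod (cinner x y)"
  have u: "cmod u = 1" using False by (simp add: u_def norm_divide)
  have "cinner x (u *\<^sub>C y) = cmod (cinner x y)"
    using False by (simp add: cinner_scaleC_right u_def complex_norm_square[symmetric]
      power2_eq_square field_simps flip: complex_norm_square)
  then have "cmod (cinner x y) = inner x (u *\<^sub>C y)"
    by (simp add: inner_eq_Re_cinner)
  also have "\<dots> \<le> norm x * norm (u *\<^sub>C y)" by (rule norm_cauchy_schwarz)
  finally show ?thesis by (simp add: norm_scaleC u)
qed simp

lemma bounded_bilinear_cinner: "bounded_bilinear cinner"
proof
  show "\<exists>K. \<forall>a b. norm (cinner a b) \<le> norm a * norm b * K"
    by (intro exI[of _ 1]) (simp add: cmod_cinner_le)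
qed (simp_all add: cinner_add_left cinner_add_right scaleR_scaleC cinner_scaleC_left
    cinner_scaleC_right scaleR_conv_of_real)

lemmas tendsto_cinner = bounded_bilinear.tendsto[OF bounded_bilinear_cinner]
lemmas continuous_on_cinner [continuous_intros] =
  bounded_bilinear.continuous_on[OF bounded_bilinear_cinner]

lemma cinner_eqI:
  assumes "closure V = UNIV" "\<And>x. x \<in> V \<Longrightarrow> cinner x y = cinner x z"
  shows "y = z"
proof -
  have "closed {x. cinner x (y - z) = 0}"
    by (intro closed_Collect_eq continuous_intros)
  moreover have "V \<subseteq> {x. cinner x (y - z) = 0}"
    using assms(2) by (auto simp: cinner_diff_right)
  ultimately have "closure V \<subseteq> {x. cinner x (y - z) = 0}"
    by (rule closure_minimal[rotated])
  then have "y - z \<in> {x. cinner x (y - z) = 0}" using assms(1) by blast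
  then show ?thesis by simp
qed

text \<open>The representing vector is the minimiser of \<open>\<parallel>x\<parallel>\<^sup>2 - 2 f x\<close> over \<open>S\<close>, which exists because
  the parallelogram law makes minimising sequences Cauchy. With \<open>S\<close> the whole space this gives
  adjoints, with \<open>S\<close> the graph of \<open>D\<close> it gives the resolvent.\<close>

lemma riesz_on_closed_subspace:
  fixes S :: "'a :: {real_inner, complete_space} set" and f :: "'a \<Rightarrow> real"
  assumes S: "subspace S" "closed S"
    and add: "\<And>x y. x \<in> S \<Longrightarrow> y \<in> S \<Longrightarrow> f (x + y) = f x + f y"
    and scale: "\<And>r x. x \<in> S \<Longrightarrow> f (r *\<^sub>R x) = r * f x"
    and bound: "\<And>x. x \<in> S \<Longrightarrow> \<bar>f x\<bar> \<le> K * norm x"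
  shows "\<exists>z\<in>S. \<forall>x\<in>S. f x = inner x z"
proof -
  define q where "q x = (norm x)\<^sup>2 - 2 * f x" for x
  have bdd: "- K\<^sup>2 \<le> q x" if "x \<in> S" for x
  proof -
    have "0 \<le> (norm x - K)\<^sup>2" by simp
    then show ?thesis using bound[OF that] by (simp add: q_def power2_diff algebra_simps abs_le_iff)
  qed
  define m where "m = Inf (q ` S)"
  have bb: "bdd_below (q ` S)" using bdd by (intro bdd_belowI[of _ "- K\<^sup>2"]) auto
  have ne: "S \<noteq> {}" using S(1) subspace_0 by blast
  have m_le: "m \<le> q x" if "x \<in> S" for x
    unfolding m_def using bb that by (simp add: cInf_lower)
  have "\<exists>x\<in>S. q x < m + 1 / Suc n" for n
  proof -
    have "\<exists>y\<in>q ` S. y < m + 1 / Suc n"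
      by (rule cInf_lessD) (use ne in \<open>simp_all add: m_def\<close>)
    then show ?thesis by blast
  qed
  then obtain s where s: "\<And>n. s n \<in> S" "\<And>n. q (s n) < m + 1 / Suc n" by metis
  have par: "(norm (x - y))\<^sup>2 \<le> 2 * (q x - m) + 2 * (q y - m)" if "x \<in> S" "y \<in> S" for x y
  proof -
    have mid: "(1/2) *\<^sub>R (x + y) \<in> S" using that S(1) by (simp add: subspace_add subspace_scale)
    have "(norm (x - y))\<^sup>2 + (norm (x + y))\<^sup>2 = 2 * (norm x)\<^sup>2 + 2 * (norm y)\<^sup>2"
      by (simp add: power2_norm_eq_inner inner_add inner_diff inner_commute)
    moreover have "q ((1/2) *\<^sub>R (x + y)) = (norm (x + y))\<^sup>2 / 4 - (f x + f y)"
    proof -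
      have "f ((1/2) *\<^sub>R (x + y)) = (f x + f y) / 2"
        using that S(1) scale[of "x + y" "1/2"] add[of x y] by (simp add: subspace_add)
      moreover have "norm ((1/2) *\<^sub>R (x + y)) = norm (x + y) / 2"
        unfolding norm_scaleR by simp
      ultimately show ?thesis by (simp add: q_def power_divide)
    qed
    ultimately show ?thesis using m_le[OF mid] by (simp add: q_def field_simps)
  qed
  have "Cauchy s"
  proof (rule metric_CauchyI)
    fix e :: real assume "0 < e"
    then obtain N :: nat where N: "4 / e\<^sup>2 < N" using reals_Archimedean2 by blast
    show "\<exists>M. \<forall>k\<ge>M. \<forall>n\<ge>M. dist (s k) (s n) < e"
    proof (intro exI[of _ N] allI impI)
      define r :: real where "r = 1 / Suc N"
      have small: "q (s j) < m + r" if "N \<le> j" for j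
        using less_le_trans[OF s(2)[of j], of "m + r"] that by (simp add: r_def frac_le)
      fix k n assume kn: "N \<le> k" "N \<le> n"
      have "(norm (s k - s n))\<^sup>2 < 4 * r"
        using par[OF s(1) s(1), of k n] small[OF kn(1)] small[OF kn(2)]
        by (simp only: right_diff_distrib)
      also have "4 * r = 4 * (1 / real (Suc N))" by (simp add: r_def)
      also have "4 * (1 / real (Suc N)) < e\<^sup>2"
        using N \<open>0 < e\<close> by (simp add: field_simps) (smt (verit) zero_less_power)
      finally show "dist (s k) (s n) < e"
        using \<open>0 < e\<close> by (simp add: dist_norm power2_less_imp_less)
    qed
  qed
  then obtain z where z: "s \<longlonglongrightarrow> z" using convergentD[OF Cauchy_convergent] by blast
  have zS: "z \<in> S" using closed_sequentially[OF S(2) _ z] s(1) by blast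
  have fdiff: "f (x - y) = f x - f y" if "x \<in> S" "y \<in> S" for x y
    using add[OF that(1), of "- y"] scale[OF that(2), of "-1"] that S(1) subspace_neg by fastforce
  have qz: "q z \<le> m"
  proof -
    have "(\<lambda>n. f (s n)) \<longlonglongrightarrow> f z"
    proof (rule LIM_zero_cancel, rule tendsto_rabs_zero_cancel, rule tendsto_sandwich)
      show "\<forall>\<^sub>F n in sequentially. 0 \<le> \<bar>f (s n) - f z\<bar>" by simp
      show "\<forall>\<^sub>F n in sequentially. \<bar>f (s n) - f z\<bar> \<le> K * norm (s n - z)"
        using bound s(1) zS S(1) by (auto simp: fdiff[symmetric] subspace_diff)
      show "(\<lambda>n. K * norm (s n - z)) \<longlonglongrightarrow> 0"
        using z by (intro tendsto_mult_right_zero tendsto_norm_zero LIM_zero)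
    qed simp
    then have "(\<lambda>n. q (s n)) \<longlonglongrightarrow> q z" unfolding q_def by (intro tendsto_intros z)
    moreover have "(\<lambda>n. m + 1 / Suc n) \<longlonglongrightarrow> m + 0"
      by (intro tendsto_intros LIMSEQ_inverse_real_of_nat[unfolded inverse_eq_divide])
    ultimately show ?thesis using s(2) by (intro LIMSEQ_le[of _ _ _ m]) (auto intro: less_imp_le)
  qed
  have "f x = inner x z" if "x \<in> S" for x
  proof (rule ccontr)
    define d where "d = f x - inner x z"
    assume "f x \<noteq> inner x z"
    then have d: "d \<noteq> 0" by (simp add: d_def)
    then have x0: "norm x > 0" using scale[OF that, of 0] by (auto simp: d_def)
    \<comment> \<open>the minimiser of the quadratic polynomial \<open>t \<mapsto> q (z + t x)\<close>\<close>
    define t where "t = d / (norm x)\<^sup>2"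
    have "q (z + t *\<^sub>R x) = q z + t\<^sup>2 * (norm x)\<^sup>2 - 2 * t * d"
      using that zS S(1) unfolding q_def power2_norm_eq_inner
      by (simp add: inner_add inner_commute add scale subspace_scale d_def power2_eq_square
          algebra_simps)
    also have "\<dots> = q z - d\<^sup>2 / (norm x)\<^sup>2"
      using x0 by (simp add: t_def field_simps power2_eq_square)
    also have "\<dots> < q z" using d x0 by simp
    also note qz
    also have "m \<le> q (z + t *\<^sub>R x)"
      using that zS S(1) by (intro m_le) (simp add: subspace_add subspace_scale)
    finally show False by simp
  qed
  with zS show ?thesis by blast
qed

section \<open>Bounded complex-linear operators and adjoints\<close>

lemma bounded_clinear_linear: "bounded_clinear f \<Longrightarrow> bounded_linear f"
  by (simp add: bounded_clinear_def)

lemma bounded_clinear_scaleC: "bounded_clinear f \<Longrightarrow> f (c *\<^sub>C x) = c *\<^sub>C f x"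
  by (simp add: bounded_clinear_def)

abbreviation clinear_op :: "('a :: complex_normed_vector \<Rightarrow>\<^sub>L 'b :: complex_normed_vector) \<Rightarrow> bool"
  where "clinear_op A \<equiv> bounded_clinear (blinfun_apply A)"

lemma clinear_op_iff: "clinear_op A \<longleftrightarrow> (\<forall>c x. A (c *\<^sub>C x) = c *\<^sub>C A x)"
  by (simp add: bounded_clinear_def blinfun.bounded_linear_right)

lemma clinear_op_add: "clinear_op A \<Longrightarrow> clinear_op B \<Longrightarrow> clinear_op (A + B)"
  by (simp add: clinear_op_iff blinfun.add_left scaleC_add_right)

lemma clinear_op_scaleR: "clinear_op A \<Longrightarrow> clinear_op (r *\<^sub>R A)"
  unfolding clinear_op_iff blinfun.scaleR_left
  by (simp add: scaleR_scaleC[of r] scaleC_scaleC mult.commute)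

lemma clinear_op_scaleC: "clinear_op A \<Longrightarrow> clinear_op (c *\<^sub>C A)"
  unfolding clinear_op_iff unfolding scaleC_blinfun.rep_eq by (simp add: scaleC_scaleC mult.commute)

lemma clinear_op_compose: "clinear_op A \<Longrightarrow> clinear_op B \<Longrightarrow> clinear_op (A o\<^sub>L B)"
  by (simp add: clinear_op_iff)

lemma clinear_op_0: "clinear_op 0"
  by (simp add: clinear_op_iff)

lemma clinear_op_id: "clinear_op id_blinfun"
  unfolding clinear_op_iff by simp

lemma clinear_op_compose_scaleC: "clinear_op A \<Longrightarrow> A o\<^sub>L (c *\<^sub>C B) = c *\<^sub>C (A o\<^sub>L B)"
  by (rule blinfun_eqI) (simp add: clinear_op_iff scaleC_blinfun.rep_eq)

lemma scaleC_compose_blinfun: "(c *\<^sub>C A) o\<^sub>L B = c *\<^sub>C (A o\<^sub>L B)"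
  by (rule blinfun_eqI) (simp add: scaleC_blinfun.rep_eq)

lemma closed_clinear_op:
  "closed {A :: 'a :: complex_normed_vector \<Rightarrow>\<^sub>L 'b :: complex_normed_vector. clinear_op A}"
  unfolding clinear_op_iff
  by (intro closed_Collect_all closed_Collect_eq continuous_intros)

text \<open>The real Riesz theorem matches only real parts; replacing \<open>x\<close> by \<open>\<i> x\<close> gives the imaginary
  parts, which is where complex linearity of \<open>A\<close> enters.\<close>

lemma ex_adjoint:
  fixes A :: "'a :: chilbert_space \<Rightarrow>\<^sub>L 'b :: complex_inner"
  assumes A: "clinear_op A"
  shows "\<exists>B :: 'b \<Rightarrow>\<^sub>L 'a. \<forall>x y. cinner (A x) y = cinner x (B y)"
proof -
  have "\<exists>z. \<forall>x. cinner (A x) y = cinner x z" for y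
  proof -
    have "\<exists>z\<in>UNIV. \<forall>x\<in>UNIV. inner (A x) y = inner x z"
    proof (rule riesz_on_closed_subspace)
      fix x :: 'a
      have "\<bar>inner (A x) y\<bar> \<le> norm (A x) * norm y" by (rule Cauchy_Schwarz_ineq2)
      also have "\<dots> \<le> (norm A * norm x) * norm y"
        by (intro mult_right_mono norm_blinfun) simp
      finally show "\<bar>inner (A x) y\<bar> \<le> (norm A * norm y) * norm x" by (simp add: mult_ac)
    qed (simp_all add: blinfun.add_right blinfun.scaleR_right inner_add)
    then obtain z where z: "\<And>x. inner (A x) y = inner x z" by blast
    have "cinner (A x) y = cinner x z" for x
    proof (rule complex_eqI)
      show "Re (cinner (A x) y) = Re (cinner x z)"
        using z[of x] by (simp add: inner_eq_Re_cinner)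
      have "Re (cinner (A (\<i> *\<^sub>C x)) y) = Re (cinner (\<i> *\<^sub>C x) z)"
        using z[of "\<i> *\<^sub>C x"] by (simp add: inner_eq_Re_cinner)
      then show "Im (cinner (A x) y) = Im (cinner x z)"
        using A by (simp add: clinear_op_iff cinner_scaleC_left)
    qed
    then show ?thesis by blast
  qed
  then obtain g where g: "\<And>x y. cinner (A x) y = cinner x (g y)" by metis
  have "bounded_linear g"
  proof (rule bounded_linear_intro[where K = "norm A"])
    show "g (y + y') = g y + g y'" for y y'
      by (rule cinner_eqI[of UNIV]) (simp_all add: g[symmetric] cinner_add_right)
    show "g (r *\<^sub>R y) = r *\<^sub>R g y" for r y
      by (rule cinner_eqI[of UNIV])
        (simp_all add: g[symmetric] scaleR_scaleC cinner_scaleC_right)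
    show "norm (g y) \<le> norm y * norm A" for y
    proof -
      have "(norm (g y))\<^sup>2 = cmod (cinner (g y) (g y))" by (rule norm_square_cinner)
      also have "\<dots> = cmod (cinner (A (g y)) y)" by (simp add: g)
      also have "\<dots> \<le> norm (A (g y)) * norm y" by (rule cmod_cinner_le)
      also have "\<dots> \<le> (norm A * norm (g y)) * norm y" by (intro mult_right_mono norm_blinfun) simp
      finally have "norm (g y) * norm (g y) \<le> norm (g y) * (norm y * norm A)"
        by (simp add: power2_eq_square mult_ac)
      then show ?thesis
        by (cases "norm (g y) = 0") (auto simp: mult_le_cancel_left)
    qed
  qed
  then show ?thesis using g by (intro exI[of _ "Blinfun g"]) (simp add: bounded_linear_Blinfun_apply)
qed

lemma adjoint_unique:
  fixes A :: "'a :: complex_inner \<Rightarrow>\<^sub>L 'b :: complex_inner" and B B' :: "'b \<Rightarrow>\<^sub>L 'a"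
  assumes "\<And>x y. cinner (A x) y = cinner x (B y)" "\<And>x y. cinner (A x) y = cinner x (B' y)"
  shows "B = B'"
  by (rule blinfun_eqI, rule cinner_eqI[of UNIV]) (simp_all flip: assms)

lemma cadj_eqI:
  fixes A :: "'a :: complex_inner \<Rightarrow>\<^sub>L 'b :: complex_inner" and B :: "'b \<Rightarrow>\<^sub>L 'a"
  assumes "\<And>x y. cinner (A x) y = cinner x (B y)"
  shows "cadj A = B"
  unfolding cadj_def by (rule the_equality) (use assms adjoint_unique in blast)+

context
  fixes A :: "'a :: chilbert_space \<Rightarrow>\<^sub>L 'b :: complex_inner"
  assumes A: "clinear_op A"
begin

lemma cadj_right: "cinner (A x) y = cinner x (cadj A y)"
  using ex_adjoint[OF A] cadj_eqI by metis

lemma cadj_left: "cinner (cadj A y) x = cinner y (A x)"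
  by (metis cadj_right cinner_commute)

lemma clinear_op_cadj: "clinear_op (cadj A)"
  unfolding clinear_op_iff
  by (intro allI cinner_eqI[of UNIV]) (simp_all add: cadj_right[symmetric] cinner_scaleC_right)

lemma norm_cadj_le: "norm (cadj A) \<le> norm A"
proof (rule norm_blinfun_bound)
  fix y
  have "(norm (cadj A y))\<^sup>2 = cmod (cinner (cadj A y) (cadj A y))"
    by (rule norm_square_cinner)
  also have "\<dots> = cmod (cinner y (A (cadj A y)))" by (simp add: cadj_left)
  also have "\<dots> \<le> norm y * norm (A (cadj A y))" by (rule cmod_cinner_le)
  also have "\<dots> \<le> norm y * (norm A * norm (cadj A y))" by (intro mult_left_mono norm_blinfun) simp
  finally have "norm (cadj A y) * norm (cadj A y) \<le> norm (cadj A y) * (norm A * norm y)"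
    by (simp add: power2_eq_square mult_ac)
  then show "norm (cadj A y) \<le> norm A * norm y"
    by (cases "norm (cadj A y) = 0") (auto simp: mult_le_cancel_left)
qed simp

end

lemma cadj_cadj:
  fixes A :: "'a :: chilbert_space \<Rightarrow>\<^sub>L 'b :: complex_inner"
  assumes "clinear_op A"
  shows "cadj (cadj A) = A"
  by (rule cadj_eqI) (rule cadj_left[OF assms])

lemma cadj_add:
  fixes A B :: "'a :: chilbert_space \<Rightarrow>\<^sub>L 'b :: complex_inner"
  assumes "clinear_op A" "clinear_op B"
  shows "cadj (A + B) = cadj A + cadj B"
  by (rule cadj_eqI)
    (simp add: blinfun.add_left cinner_add_left cinner_add_right cadj_right assms)

lemma cadj_scaleC:
  fixes A :: "'a :: chilbert_space \<Rightarrow>\<^sub>L 'b :: complex_inner"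
  assumes "clinear_op A"
  shows "cadj (c *\<^sub>C A) = cnj c *\<^sub>C cadj A"
  by (rule cadj_eqI)
    (simp add: scaleC_blinfun.rep_eq cinner_scaleC_left cinner_scaleC_right cadj_right assms)

lemma cadj_compose:
  fixes A :: "'b :: chilbert_space \<Rightarrow>\<^sub>L 'c :: complex_inner" and B :: "'a :: chilbert_space \<Rightarrow>\<^sub>L 'b"
  assumes "clinear_op A" "clinear_op B"
  shows "cadj (A o\<^sub>L B) = cadj B o\<^sub>L cadj A"
  by (rule cadj_eqI) (simp add: cadj_right assms)

lemma tendsto_cadj:
  fixes s :: "nat \<Rightarrow> 'a :: chilbert_space \<Rightarrow>\<^sub>L 'b :: complex_inner"
  assumes "\<And>n. clinear_op (s n)" "clinear_op A" "s \<longlonglongrightarrow> A"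
  shows "(\<lambda>n. cadj (s n)) \<longlonglongrightarrow> cadj A"
proof (rule LIM_zero_cancel, rule Lim_null_comparison)
  show "(\<lambda>n. norm (s n - A)) \<longlonglongrightarrow> 0" using assms(3) by (intro tendsto_norm_zero LIM_zero)
  have "cadj (s n) - cadj A = cadj (s n - A)" for n
    using cadj_add[OF assms(1) clinear_op_scaleC[OF assms(2)], of n "-1"]
      cadj_scaleC[OF assms(2), of "-1"]
    by (simp add: scaleC_minus_one)
  moreover have "norm (cadj (s n - A)) \<le> norm (s n - A)" for n
    using norm_cadj_le[OF clinear_op_add[OF assms(1) clinear_op_scaleC[OF assms(2)]], of n "-1"]
    by (simp add: scaleC_minus_one)
  ultimately show "\<forall>\<^sub>F n in sequentially. norm (cadj (s n) - cadj A) \<le> norm (s n - A)" by simp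
qed

section \<open>Extension from dense subspaces, spans and operator matrices\<close>

lemma Cauchy_dist_le:
  assumes g: "Cauchy g" and le: "\<And>m n. dist (f m) (f n) \<le> K * dist (g m) (g n)"
  shows "Cauchy f"
proof (rule metric_CauchyI)
  fix e :: real assume e: "0 < e"
  define L where "L = max K 1"
  have "0 < e / L" using e by (simp add: L_def)
  then obtain M where M: "\<And>m n. m \<ge> M \<Longrightarrow> n \<ge> M \<Longrightarrow> dist (g m) (g n) < e / L"
    using metric_CauchyD[OF g] by blast
  have "dist (f m) (f n) < e" if "m \<ge> M" "n \<ge> M" for m n
  proof -
    have "dist (f m) (f n) \<le> L * dist (g m) (g n)"
      by (rule order.trans[OF le mult_right_mono]) (simp_all add: L_def)
    also have "\<dots> < e" using M[OF that] by (simp add: L_def field_simps)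
    finally show ?thesis .
  qed
  then show "\<exists>M. \<forall>m\<ge>M. \<forall>n\<ge>M. dist (f m) (f n) < e" by blast
qed

lemma bounded_clinear_eq_on_dense:
  assumes "bounded_clinear f" "bounded_clinear g" "closure S = UNIV" "\<And>x. x \<in> S \<Longrightarrow> f x = g x"
  shows "f = g"
proof
  fix x
  have "closed {x. f x = g x}"
    using assms(1,2) by (intro closed_Collect_eq linear_continuous_on bounded_clinear_linear)
  then have "closure S \<subseteq> {x. f x = g x}" using assms(4) by (intro closure_minimal) auto
  then show "f x = g x" using assms(3) by auto
qed

lemma blinfun_eq_on_dense:
  assumes "closure S = UNIV" "\<And>x. x \<in> S \<Longrightarrow> blinfun_apply A x = blinfun_apply B x"
  shows "A = B"
proof (rule blinfun_eqI)
  fix x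
  have "closed {x. A x = B x}" by (intro closed_Collect_eq continuous_intros)
  then have "closure S \<subseteq> {x. A x = B x}" using assms(2) by (intro closure_minimal) auto
  then show "A x = B x" using assms(1) by auto
qed

lemma bounded_clinear_extension:
  fixes g :: "'a :: complex_normed_vector \<Rightarrow> 'b :: complex_banach"
  assumes S: "csubspace S" "closure S = UNIV"
    and add: "\<And>x y. x \<in> S \<Longrightarrow> y \<in> S \<Longrightarrow> g (x + y) = g x + g y"
    and scale: "\<And>c x. x \<in> S \<Longrightarrow> g (c *\<^sub>C x) = c *\<^sub>C g x"
    and bound: "\<And>x. x \<in> S \<Longrightarrow> norm (g x) \<le> K * norm x"
  shows "\<exists>F. bounded_clinear F \<and> (\<forall>x\<in>S. F x = g x)"
proof -
  note sub = complex_vector.subspace_add[OF S(1)] complex_vector.subspace_scale[OF S(1)]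
    complex_vector.subspace_diff[OF S(1)]
  have gdiff: "g (x - y) = g x - g y" if "x \<in> S" "y \<in> S" for x y
    using add[OF that(1) sub(2)[OF that(2), of "-1"]] scale[OF that(2), of "-1"]
    by (simp add: scaleC_minus_one)
  define L where "L = max K 1"
  have L: "norm (g x) \<le> L * norm x" if "x \<in> S" for x
    using bound[OF that] mult_right_mono[of K L "norm x"] by (auto simp: L_def)
  have "L-lipschitz_on S g"
  proof (rule lipschitz_onI)
    show "dist (g x) (g y) \<le> L * dist x y" if "x \<in> S" "y \<in> S" for x y
      using L[OF sub(3)[OF that]] that by (simp add: dist_norm gdiff)
  qed (simp add: L_def)
  then have "uniformly_continuous_on S g" by (rule lipschitz_on_uniformly_continuous)
  then obtain F where F: "uniformly_continuous_on (closure S) F" "\<And>x. x \<in> S \<Longrightarrow> g x = F x"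
    by (rule uniformly_continuous_on_extension_on_closure) metis
  have cont: "continuous_on UNIV F"
    using uniformly_continuous_imp_continuous[OF F(1)] S(2) by simp
  have app: "\<exists>s. (\<forall>n. s n \<in> S) \<and> s \<longlonglongrightarrow> x" for x
    using S(2) closure_sequential[of x S] by simp
  have lim: "(\<lambda>n. F (s n)) \<longlonglongrightarrow> F x" if "s \<longlonglongrightarrow> x" for s x
    using continuous_on_tendsto_compose[OF cont that] by simp
  have Fadd: "F (x + y) = F x + F y" for x y
  proof -
    obtain s t where st: "\<And>n. s n \<in> S" "s \<longlonglongrightarrow> x" "\<And>n. t n \<in> S" "t \<longlonglongrightarrow> y" using app by metis
    have "(\<lambda>n. F (s n + t n)) \<longlonglongrightarrow> F (x + y)" by (intro lim tendsto_intros st)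
    moreover have "F (s n + t n) = F (s n) + F (t n)" for n
      using st add sub(1) by (simp flip: F(2))
    ultimately have "(\<lambda>n. F (s n) + F (t n)) \<longlonglongrightarrow> F (x + y)" by simp
    moreover have "(\<lambda>n. F (s n) + F (t n)) \<longlonglongrightarrow> F x + F y" by (intro tendsto_intros lim st)
    ultimately show ?thesis by (rule LIMSEQ_unique)
  qed
  have Fscale: "F (c *\<^sub>C x) = c *\<^sub>C F x" for c x
  proof -
    obtain s where st: "\<And>n. s n \<in> S" "s \<longlonglongrightarrow> x" using app by metis
    have "(\<lambda>n. F (c *\<^sub>C s n)) \<longlonglongrightarrow> F (c *\<^sub>C x)" by (intro lim tendsto_scaleC st)
    moreover have "F (c *\<^sub>C s n) = c *\<^sub>C F (s n)" for n
      using st scale sub(2) by (simp flip: F(2))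
    ultimately have "(\<lambda>n. c *\<^sub>C F (s n)) \<longlonglongrightarrow> F (c *\<^sub>C x)" by simp
    moreover have "(\<lambda>n. c *\<^sub>C F (s n)) \<longlonglongrightarrow> c *\<^sub>C F x" by (intro tendsto_scaleC lim st)
    ultimately show ?thesis by (rule LIMSEQ_unique)
  qed
  have Fbound: "norm (F x) \<le> L * norm x" for x
  proof -
    obtain s where st: "\<And>n. s n \<in> S" "s \<longlonglongrightarrow> x" using app by metis
    have "norm (F (s n)) \<le> L * norm (s n)" for n
      using L[OF st(1)[of n]] by (simp add: F(2) st)
    then show ?thesis
      by (intro LIMSEQ_le[of "\<lambda>n. norm (F (s n))" _ "\<lambda>n. L * norm (s n)"] tendsto_intros lim st) auto
  qed
  have "bounded_clinear F"
    unfolding bounded_clinear_def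
    by (intro conjI allI bounded_linear_intro[where K = L])
      (use Fbound in \<open>simp_all add: Fadd Fscale scaleR_scaleC mult.commute\<close>)
  then show ?thesis using F(2) by metis
qed

lemma tendsto_bounded_clinear:
  "bounded_clinear f \<Longrightarrow> (g \<longlongrightarrow> l) F \<Longrightarrow> ((\<lambda>x. f (g x)) \<longlongrightarrow> f l) F"
  by (rule bounded_linear.tendsto[OF bounded_clinear_linear])

lemma tendsto_blinfun_apply:
  "(A \<longlongrightarrow> B) F \<Longrightarrow> (g \<longlongrightarrow> l) F \<Longrightarrow> ((\<lambda>x. blinfun_apply (A x) (g x)) \<longlongrightarrow> blinfun_apply B l) F"
  by (rule bounded_bilinear.tendsto[OF bounded_bilinear_blinfun_apply])

lemma tendsto_blinfun_compose:
  "(A \<longlongrightarrow> B) F \<Longrightarrow> (A' \<longlongrightarrow> B') F \<Longrightarrow> ((\<lambda>x. A x o\<^sub>L A' x) \<longlongrightarrow> B o\<^sub>L B') F"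
  by (rule bounded_bilinear.tendsto[OF bounded_bilinear_blinfun_compose])

lemmas blinfun_compose_add_left = bounded_bilinear.add_left[OF bounded_bilinear_blinfun_compose]
lemmas blinfun_compose_add_right = bounded_bilinear.add_right[OF bounded_bilinear_blinfun_compose]

lemma blinfun_compose_assoc: "(A o\<^sub>L B) o\<^sub>L C = A o\<^sub>L (B o\<^sub>L C)"
  by (rule blinfun_eqI) simp

lemma blinfun_compose_id [simp]: "id_blinfun o\<^sub>L A = A" "A o\<^sub>L id_blinfun = A"
  by (rule blinfun_eqI; simp)+

lemma blinfun_compose_scaleR_left: "(r *\<^sub>R A) o\<^sub>L B = r *\<^sub>R (A o\<^sub>L B)"
  by (rule blinfun_eqI) (simp add: blinfun.scaleR_left)

lemma cadj_scaleR:
  fixes A :: "'a :: chilbert_space \<Rightarrow>\<^sub>L 'b :: complex_inner"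
  assumes "clinear_op A"
  shows "cadj (r *\<^sub>R A) = r *\<^sub>R cadj A"
  using cadj_scaleC[OF assms, of "of_real r"] by (simp add: scaleC_of_real)

lemma csubspace_closure:
  fixes S :: "'a :: complex_normed_vector set"
  assumes "csubspace S" shows "csubspace (closure S)"
  unfolding complex_vector.subspace_def
proof (intro conjI ballI allI)
  show "0 \<in> closure S"
    using complex_vector.subspace_0[OF assms] closure_subset by blast
next
  fix x y assume "x \<in> closure S" "y \<in> closure S"
  then obtain s t where "\<And>n. s n \<in> S" "s \<longlonglongrightarrow> x" "\<And>n. t n \<in> S" "t \<longlonglongrightarrow> y"
    unfolding closure_sequential by blast
  then show "x + y \<in> closure S"
    unfolding closure_sequential
    by (intro exI[of _ "\<lambda>n. s n + t n"]) (simp add: tendsto_add complex_vector.subspace_add[OF assms])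
next
  fix c x assume "x \<in> closure S"
  then obtain s where "\<And>n. s n \<in> S" "s \<longlonglongrightarrow> x" unfolding closure_sequential by blast
  then show "c *\<^sub>C x \<in> closure S"
    unfolding closure_sequential
    by (intro exI[of _ "\<lambda>n. c *\<^sub>C s n"]) (simp add: tendsto_scaleC complex_vector.subspace_scale[OF assms])
qed

text \<open>The operators \<open>1 \<otimes>\<^sub>\<nabla> D\<close> and \<open>1 \<otimes>\<^sub>\<nabla> D\<^sup>2\<close> are given as spans of pairs, which need not be
  graphs in general. Exhibiting one formula \<open>F\<close> that is linear on a subspace containing all
  generators shows that they are.\<close>

lemma cspan_graph:
  assumes W: "csubspace W" "G \<subseteq> W"
    and F: "\<And>c z y. z \<in> W \<Longrightarrow> y \<in> W \<Longrightarrow> F (c *\<^sub>C z + y) = c *\<^sub>C F z + F y"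
  shows "cspan {(z, F z) |z. z \<in> G} = {(z, F z) |z. z \<in> cspan G}"
proof -
  have F0: "F 0 = 0" using F[of 0 0 1] complex_vector.subspace_0[OF W(1)] by (simp add: scaleC_one)
  have sub: "z \<in> W" if "z \<in> cspan G" for z
    using that complex_vector.span_minimal[OF W(2,1)] by blast
  have "\<exists>z\<in>cspan G. p = (z, F z)" if "p \<in> cspan {(z, F z) |z. z \<in> G}" for p
    using that
  proof (induction rule: complex_vector.span_induct_alt)
    case base
    then show ?case using complex_vector.span_zero F0 by (intro bexI[of _ 0]) (simp_all add: zero_prod_def)
  next
    case (step c q p)
    then obtain z y where zy: "q = (z, F z)" "z \<in> G" "p = (y, F y)" "y \<in> cspan G" by blast
    then show ?case
      by (intro bexI[of _ "c *\<^sub>C z + y"])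
        (simp_all add: scaleC_prod_def F subsetD[OF W(2)] sub complex_vector.span_add
          complex_vector.span_scale complex_vector.span_base)
  qed
  moreover have "(z, F z) \<in> cspan {(z, F z) |z. z \<in> G}" if "z \<in> cspan G" for z
  proof -
    have "z \<in> cspan G \<and> (z, F z) \<in> cspan {(z, F z) |z. z \<in> G}"
      using that
    proof (induction rule: complex_vector.span_induct_alt)
      case base
      then show ?case
        using complex_vector.span_zero[of "{(z, F z) |z. z \<in> G}"] complex_vector.span_zero
        by (simp add: F0 zero_prod_def)
    next
      case (step c z y)
      have zG: "(z, F z) \<in> {(z, F z) |z. z \<in> G}" using step(1) by blast
      have eq: "(c *\<^sub>C z + y, F (c *\<^sub>C z + y)) = c *\<^sub>C (z, F z) + (y, F y)"
        using step subsetD[OF W(2)] by (simp add: scaleC_prod_def F sub)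
      show ?case
        unfolding eq using step
        by (intro conjI complex_vector.span_add complex_vector.span_scale complex_vector.span_base[OF zG])
          (auto intro: complex_vector.span_base)
    qed
    then show ?thesis ..
  qed
  ultimately show ?thesis by blast
qed

lemma bcomm_eqI:
  fixes A b :: "'a :: complex_inner \<Rightarrow>\<^sub>L 'a"
  assumes "closure S = UNIV" "\<And>h. h \<in> S \<Longrightarrow> blinfun_apply A h = D (b h) - b (D h)"
  shows "bcomm S D b = A"
  unfolding bcomm_def
  by (rule the_equality) (use assms(2) in \<open>auto intro!: blinfun_eq_on_dense[OF assms(1)]\<close>)

lemma bounded_clinear_ident: "bounded_clinear (\<lambda>x. x)"
  by (simp add: bounded_clinear_def bounded_linear_ident)

lemma bounded_clinear_compose:
  "bounded_clinear f \<Longrightarrow> bounded_clinear g \<Longrightarrow> bounded_clinear (\<lambda>x. f (g x))"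
  by (simp add: bounded_clinear_def bounded_linear_compose)

lemma bounded_clinear_add:
  "bounded_clinear f \<Longrightarrow> bounded_clinear g \<Longrightarrow> bounded_clinear (\<lambda>x. f x + g x)"
  by (simp add: bounded_clinear_def bounded_linear_add scaleC_add_right)

lemma bounded_clinear_scale:
  "bounded_clinear f \<Longrightarrow> bounded_clinear (\<lambda>x. c *\<^sub>C f x)"
  unfolding bounded_clinear_def
proof (intro conjI allI, elim conjE)
  assume f: "bounded_linear f"
  have "bounded_linear (\<lambda>x :: 'b. c *\<^sub>C x)"
    by (rule bounded_linear_intro[where K = "cmod c"])
      (simp_all add: scaleC_add_right scaleR_scaleC scaleC_scaleC norm_scaleC mult.commute)
  from bounded_linear_compose[OF this f] show "bounded_linear (\<lambda>x. c *\<^sub>C f x)" .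
qed (simp add: scaleC_scaleC mult.commute)

lemma bounded_clinear_compose_left:
  assumes "clinear_op A" "bounded_clinear f"
  shows "bounded_clinear (\<lambda>x. A o\<^sub>L f x)"
  unfolding bounded_clinear_def
  using assms bounded_linear_compose[OF
      bounded_bilinear.bounded_linear_right[OF bounded_bilinear_blinfun_compose] bounded_clinear_linear]
  by (auto simp: bounded_clinear_scaleC clinear_op_compose_scaleC)

lemma bounded_clinear_compose_right:
  assumes "bounded_clinear f"
  shows "bounded_clinear (\<lambda>x. f x o\<^sub>L A)"
  unfolding bounded_clinear_def
  using assms bounded_linear_compose[OF
      bounded_bilinear.bounded_linear_left[OF bounded_bilinear_blinfun_compose] bounded_clinear_linear]
  by (auto simp: bounded_clinear_scaleC scaleC_compose_blinfun)

lemma bounded_clinear_apply: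
  "bounded_clinear f \<Longrightarrow> bounded_clinear (\<lambda>x. blinfun_apply (f x) h)"
  unfolding bounded_clinear_def
  by (auto simp: scaleC_blinfun.rep_eq intro: bounded_linear_compose[OF
        bounded_bilinear.bounded_linear_left[OF bounded_bilinear_blinfun_apply]])

lemma bounded_clinear_vec_nth: "bounded_clinear (\<lambda>\<xi> :: ('a :: complex_inner) ^ 'i :: finite. \<xi> $ i)"
  by (simp add: bounded_clinear_def bounded_linear_vec_nth scaleC_vec_def)

lemma bounded_clinear_zero: "bounded_clinear f \<Longrightarrow> f 0 = 0"
  using bounded_clinear_scaleC[of f 0 0] by simp

lemma bounded_clinear_add_apply: "bounded_clinear f \<Longrightarrow> f (x + y) = f x + f y"
  by (simp add: bounded_clinear_def linear_simps(1))

lemma bounded_clinear_minus: "bounded_clinear f \<Longrightarrow> f (- x) = - f x"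
  using bounded_clinear_scaleC[of f "-1" x] by (simp add: scaleC_minus_one)

lemma bounded_clinear_diff: "bounded_clinear f \<Longrightarrow> f (x - y) = f x - f y"
  using bounded_clinear_add_apply[of f x "- y"] by (simp add: bounded_clinear_minus)

lemma bounded_clinear_sum: "bounded_clinear f \<Longrightarrow> f (\<Sum>k\<in>I. g k) = (\<Sum>k\<in>I. f (g k))"
  by (induction I rule: infinite_finite_induct)
    (simp_all add: bounded_clinear_zero bounded_clinear_add_apply)

lemma bounded_clinear_sum_mset: "bounded_clinear f \<Longrightarrow> f (\<Sum>x\<in>#u. g x) = (\<Sum>x\<in>#u. f (g x))"
  by (induction u) (simp_all add: bounded_clinear_zero bounded_clinear_add_apply)

lemma bounded_clinear_sum_mset_Pair:
  "bounded_clinear F \<Longrightarrow> F (\<Sum>(x, y)\<in>#u. f x y) = (\<Sum>(x, y)\<in>#u. F (f x y))"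
  by (induction u) (auto simp: bounded_clinear_zero bounded_clinear_add_apply)

lemma bounded_linear_matrix:
  "bounded_linear (\<lambda>\<xi> :: ('h :: real_normed_vector) ^ 'i :: finite. \<chi> i. \<Sum>j\<in>UNIV. blinfun_apply (A i j) (\<xi> $ j))"
proof -
  have nb: "norm (\<xi> $ j) \<le> norm \<xi>" for \<xi> :: "'h ^ 'i" and j by (rule Finite_Cartesian_Product.norm_nth_le)
  show ?thesis
  proof (rule bounded_linear_intro[where K = "\<Sum>i\<in>UNIV. \<Sum>j\<in>UNIV. norm (A i j)"])
    fix \<xi> :: "'h ^ 'i"
    have "norm (\<chi> i. \<Sum>j\<in>UNIV. A i j (\<xi> $ j)) \<le> (\<Sum>i\<in>UNIV. norm (\<Sum>j\<in>UNIV. A i j (\<xi> $ j)))"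
      unfolding norm_vec_def by (rule order.trans[OF L2_set_le_sum]) simp_all
    also have "\<dots> \<le> (\<Sum>i\<in>UNIV. \<Sum>j\<in>UNIV. norm (A i j) * norm \<xi>)"
      by (intro sum_mono order.trans[OF norm_sum] order.trans[OF norm_blinfun] mult_left_mono nb) simp
    finally show "norm (\<chi> i. \<Sum>j\<in>UNIV. A i j (\<xi> $ j)) \<le> norm \<xi> * (\<Sum>i\<in>UNIV. \<Sum>j\<in>UNIV. norm (A i j))"
      by (simp add: sum_distrib_left mult.commute)
  qed (simp_all add: vec_eq_iff blinfun.add_right blinfun.scaleR_right sum.distrib scaleR_sum_right)
qed

lemma matrix_op_apply: "matrix_op A \<xi> = (\<chi> i. \<Sum>j\<in>UNIV. A i j (\<xi> $ j))"
  unfolding matrix_op_def by (simp add: bounded_linear_Blinfun_apply[OF bounded_linear_matrix])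

lemma clinear_op_matrix_op:
  "(\<And>i j. clinear_op (A i j)) \<Longrightarrow> clinear_op (matrix_op A)"
  unfolding clinear_op_iff
  by (simp add: matrix_op_apply vec_eq_iff scaleC_vec_def complex_vector.scale_sum_right)

section \<open>Commutators with an unbounded self-adjoint operator\<close>

locale spectral_triple =
  fixes T :: "'h :: chilbert_space striple"
  assumes C2: "C2_spectral_triple T"
begin

abbreviation "D \<equiv> Dop T"

lemma selfadjoint: "selfadjoint_on (Dom T) D"
  using C2 by (simp add: C2_spectral_triple_def)

lemma csubspace_Dom: "csubspace (Dom T)"
  and dense_Dom: "closure (Dom T) = UNIV"
  and D_add: "x \<in> Dom T \<Longrightarrow> y \<in> Dom T \<Longrightarrow> D (x + y) = D x + D y"
  and D_scaleC: "x \<in> Dom T \<Longrightarrow> D (c *\<^sub>C x) = c *\<^sub>C D x"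
  and D_symmetric: "x \<in> Dom T \<Longrightarrow> y \<in> Dom T \<Longrightarrow> cinner (D x) y = cinner x (D y)"
  using selfadjoint unfolding selfadjoint_on_def by blast+

lemmas Dom_add = complex_vector.subspace_add[OF csubspace_Dom]
lemmas Dom_scaleC = complex_vector.subspace_scale[OF csubspace_Dom]
lemmas Dom_diff = complex_vector.subspace_diff[OF csubspace_Dom]
lemmas Dom_0 = complex_vector.subspace_0[OF csubspace_Dom]
lemmas Dom_sum = complex_vector.subspace_sum[OF csubspace_Dom]

lemma D_0 [simp]: "D 0 = 0"
  using D_scaleC[OF Dom_0, of 0] by simp

lemma D_diff: "x \<in> Dom T \<Longrightarrow> y \<in> Dom T \<Longrightarrow> D (x - y) = D x - D y"
  using D_add[of x "- y"] D_scaleC[of y "-1"] Dom_scaleC[of y "-1"]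
  by (simp add: scaleC_minus_one)

lemma D_scaleR: "x \<in> Dom T \<Longrightarrow> D (r *\<^sub>R x) = r *\<^sub>R D x"
  by (simp add: scaleR_scaleC D_scaleC)

lemma Dom_scaleR: "x \<in> Dom T \<Longrightarrow> r *\<^sub>R x \<in> Dom T"
  by (simp add: scaleR_scaleC Dom_scaleC)

lemma D_sum: "(\<And>a. a \<in> I \<Longrightarrow> f a \<in> Dom T) \<Longrightarrow> D (sum f I) = (\<Sum>a\<in>I. D (f a))"
  by (induction I rule: infinite_finite_induct) (simp_all add: D_add Dom_sum)

text \<open>The maximality clause of self-adjointness. It is the source of the closedness of \<open>D\<close>, of
  its resolvent, and of the fact that adjoints of operators preserving \<open>Dom D\<close> preserve it too.\<close>

lemma in_Dom_if_adjoint: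
  assumes "\<And>v. v \<in> Dom T \<Longrightarrow> cinner (D v) y = cinner v z"
  shows "y \<in> Dom T \<and> D y = z"
proof
  show y: "y \<in> Dom T" using selfadjoint assms unfolding selfadjoint_on_def by blast
  show "D y = z"
    by (rule cinner_eqI[OF dense_Dom]) (simp add: assms[symmetric] D_symmetric y)
qed

lemma D_closed:
  assumes "\<And>n. s n \<in> Dom T" "s \<longlonglongrightarrow> x" "(\<lambda>n. D (s n)) \<longlonglongrightarrow> y"
  shows "x \<in> Dom T \<and> D x = y"
proof (rule in_Dom_if_adjoint)
  fix v assume v: "v \<in> Dom T"
  have "(\<lambda>n. cinner (D v) (s n)) \<longlonglongrightarrow> cinner (D v) x"
    by (intro tendsto_cinner tendsto_const assms)
  moreover have "(\<lambda>n. cinner v (D (s n))) \<longlonglongrightarrow> cinner v y"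
    by (intro tendsto_cinner tendsto_const assms)
  ultimately show "cinner (D v) x = cinner v y"
    using v assms(1) by (simp add: D_symmetric LIMSEQ_unique)
qed

lemma norm_D_plus_i:
  assumes "h \<in> Dom T"
  shows "(norm (D h + \<i> *\<^sub>C h))\<^sup>2 = (norm (D h))\<^sup>2 + (norm h)\<^sup>2"
proof -
  have "cinner (D h + \<i> *\<^sub>C h) (D h + \<i> *\<^sub>C h) = cinner (D h) (D h) + cinner h h"
    by (simp add: cinner_add_left cinner_add_right cinner_scaleC_left cinner_scaleC_right
        D_symmetric[OF assms assms] algebra_simps)
  then have "complex_of_real ((norm (D h + \<i> *\<^sub>C h))\<^sup>2) = complex_of_real ((norm (D h))\<^sup>2 + (norm h)\<^sup>2)"
    by (simp only: cinner_self of_real_add)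
  then show ?thesis by (simp only: of_real_eq_iff)
qed

lemma norm_le_D_plus_i: "h \<in> Dom T \<Longrightarrow> norm h \<le> norm (D h + \<i> *\<^sub>C h)"
  and norm_D_le_D_plus_i: "h \<in> Dom T \<Longrightarrow> norm (D h) \<le> norm (D h + \<i> *\<^sub>C h)"
  by (rule power2_le_imp_le; simp add: norm_D_plus_i)+

text \<open>The Riesz representation theorem on the graph of \<open>D\<close> solves \<open>(D\<^sup>2 + 1) z = k\<close> weakly, hence
  strongly because \<open>D\<close> is self-adjoint, and \<open>(D - i) z\<close> is then a preimage of \<open>k\<close> under \<open>D + i\<close>.\<close>

lemma D_plus_i_surj: "\<exists>h\<in>Dom T. D h + \<i> *\<^sub>C h = k"
proof -
  define G where "G = {(h, D h) | h. h \<in> Dom T}"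
  have "\<exists>z\<in>G. \<forall>x\<in>G. inner (fst x) k = inner x z"
  proof (rule riesz_on_closed_subspace)
    show "subspace G"
      unfolding subspace_def G_def
      using Dom_0 Dom_add D_add Dom_scaleR D_scaleR by (force simp: zero_prod_def)
    show "closed G"
      unfolding closed_sequential_limits
    proof (intro allI impI, elim conjE)
      fix s l assume s: "\<forall>n. s n \<in> G" "s \<longlonglongrightarrow> l"
      from s(1) have m: "fst (s n) \<in> Dom T" "D (fst (s n)) = snd (s n)" for n
        by (auto simp: G_def dest: spec[of _ n])
      have "fst l \<in> Dom T \<and> D (fst l) = snd l"
        by (rule D_closed[of "\<lambda>n. fst (s n)"]) (use m s(2) in \<open>simp_all add: tendsto_fst tendsto_snd\<close>)
      then show "l \<in> G" by (auto simp: G_def intro!: exI[of _ "fst l"] prod_eqI)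
    qed
    fix x :: "'h \<times> 'h"
    have "\<bar>inner (fst x) k\<bar> \<le> norm (fst x) * norm k" by (rule Cauchy_Schwarz_ineq2)
    also have "\<dots> \<le> norm x * norm k"
      using norm_fst_le[of "fst x" "snd x"] by (intro mult_right_mono) simp_all
    finally show "\<bar>inner (fst x) k\<bar> \<le> norm k * norm x" by (simp add: mult.commute)
  qed (simp_all add: inner_add)
  then obtain z where z: "z \<in> Dom T" "\<And>v. v \<in> Dom T \<Longrightarrow> inner v k = inner v z + inner (D v) (D z)"
    unfolding G_def by auto
  have "cinner (D v) (D z) = cinner v (k - z)" if "v \<in> Dom T" for v
  proof -
    have re: "Re (cinner (D v) (D z)) = Re (cinner v (k - z))" if "v \<in> Dom T" for v
      using z(2)[OF that] by (simp add: inner_eq_Re_cinner cinner_diff_right)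
    from re[OF that] re[OF Dom_scaleC[OF that, of \<i>]] show ?thesis
      by (simp add: complex_eq_iff D_scaleC[OF that] cinner_scaleC_left)
  qed
  then have Dz: "D z \<in> Dom T" "D (D z) = k - z" using in_Dom_if_adjoint by blast+
  have "D (D z - \<i> *\<^sub>C z) + \<i> *\<^sub>C (D z - \<i> *\<^sub>C z) = k"
    using Dz z(1) by (simp add: D_diff D_scaleC Dom_scaleC complex_vector.scale_right_diff_distrib
        scaleC_scaleC scaleC_minus_one)
  then show ?thesis using Dz z(1) by (intro bexI[of _ "D z - \<i> *\<^sub>C z"]) (auto intro: Dom_diff Dom_scaleC)
qed

lemma D_plus_i_inj:
  assumes "h \<in> Dom T" "h' \<in> Dom T" "D h + \<i> *\<^sub>C h = D h' + \<i> *\<^sub>C h'"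
  shows "h = h'"
proof -
  have "D (h - h') + \<i> *\<^sub>C (h - h') = 0"
    using assms by (simp add: D_diff complex_vector.scale_right_diff_distrib)
      (metis add_diff_add diff_self)
  then show ?thesis using norm_le_D_plus_i[OF Dom_diff[OF assms(1,2)]] by simp
qed

abbreviation "R \<equiv> resolv T \<i>"

lemma resolv_in_Dom: "R k \<in> Dom T" and D_resolv: "D (R k) + \<i> *\<^sub>C R k = k"
  and clinear_op_resolv: "clinear_op R"
proof -
  define r where "r k = (THE h. h \<in> Dom T \<and> D h + \<i> *\<^sub>C h = k)" for k
  have r: "r k \<in> Dom T \<and> D (r k) + \<i> *\<^sub>C r k = k" for k
    unfolding r_def by (rule theI') (use D_plus_i_surj[of k] D_plus_i_inj in blast)
  have radd: "r (k + k') = r k + r k'" for k k'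
  proof (rule D_plus_i_inj)
    have "D (r k + r k') + \<i> *\<^sub>C (r k + r k') = (D (r k) + \<i> *\<^sub>C r k) + (D (r k') + \<i> *\<^sub>C r k')"
      using r[of k] r[of k'] by (simp only: D_add scaleC_add_right add_ac)
    then show "D (r (k + k')) + \<i> *\<^sub>C r (k + k') = D (r k + r k') + \<i> *\<^sub>C (r k + r k')"
      using r[of k] r[of k'] r[of "k + k'"] by simp
  qed (use r in \<open>auto simp: Dom_add\<close>)
  have rscale: "r (c *\<^sub>C k) = c *\<^sub>C r k" for k c
  proof (rule D_plus_i_inj)
    have "D (c *\<^sub>C r k) + \<i> *\<^sub>C c *\<^sub>C r k = c *\<^sub>C (D (r k) + \<i> *\<^sub>C r k)"
      unfolding scaleC_add_right scaleC_scaleC mult.commute[of c] using r[of k]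
      by (simp only: D_scaleC)
    then show "D (r (c *\<^sub>C k)) + \<i> *\<^sub>C r (c *\<^sub>C k) = D (c *\<^sub>C r k) + \<i> *\<^sub>C c *\<^sub>C r k"
      using r[of k] r[of "c *\<^sub>C k"] by simp
  qed (use r in \<open>auto simp: Dom_scaleC\<close>)
  have rnorm: "norm (r k) \<le> norm k" for k
    using r[of k] norm_le_D_plus_i[of "r k"] by simp
  have "bounded_linear r"
    by (rule bounded_linear_intro[where K = 1]) (simp_all add: radd rscale rnorm scaleR_scaleC)
  then have R: "blinfun_apply R = r"
    unfolding resolv_def r_def[symmetric] by (rule bounded_linear_Blinfun_apply)
  show "R k \<in> Dom T" "D (R k) + \<i> *\<^sub>C R k = k" using r[of k] by (simp_all add: R)
  show "clinear_op R" unfolding clinear_op_iff by (simp add: R rscale)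
qed

lemma D_resolv': "D (R k) = k - \<i> *\<^sub>C R k"
  using D_resolv[of k] by (simp add: algebra_simps)

lemma resolv_D_plus_i: "h \<in> Dom T \<Longrightarrow> R (D h + \<i> *\<^sub>C h) = h"
  by (rule D_plus_i_inj) (simp_all add: resolv_in_Dom D_resolv)

lemma norm_resolv: "norm R \<le> 1"
  by (rule norm_blinfun_bound) (use norm_le_D_plus_i[OF resolv_in_Dom] in \<open>simp_all add: D_resolv\<close>)

lemma Dom2_iff: "h \<in> Dom2 T \<longleftrightarrow> h \<in> Dom T \<and> D h \<in> Dom T"
  by (simp add: Dom2_def)

lemma csubspace_Dom2: "csubspace (Dom2 T)"
  unfolding complex_vector.subspace_def
  by (simp add: Dom2_iff Dom_0 Dom_add D_add Dom_scaleC D_scaleC)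

lemmas Dom2_add = complex_vector.subspace_add[OF csubspace_Dom2]
lemmas Dom2_scaleC = complex_vector.subspace_scale[OF csubspace_Dom2]

lemma resolv_in_Dom2: "k \<in> Dom T \<Longrightarrow> R k \<in> Dom2 T"
  by (simp add: Dom2_iff resolv_in_Dom D_resolv' Dom_diff Dom_scaleC)

lemma D_plus_i_in_Dom: "h \<in> Dom2 T \<Longrightarrow> D h + \<i> *\<^sub>C h \<in> Dom T"
  by (simp add: Dom2_iff Dom_add Dom_scaleC)

text \<open>\<open>(D + i)\<inverse>\<close> maps \<open>Dom D\<close> onto \<open>Dom D\<^sup>2\<close> and, being continuous with dense range \<open>Dom D\<close>,
  maps dense sets to dense sets.\<close>

lemma dense_Dom2: "closure (Dom2 T) = UNIV"
proof -
  have "h \<in> closure (Dom2 T)" if h: "h \<in> Dom T" for h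
  proof -
    obtain s where s: "\<And>n. s n \<in> Dom T" "s \<longlonglongrightarrow> D h + \<i> *\<^sub>C h"
      using dense_Dom closure_sequential[of "D h + \<i> *\<^sub>C h" "Dom T"] by auto
    have "(\<lambda>n. R (s n)) \<longlonglongrightarrow> R (D h + \<i> *\<^sub>C h)"
      by (intro tendsto_blinfun_apply tendsto_const s)
    then have "(\<lambda>n. R (s n)) \<longlonglongrightarrow> h" using h by (simp only: resolv_D_plus_i)
    then show ?thesis
      unfolding closure_sequential using resolv_in_Dom2[OF s(1)]
      by (intro exI[of _ "\<lambda>n. R (s n)"]) simp
  qed
  then have "closure (Dom T) \<subseteq> closure (Dom2 T)" by (intro closure_minimal) auto
  then show ?thesis using dense_Dom by auto
qed

text \<open>From \<open>\<parallel>D h\<parallel>\<^sup>2 = \<langle>h, D\<^sup>2 h\<rangle>\<close>: the graph norm of \<open>D\<^sup>2\<close> dominates that of \<open>D\<close>, which makes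
  \<open>D\<^sup>2\<close> closed.\<close>

lemma norm_D_le:
  assumes "h \<in> Dom2 T" shows "norm (D h) \<le> 2 * norm (h, D (D h))"
proof -
  let ?n = "norm (h, D (D h))"
  have "(norm (D h))\<^sup>2 = cmod (cinner h (D (D h)))"
    using assms by (simp add: norm_square_cinner D_symmetric Dom2_iff)
  also have "\<dots> \<le> norm h * norm (D (D h))" by (rule cmod_cinner_le)
  also have "\<dots> \<le> ?n * ?n"
    by (intro mult_mono norm_fst_le norm_snd_le norm_ge_zero)
  also have "\<dots> \<le> (2 * ?n)\<^sup>2" by (simp add: power2_eq_square)
  finally show ?thesis by (rule power2_le_imp_le) simp
qed

lemma D2_closed:
  assumes s: "\<And>n. s n \<in> Dom2 T" "s \<longlonglongrightarrow> x" "(\<lambda>n. D (D (s n))) \<longlonglongrightarrow> y"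
  shows "x \<in> Dom2 T \<and> D (D x) = y" "(\<lambda>n. D (s n)) \<longlonglongrightarrow> D x"
proof -
  have "Cauchy (\<lambda>n. D (s n))"
  proof (rule Cauchy_dist_le)
    show "Cauchy (\<lambda>n. (s n, D (D (s n))))" by (rule LIMSEQ_imp_Cauchy[OF tendsto_Pair[OF s(2,3)]])
    show "dist (D (s m)) (D (s n)) \<le> 2 * dist (s m, D (D (s m))) (s n, D (D (s n)))" for m n
      using norm_D_le[of "s m - s n"] complex_vector.subspace_diff[OF csubspace_Dom2 s(1) s(1)] s(1)
      by (simp add: dist_norm D_diff Dom2_iff)
  qed
  then obtain w where w: "(\<lambda>n. D (s n)) \<longlonglongrightarrow> w"
    using convergentD[OF Cauchy_convergent] by blast
  have 1: "x \<in> Dom T \<and> D x = w" by (rule D_closed[OF _ s(2) w]) (use s(1) in \<open>simp_all add: Dom2_iff\<close>)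
  have 2: "w \<in> Dom T \<and> D w = y" by (rule D_closed[OF _ w s(3)]) (use s(1) in \<open>simp_all add: Dom2_iff\<close>)
  from 1 2 show "x \<in> Dom2 T \<and> D (D x) = y" by (auto simp: Dom2_iff)
  from 1 w show "(\<lambda>n. D (s n)) \<longlonglongrightarrow> D x" by simp
qed

subsection \<open>Operators with bounded first commutator\<close>

definition C1_op :: "('h \<Rightarrow>\<^sub>L 'h) \<Rightarrow> bool"
  where "C1_op b \<longleftrightarrow> clinear_op b \<and> (\<forall>h\<in>Dom T. b h \<in> Dom T) \<and>
    (\<exists>A :: 'h \<Rightarrow>\<^sub>L 'h. \<forall>h\<in>Dom T. A h = D (b h) - b (D h))"

lemmas comm1_eqI = bcomm_eqI[where D = "Dop T", OF dense_Dom]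

lemma C1_opI:
  fixes A b :: "'h \<Rightarrow>\<^sub>L 'h"
  assumes "clinear_op b" "\<And>h. h \<in> Dom T \<Longrightarrow> b h \<in> Dom T \<and> D (b h) = b (D h) + blinfun_apply A h"
  shows "C1_op b" "comm1 T b = A"
proof -
  have A: "A h = D (b h) - b (D h)" if "h \<in> Dom T" for h using assms(2)[OF that] by simp
  show "C1_op b" unfolding C1_op_def using assms A by blast
  show "comm1 T b = A" by (rule comm1_eqI) (rule A)
qed

lemma C1_op_clinear: "C1_op b \<Longrightarrow> clinear_op b"
  and C1_op_Dom: "C1_op b \<Longrightarrow> h \<in> Dom T \<Longrightarrow> b h \<in> Dom T"
  by (simp_all add: C1_op_def)

lemma comm1_apply:
  assumes "C1_op b" "h \<in> Dom T"
  shows "D (b h) = b (D h) + comm1 T b h"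
proof -
  obtain A :: "'h \<Rightarrow>\<^sub>L 'h" where "\<And>h. h \<in> Dom T \<Longrightarrow> A h = D (b h) - b (D h)"
    using assms(1) unfolding C1_op_def by blast
  with comm1_eqI[of A b] assms(2) show ?thesis by simp
qed

lemma C1_op_add: "C1_op a \<Longrightarrow> C1_op b \<Longrightarrow> C1_op (a + b)"
  and comm1_add: "C1_op a \<Longrightarrow> C1_op b \<Longrightarrow> comm1 T (a + b) = comm1 T a + comm1 T b"
  by (rule C1_opI[where A = "comm1 T a + comm1 T b"];
      simp add: clinear_op_add C1_op_clinear blinfun.add_left Dom_add C1_op_Dom D_add comm1_apply)+

lemma C1_op_scaleC: "C1_op b \<Longrightarrow> C1_op (c *\<^sub>C b)"
  and comm1_scaleC: "C1_op b \<Longrightarrow> comm1 T (c *\<^sub>C b) = c *\<^sub>C comm1 T b"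
proof -
  assume b: "C1_op b"
  have "clinear_op (c *\<^sub>C b)" using b by (intro clinear_op_scaleC C1_op_clinear)
  from C1_opI[OF this, of "c *\<^sub>C comm1 T b"] b
  show "C1_op (c *\<^sub>C b)" "comm1 T (c *\<^sub>C b) = c *\<^sub>C comm1 T b"
    by (simp_all add: scaleC_blinfun.rep_eq Dom_scaleC C1_op_Dom D_scaleC comm1_apply scaleC_add_right)
qed

lemma C1_op_id: "C1_op id_blinfun" and comm1_id: "comm1 T id_blinfun = 0"
  by (rule C1_opI[OF clinear_op_id, of 0]; simp)+

lemma C1_op_compose: "C1_op a \<Longrightarrow> C1_op b \<Longrightarrow> C1_op (a o\<^sub>L b)"
  and comm1_compose: "C1_op a \<Longrightarrow> C1_op b \<Longrightarrow>
    comm1 T (a o\<^sub>L b) = (comm1 T a o\<^sub>L b) + (a o\<^sub>L comm1 T b)"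
  by (rule C1_opI[where A = "(comm1 T a o\<^sub>L b) + (a o\<^sub>L comm1 T b)"];
      simp add: clinear_op_compose C1_op_clinear C1_op_Dom comm1_apply blinfun.add_left
        blinfun.add_right)+

lemma C1_op_minus: "C1_op b \<Longrightarrow> C1_op (- b)"
  and comm1_minus: "C1_op b \<Longrightarrow> comm1 T (- b) = - comm1 T b"
  using C1_op_scaleC[of b "-1"] comm1_scaleC[of b "-1"] by (simp_all add: scaleC_minus_one)

lemma C1_op_diff: "C1_op a \<Longrightarrow> C1_op b \<Longrightarrow> C1_op (a - b)"
  and comm1_diff: "C1_op a \<Longrightarrow> C1_op b \<Longrightarrow> comm1 T (a - b) = comm1 T a - comm1 T b"
  using C1_op_add[of a "- b"] comm1_add[of a "- b"] by (simp_all add: C1_op_minus comm1_minus)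

lemma clinear_op_comm1:
  assumes "C1_op b" shows "clinear_op (comm1 T b)"
  unfolding clinear_op_iff
proof (intro allI)
  fix c x
  have "closed {x. comm1 T b (c *\<^sub>C x) = c *\<^sub>C comm1 T b x}"
    by (intro closed_Collect_eq continuous_intros)
  moreover have "Dom T \<subseteq> {x. comm1 T b (c *\<^sub>C x) = c *\<^sub>C comm1 T b x}"
  proof (intro subsetI CollectI)
    fix h assume h: "h \<in> Dom T"
    note lin = bounded_clinear_scaleC[OF C1_op_clinear[OF assms]]
    from comm1_apply[OF assms Dom_scaleC[OF h, of c]] comm1_apply[OF assms h]
    show "comm1 T b (c *\<^sub>C h) = c *\<^sub>C comm1 T b h"
      using h assms by (simp add: lin D_scaleC C1_op_Dom scaleC_add_right)
  qed
  ultimately have "closure (Dom T) \<subseteq> {x. comm1 T b (c *\<^sub>C x) = c *\<^sub>C comm1 T b x}"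
    by (rule closure_minimal[rotated])
  then show "comm1 T b (c *\<^sub>C x) = c *\<^sub>C comm1 T b x" by (auto simp: dense_Dom)
qed

text \<open>Moving \<open>D\<close> across \<open>\<langle>D v, b\<^sup>* h\<rangle> = \<langle>b D v, h\<rangle>\<close> shows that \<open>b\<^sup>* h\<close> lies in the domain of
  \<open>D\<^sup>* = D\<close>.\<close>

lemma C1_op_cadj: "C1_op b \<Longrightarrow> C1_op (cadj b)"
  and comm1_cadj: "C1_op b \<Longrightarrow> comm1 T (cadj b) = - cadj (comm1 T b)"
proof -
  assume b: "C1_op b"
  note lin = C1_op_clinear[OF b] clinear_op_comm1[OF b]
  have "cadj b h \<in> Dom T \<and> D (cadj b h) = cadj b (D h) + (- cadj (comm1 T b)) h"
    if h: "h \<in> Dom T" for h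
  proof (rule in_Dom_if_adjoint)
    fix v assume v: "v \<in> Dom T"
    have "cinner (D v) (cadj b h) = cinner (b (D v)) h" by (simp add: cadj_right lin)
    also have "b (D v) = D (b v) - comm1 T b v" by (simp add: comm1_apply b v)
    also have "cinner \<dots> h = cinner (b v) (D h) - cinner v (cadj (comm1 T b) h)"
      by (simp add: cinner_diff_left D_symmetric C1_op_Dom b v h cadj_right[OF lin(2)])
    also have "\<dots> = cinner v (cadj b (D h) + (- cadj (comm1 T b)) h)"
      by (simp add: cadj_right[OF lin(1)] blinfun.minus_left cinner_diff_right)
    finally show "cinner (D v) (cadj b h) = \<dots>" .
  qed
  from C1_opI[OF clinear_op_cadj[OF lin(1)] this]
  show "C1_op (cadj b)" "comm1 T (cadj b) = - cadj (comm1 T b)" by simp_all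
qed

text \<open>The map \<open>b \<mapsto> [D, b]\<close> is closed because \<open>D\<close> is: \<open>s\<^sub>n h\<close> and
  \<open>D s\<^sub>n h = s\<^sub>n D h + [D, s\<^sub>n] h\<close> both converge. This is how elements of the completions come
  to act on \<open>H\<close> like those of the algebra.\<close>

lemma C1_op_limit:
  assumes s: "\<And>n. C1_op (s n)" "s \<longlonglongrightarrow> b" "(\<lambda>n. comm1 T (s n)) \<longlonglongrightarrow> A"
  shows "C1_op b" "comm1 T b = A"
proof -
  have lin: "clinear_op b"
    using closed_sequentially[OF closed_clinear_op _ s(2)] s(1) C1_op_clinear by blast
  have "b h \<in> Dom T \<and> D (b h) = b (D h) + A h" if h: "h \<in> Dom T" for h
  proof (rule D_closed[of "\<lambda>n. s n h"])
    show "(\<lambda>n. s n h) \<longlonglongrightarrow> b h" by (intro tendsto_blinfun_apply s tendsto_const)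
    have "(\<lambda>n. s n (D h) + comm1 T (s n) h) \<longlonglongrightarrow> b (D h) + A h"
      by (intro tendsto_blinfun_apply tendsto_add s tendsto_const)
    then show "(\<lambda>n. D (s n h)) \<longlonglongrightarrow> b (D h) + A h" by (simp add: comm1_apply s h)
  qed (simp add: C1_op_Dom s h)
  from C1_opI[OF lin this] show "C1_op b" "comm1 T b = A" by blast+
qed

subsection \<open>Operators with relatively bounded second commutator\<close>

definition C2_op :: "('h \<Rightarrow>\<^sub>L 'h) \<Rightarrow> bool"
  where "C2_op b \<longleftrightarrow> C1_op b \<and> (\<forall>h\<in>Dom2 T. b h \<in> Dom2 T) \<and>
    (\<exists>A :: 'h \<Rightarrow>\<^sub>L 'h. \<forall>h\<in>Dom2 T. A (D h + \<i> *\<^sub>C h) = D (D (b h)) - b (D (D h)))"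

lemma D_plus_i_image_Dom2: "(\<lambda>h. D h + \<i> *\<^sub>C h) ` Dom2 T = Dom T"
proof (intro equalityI subsetI)
  fix k assume "k \<in> Dom T"
  then show "k \<in> (\<lambda>h. D h + \<i> *\<^sub>C h) ` Dom2 T"
    by (intro image_eqI[of _ _ "R k"]) (simp_all add: D_resolv resolv_in_Dom2)
qed (auto simp: D_plus_i_in_Dom)

lemma comm2R_eqI:
  fixes A b :: "'h \<Rightarrow>\<^sub>L 'h"
  assumes "\<And>h. h \<in> Dom2 T \<Longrightarrow> blinfun_apply b h \<in> Dom2 T \<and>
    blinfun_apply A (D h + \<i> *\<^sub>C h) = D (D (b h)) - b (D (D h))"
  shows "comm2R T b = A"
  unfolding comm2R_def
proof (rule the_equality)
  fix B :: "'h \<Rightarrow>\<^sub>L 'h"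
  assume B: "\<forall>h\<in>Dom2 T. b h \<in> Dom2 T \<longrightarrow> B (D h + \<i> *\<^sub>C h) = D (D (b h)) - b (D (D h))"
  show "B = A"
  proof (rule blinfun_eq_on_dense[OF dense_Dom])
    fix k assume "k \<in> Dom T"
    then obtain h where "h \<in> Dom2 T" "k = D h + \<i> *\<^sub>C h" using D_plus_i_image_Dom2 by blast
    then show "B k = A k" using assms B by simp
  qed
qed (use assms in blast)

lemma C2_opI:
  fixes A b :: "'h \<Rightarrow>\<^sub>L 'h"
  assumes "C1_op b" "\<And>h. h \<in> Dom2 T \<Longrightarrow> b h \<in> Dom2 T \<and>
    D (D (b h)) = b (D (D h)) + blinfun_apply A (D h + \<i> *\<^sub>C h)"
  shows "C2_op b" "comm2R T b = A"
proof -
  have A: "A (D h + \<i> *\<^sub>C h) = D (D (b h)) - b (D (D h))" if "h \<in> Dom2 T" for h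
    using assms(2)[OF that] by simp
  show "C2_op b" unfolding C2_op_def using assms A by blast
  show "comm2R T b = A" by (rule comm2R_eqI) (use A assms(2) in blast)
qed

lemma C2_op_C1: "C2_op b \<Longrightarrow> C1_op b"
  and C2_op_Dom2: "C2_op b \<Longrightarrow> h \<in> Dom2 T \<Longrightarrow> b h \<in> Dom2 T"
  by (simp_all add: C2_op_def)

lemma comm2R_apply:
  assumes "C2_op b" "h \<in> Dom2 T"
  shows "D (D (b h)) = b (D (D h)) + comm2R T b (D h + \<i> *\<^sub>C h)"
proof -
  obtain A :: "'h \<Rightarrow>\<^sub>L 'h" where "\<And>h. h \<in> Dom2 T \<Longrightarrow> A (D h + \<i> *\<^sub>C h) = D (D (b h)) - b (D (D h))"
    using assms(1) unfolding C2_op_def by blast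
  with comm2R_eqI[of b A] C2_op_Dom2[OF assms(1)] assms(2) show ?thesis by simp
qed

lemma C2_op_add: "C2_op a \<Longrightarrow> C2_op b \<Longrightarrow> C2_op (a + b)"
  and comm2R_add: "C2_op a \<Longrightarrow> C2_op b \<Longrightarrow> comm2R T (a + b) = comm2R T a + comm2R T b"
proof -
  assume ab: "C2_op a" "C2_op b"
  have "(a + b) h \<in> Dom2 T \<and> D (D ((a + b) h)) =
      (a + b) (D (D h)) + (comm2R T a + comm2R T b) (D h + \<i> *\<^sub>C h)" if h: "h \<in> Dom2 T" for h
    using comm2R_apply[OF ab(1) h] comm2R_apply[OF ab(2) h] C2_op_Dom2[OF ab(1) h]
      C2_op_Dom2[OF ab(2) h]
    by (simp add: blinfun.add_left Dom2_iff Dom_add D_add)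
  from C2_opI[OF C1_op_add[OF ab[THEN C2_op_C1]] this]
  show "C2_op (a + b)" "comm2R T (a + b) = comm2R T a + comm2R T b" by blast+
qed

lemma C2_op_scaleC: "C2_op b \<Longrightarrow> C2_op (c *\<^sub>C b)"
  and comm2R_scaleC: "C2_op b \<Longrightarrow> comm2R T (c *\<^sub>C b) = c *\<^sub>C comm2R T b"
proof -
  assume b: "C2_op b"
  have "(c *\<^sub>C b) h \<in> Dom2 T \<and> D (D ((c *\<^sub>C b) h)) =
      (c *\<^sub>C b) (D (D h)) + (c *\<^sub>C comm2R T b) (D h + \<i> *\<^sub>C h)" if h: "h \<in> Dom2 T" for h
    using comm2R_apply[OF b h] C2_op_Dom2[OF b h]
    by (simp add: scaleC_blinfun.rep_eq Dom2_iff Dom_scaleC D_scaleC scaleC_add_right)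
  from C2_opI[OF C1_op_scaleC[OF C2_op_C1[OF b]] this]
  show "C2_op (c *\<^sub>C b)" "comm2R T (c *\<^sub>C b) = c *\<^sub>C comm2R T b" by blast+
qed

lemma C2_op_id: "C2_op id_blinfun" and comm2R_id: "comm2R T id_blinfun = 0"
  by (rule C2_opI[where A = 0]; simp add: C1_op_id)+

lemma C2_op_minus: "C2_op b \<Longrightarrow> C2_op (- b)"
  and comm2R_minus: "C2_op b \<Longrightarrow> comm2R T (- b) = - comm2R T b"
  using C2_op_scaleC[of b "-1"] comm2R_scaleC[of b "-1"] by (simp_all add: scaleC_minus_one)

lemma C2_op_diff: "C2_op a \<Longrightarrow> C2_op b \<Longrightarrow> C2_op (a - b)"
  and comm2R_diff: "C2_op a \<Longrightarrow> C2_op b \<Longrightarrow> comm2R T (a - b) = comm2R T a - comm2R T b"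
  using C2_op_add[of a "- b"] comm2R_add[of a "- b"] by (simp_all add: C2_op_minus comm2R_minus)

text \<open>This is \<open>(D + i) b (D + i)\<inverse>\<close>, the upper left entry of \<open>\<pi>\<^sup>2(b)\<close>, written as a visibly
  bounded operator.\<close>

definition conj_op :: "('h \<Rightarrow>\<^sub>L 'h) \<Rightarrow> ('h \<Rightarrow>\<^sub>L 'h)"
  where "conj_op b = b + (comm1 T b o\<^sub>L R)"

lemma conj_op_apply:
  assumes "C1_op b"
  shows "conj_op b k = D (b (R k)) + \<i> *\<^sub>C b (R k)"
  using comm1_apply[OF assms resolv_in_Dom, of k] bounded_clinear_scaleC[OF C1_op_clinear[OF assms]]
  by (simp add: conj_op_def blinfun.add_left D_resolv' blinfun.diff_right)

lemma conj_op_D_plus_i: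
  "C1_op b \<Longrightarrow> h \<in> Dom T \<Longrightarrow> conj_op b (D h + \<i> *\<^sub>C h) = D (b h) + \<i> *\<^sub>C b h"
  by (simp add: conj_op_apply resolv_D_plus_i)

lemma C2_op_compose: "C2_op a \<Longrightarrow> C2_op b \<Longrightarrow> C2_op (a o\<^sub>L b)"
  and comm2R_compose: "C2_op a \<Longrightarrow> C2_op b \<Longrightarrow>
    comm2R T (a o\<^sub>L b) = (comm2R T a o\<^sub>L conj_op b) + (a o\<^sub>L comm2R T b)"
proof -
  assume ab: "C2_op a" "C2_op b"
  have "(a o\<^sub>L b) h \<in> Dom2 T \<and> D (D ((a o\<^sub>L b) h)) = (a o\<^sub>L b) (D (D h)) +
      ((comm2R T a o\<^sub>L conj_op b) + (a o\<^sub>L comm2R T b)) (D h + \<i> *\<^sub>C h)" if h: "h \<in> Dom2 T" for h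
  proof
    have bh: "b h \<in> Dom2 T" using C2_op_Dom2[OF ab(2) h] .
    then show "(a o\<^sub>L b) h \<in> Dom2 T" using C2_op_Dom2[OF ab(1)] by simp
    have "D (D ((a o\<^sub>L b) h)) = a (D (D (b h))) + comm2R T a (D (b h) + \<i> *\<^sub>C b h)"
      using comm2R_apply[OF ab(1) bh] by simp
    also have "D (b h) + \<i> *\<^sub>C b h = conj_op b (D h + \<i> *\<^sub>C h)"
      using h by (simp add: conj_op_D_plus_i C2_op_C1 ab Dom2_iff)
    finally show "D (D ((a o\<^sub>L b) h)) = (a o\<^sub>L b) (D (D h)) +
        ((comm2R T a o\<^sub>L conj_op b) + (a o\<^sub>L comm2R T b)) (D h + \<i> *\<^sub>C h)"
      by (simp only: comm2R_apply[OF ab(2) h] blinfun.add_left blinfun.add_right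
          blinfun_apply_blinfun_compose add_ac)
  qed
  from C2_opI[OF C1_op_compose[OF ab[THEN C2_op_C1]] this]
  show "C2_op (a o\<^sub>L b)" "comm2R T (a o\<^sub>L b) = (comm2R T a o\<^sub>L conj_op b) + (a o\<^sub>L comm2R T b)"
    by blast+
qed

lemma clinear_op_comm2R:
  assumes "C2_op b" shows "clinear_op (comm2R T b)"
  unfolding clinear_op_iff
proof (intro allI)
  fix c x
  let ?S = "{x. comm2R T b (c *\<^sub>C x) = c *\<^sub>C comm2R T b x}"
  have "closed ?S" by (intro closed_Collect_eq continuous_intros)
  moreover have "Dom T \<subseteq> ?S"
  proof (intro subsetI CollectI)
    fix k assume "k \<in> Dom T"
    then obtain h where h: "h \<in> Dom2 T" "k = D h + \<i> *\<^sub>C h" using D_plus_i_image_Dom2 by blast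
    note lin = bounded_clinear_scaleC[OF C1_op_clinear[OF C2_op_C1[OF assms]]]
    have "c *\<^sub>C k = D (c *\<^sub>C h) + \<i> *\<^sub>C (c *\<^sub>C h)"
      unfolding h(2) scaleC_add_right scaleC_scaleC mult.commute[of c] using h(1)
      by (simp only: D_scaleC Dom2_iff)
    moreover have "b h \<in> Dom2 T" by (rule C2_op_Dom2[OF assms h(1)])
    ultimately show "comm2R T b (c *\<^sub>C k) = c *\<^sub>C comm2R T b k"
      using comm2R_apply[OF assms Dom2_scaleC[OF h(1), of c]] comm2R_apply[OF assms h(1)] h
      by (simp add: lin D_scaleC Dom2_iff scaleC_add_right[of c "b (D (D h))"])
  qed
  ultimately have "closure (Dom T) \<subseteq> ?S" by (rule closure_minimal[rotated])
  then show "comm2R T b (c *\<^sub>C x) = c *\<^sub>C comm2R T b x" by (auto simp: dense_Dom)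
qed

text \<open>The argument for \<open>[D, b]\<close> with the closed operator \<open>D\<^sup>2\<close> in place of \<open>D\<close>. The commutator
  \<open>[D\<^sup>2, b]\<close> itself is unbounded, so convergence is that of \<open>[D\<^sup>2, s\<^sub>n] (D + i)\<inverse>\<close>.\<close>

lemma C2_op_limit:
  assumes s: "\<And>n. C2_op (s n)" "s \<longlonglongrightarrow> b" "(\<lambda>n. comm1 T (s n)) \<longlonglongrightarrow> A"
    "(\<lambda>n. comm2R T (s n)) \<longlonglongrightarrow> A'"
  shows "C2_op b" "comm2R T b = A'"
proof -
  have C1: "C1_op b" by (rule C1_op_limit(1)[OF C2_op_C1 s(2,3)]) (rule s)
  have "b h \<in> Dom2 T \<and> D (D (b h)) = b (D (D h)) + A' (D h + \<i> *\<^sub>C h)" if h: "h \<in> Dom2 T" for h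
  proof (rule D2_closed(1)[of "\<lambda>n. s n h"])
    show "(\<lambda>n. s n h) \<longlonglongrightarrow> b h" by (intro tendsto_blinfun_apply s tendsto_const)
    have "(\<lambda>n. s n (D (D h)) + comm2R T (s n) (D h + \<i> *\<^sub>C h)) \<longlonglongrightarrow>
        b (D (D h)) + A' (D h + \<i> *\<^sub>C h)"
      by (intro tendsto_blinfun_apply tendsto_add s tendsto_const)
    then show "(\<lambda>n. D (D (s n h))) \<longlonglongrightarrow> b (D (D h)) + A' (D h + \<i> *\<^sub>C h)"
      by (simp only: comm2R_apply[OF s(1) h])
  qed (simp add: C2_op_Dom2 s h)
  from C2_opI[OF C1 this] show "C2_op b" "comm2R T b = A'" by blast+
qed

lemma C1_op_Alg:
  assumes "b \<in> Alg T" shows "C1_op b"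
proof -
  have 1: "\<forall>b\<in>Alg T. clinear_op b \<and> (\<forall>h. b (grH T h) = grH T (b h))"
    using C2 unfolding C2_spectral_triple_def by (elim conjE)
  have 2: "\<forall>b\<in>Alg T. (\<forall>h\<in>Dom T. b h \<in> Dom T) \<and>
      (\<exists>A :: 'h \<Rightarrow>\<^sub>L 'h. \<forall>h\<in>Dom T. A h = D (b h) - b (D h))"
    using C2 unfolding C2_spectral_triple_def by (elim conjE)
  show ?thesis
    unfolding C1_op_def by (rule conjI[OF conjunct1[OF bspec[OF 1 assms]] bspec[OF 2 assms]])
qed

lemma csubspace_Alg: "csubspace (Alg T)"
  and id_in_Alg: "id_blinfun \<in> Alg T"
  and Alg_compose: "a \<in> Alg T \<Longrightarrow> b \<in> Alg T \<Longrightarrow> a o\<^sub>L b \<in> Alg T"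
  and Alg_cadj: "b \<in> Alg T \<Longrightarrow> cadj b \<in> Alg T"
proof -
  show "csubspace (Alg T)" using C2 unfolding C2_spectral_triple_def by (elim conjE)
  show "id_blinfun \<in> Alg T" using C2 unfolding C2_spectral_triple_def by (elim conjE)
  have "\<forall>a\<in>Alg T. \<forall>b\<in>Alg T. a o\<^sub>L b \<in> Alg T"
    using C2 unfolding C2_spectral_triple_def by (elim conjE)
  then show "a \<in> Alg T \<Longrightarrow> b \<in> Alg T \<Longrightarrow> a o\<^sub>L b \<in> Alg T" by simp
  have "\<forall>b\<in>Alg T. cadj b \<in> Alg T" using C2 unfolding C2_spectral_triple_def by (elim conjE)
  then show "b \<in> Alg T \<Longrightarrow> cadj b \<in> Alg T" by simp
qed

text \<open>The bound on the core passes to all of \<open>Dom D\<^sup>2\<close> because convergence in the graph norm of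
  \<open>D\<^sup>2\<close> implies convergence in that of \<open>D\<close>.\<close>

lemma C2_op_Alg:
  assumes "b \<in> Alg T" shows "C2_op b"
proof -
  have "\<exists>C. csubspace C \<and> C \<subseteq> Dom2 T \<and>
      (\<forall>h\<in>Dom2 T. (h, D (D h)) \<in> closure {(c, D (D c)) |c. c \<in> C}) \<and>
      (\<forall>b\<in>Alg T. (\<forall>c\<in>C. b c \<in> Dom2 T) \<and>
        (\<forall>z\<in>{\<i>, - \<i>}. \<exists>K. \<forall>c\<in>C.
          norm (D (D (b c)) - b (D (D c))) \<le> K * norm (D c + z *\<^sub>C c)))"
    using C2 unfolding C2_spectral_triple_def by (elim conjE)
  then obtain C where C0: "csubspace C" "C \<subseteq> Dom2 T"
      "\<forall>h\<in>Dom2 T. (h, D (D h)) \<in> closure {(c, D (D c)) |c. c \<in> C}"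
      "\<forall>b\<in>Alg T. (\<forall>c\<in>C. b c \<in> Dom2 T) \<and>
        (\<forall>z\<in>{\<i>, - \<i>}. \<exists>K. \<forall>c\<in>C.
          norm (D (D (b c)) - b (D (D c))) \<le> K * norm (D c + z *\<^sub>C c))"
    by (elim exE conjE) (rule that)
  note C = C0(2) bspec[OF C0(3)] C0(1)
  have bC: "b c \<in> Dom2 T" if "c \<in> C" for c using C0(4) assms that by blast
  have "\<exists>K. \<forall>c\<in>C. norm (D (D (b c)) - b (D (D c))) \<le> K * norm (D c + \<i> *\<^sub>C c)"
    using bspec[OF C0(4) assms] by simp
  then obtain K where K: "\<And>c. c \<in> C \<Longrightarrow>
      norm (D (D (b c)) - b (D (D c))) \<le> K * norm (D c + \<i> *\<^sub>C c)"
    by blast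
  have C1: "C1_op b" using assms by (rule C1_op_Alg)
  have lin: "b (c *\<^sub>C x) = c *\<^sub>C b x" for c x
    by (rule bounded_clinear_scaleC[OF C1_op_clinear[OF C1]])
  have main: "b h \<in> Dom2 T \<and> norm (D (D (b h)) - b (D (D h))) \<le> K * norm (D h + \<i> *\<^sub>C h)"
    if h: "h \<in> Dom2 T" for h
  proof -
    obtain s where s0: "\<And>n. s n \<in> {(c, D (D c)) |c. c \<in> C}" "s \<longlonglongrightarrow> (h, D (D h))"
      using C(2)[OF h] unfolding closure_sequential by blast
    define c where "c = (\<lambda>n. fst (s n))"
    have sc: "c n \<in> C" "s n = (c n, D (D (c n)))" for n
      using s0(1)[of n] by (auto simp: c_def)
    have c: "c n \<in> Dom2 T" for n using sc C(1) by blast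
    have lc: "c \<longlonglongrightarrow> h" using tendsto_fst[OF s0(2)] by (simp add: c_def)
    have lc2: "(\<lambda>n. D (D (c n))) \<longlonglongrightarrow> D (D h)" using tendsto_snd[OF s0(2)] by (simp add: sc(2))
    have lc1: "(\<lambda>n. D (c n)) \<longlonglongrightarrow> D h" by (rule D2_closed(2)[OF c lc lc2])
    have li: "(\<lambda>n. D (c n) + \<i> *\<^sub>C c n) \<longlonglongrightarrow> D h + \<i> *\<^sub>C h"
      by (intro tendsto_intros tendsto_scaleC lc lc1)
    define q where "q n = D (D (b (c n))) - b (D (D (c n)))" for n
    have bc: "b (c n) \<in> Dom2 T" for n using bC[OF sc(1)] .
    have "Cauchy q"
    proof (rule Cauchy_dist_le[OF LIMSEQ_imp_Cauchy[OF li]])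
      fix m n
      have d: "c m - c n \<in> C" using sc complex_vector.subspace_diff[OF C(3)] by blast
      have "q m - q n = D (D (b (c m - c n))) - b (D (D (c m - c n)))"
        using c[of m] c[of n] bc[of m] bc[of n]
        by (simp add: q_def Dom2_iff D_diff blinfun.diff_right)
      then have "dist (q m) (q n) \<le> K * norm (D (c m - c n) + \<i> *\<^sub>C (c m - c n))"
        using K[OF d] by (simp add: dist_norm)
      also have "D (c m - c n) + \<i> *\<^sub>C (c m - c n) = (D (c m) + \<i> *\<^sub>C c m) - (D (c n) + \<i> *\<^sub>C c n)"
        using c[of m] c[of n] by (simp add: Dom2_iff D_diff complex_vector.scale_right_diff_distrib)
      finally show "dist (q m) (q n) \<le> K * dist (D (c m) + \<i> *\<^sub>C c m) (D (c n) + \<i> *\<^sub>C c n)"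
        by (simp only: dist_norm)
    qed
    then obtain w where w: "q \<longlonglongrightarrow> w" using convergentD[OF Cauchy_convergent] by blast
    have lb: "(\<lambda>n. b (D (D (c n)))) \<longlonglongrightarrow> b (D (D h))"
      by (intro tendsto_blinfun_apply tendsto_const lc2)
    from tendsto_add[OF w this] have "(\<lambda>n. D (D (b (c n)))) \<longlonglongrightarrow> w + b (D (D h))"
      by (simp add: q_def)
    moreover have "(\<lambda>n. b (c n)) \<longlonglongrightarrow> b h" by (intro tendsto_blinfun_apply tendsto_const lc)
    ultimately have bh: "b h \<in> Dom2 T \<and> D (D (b h)) = w + b (D (D h))"
      by (intro D2_closed(1)[of "\<lambda>n. b (c n)"] bc)
    moreover have "norm w \<le> K * norm (D h + \<i> *\<^sub>C h)"
      by (rule LIMSEQ_le[OF tendsto_norm[OF w] tendsto_mult[OF tendsto_const tendsto_norm[OF li]]])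
        (use K[OF sc(1)] in \<open>auto simp: q_def\<close>)
    ultimately show ?thesis by simp
  qed
  define g where "g k = D (D (b (R k))) - b (D (D (R k)))" for k
  have "\<exists>F. bounded_clinear F \<and> (\<forall>k\<in>Dom T. F k = g k)"
  proof (rule bounded_clinear_extension[OF csubspace_Dom dense_Dom])
    fix x y :: 'h and c assume x: "x \<in> Dom T"
    have bx: "R x \<in> Dom2 T" "b (R x) \<in> Dom2 T"
      using main[of "R x"] x by (auto intro: resolv_in_Dom2)
    show "norm (g x) \<le> K * norm x"
      using main[OF bx(1)] by (simp add: g_def D_resolv)
    show "g (c *\<^sub>C x) = c *\<^sub>C g x"
      using bx by (simp add: g_def bounded_clinear_scaleC[OF clinear_op_resolv] lin D_scaleC Dom2_iff
          complex_vector.scale_right_diff_distrib)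
    assume y: "y \<in> Dom T"
    have "R y \<in> Dom2 T" "b (R y) \<in> Dom2 T"
      using main[of "R y"] y by (auto intro: resolv_in_Dom2)
    with bx show "g (x + y) = g x + g y"
      by (simp add: g_def blinfun.add_right D_add Dom2_iff)
  qed
  then obtain F where F: "bounded_clinear F" "\<And>k. k \<in> Dom T \<Longrightarrow> F k = g k" by blast
  have "b h \<in> Dom2 T \<and> D (D (b h)) = b (D (D h)) + Blinfun F (D h + \<i> *\<^sub>C h)" if "h \<in> Dom2 T" for h
    using main[OF that] that F(2)[OF D_plus_i_in_Dom[OF that]]
    by (simp add: bounded_linear_Blinfun_apply bounded_clinear_linear F(1) g_def resolv_D_plus_i Dom2_iff)
  from C2_opI(1)[OF C1 this] show ?thesis .
qed

end

section \<open>The differentiable algebras\<close>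

text \<open>Convergence of \<open>J \<circ> s\<close> is easier to compute with than the Cauchy condition for \<open>nrm\<close>.
  Below, \<open>J\<close> collects an operator and its commutators, which are the entries of the matrices
  that define the norms of \<open>B\<^sub>1\<close> and \<open>B\<^sub>2\<close>.\<close>

lemma completion_in_iff:
  fixes J :: "'a :: real_normed_vector \<Rightarrow> 'b :: complete_space" and nrm :: "'a \<Rightarrow> real"
  assumes "0 < C" "\<And>x y. x \<in> A \<Longrightarrow> y \<in> A \<Longrightarrow> nrm (x - y) \<le> C * dist (J x) (J y)"
    and "\<And>x y. x \<in> A \<Longrightarrow> y \<in> A \<Longrightarrow> dist (J x) (J y) \<le> C * nrm (x - y)"
  shows "x \<in> completion_in nrm A \<longleftrightarrow>
    (\<exists>s l. (\<forall>n. s n \<in> A) \<and> s \<longlonglongrightarrow> x \<and> (\<lambda>n. J (s n)) \<longlonglongrightarrow> l)"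
proof -
  have "(\<forall>e>0. \<exists>K. \<forall>m\<ge>K. \<forall>n\<ge>K. nrm (s m - s n) < e) \<longleftrightarrow> Cauchy (\<lambda>n. J (s n))"
    if s: "\<forall>n. s n \<in> A" for s :: "nat \<Rightarrow> 'a"
  proof
    assume L: "\<forall>e>0. \<exists>K. \<forall>m\<ge>K. \<forall>n\<ge>K. nrm (s m - s n) < e"
    show "Cauchy (\<lambda>n. J (s n))"
    proof (rule metric_CauchyI)
      fix e :: real assume "0 < e"
      then have "0 < e / C" using assms(1) by simp
      then obtain K where K: "\<And>m n. m \<ge> K \<Longrightarrow> n \<ge> K \<Longrightarrow> nrm (s m - s n) < e / C" using L by blast
      have "dist (J (s m)) (J (s n)) < e" if "m \<ge> K" "n \<ge> K" for m n
        using assms(3)[of "s m" "s n"] s K[OF that] assms(1) by (simp add: field_simps)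
      then show "\<exists>M. \<forall>m\<ge>M. \<forall>n\<ge>M. dist (J (s m)) (J (s n)) < e" by blast
    qed
  next
    assume L: "Cauchy (\<lambda>n. J (s n))"
    show "\<forall>e>0. \<exists>K. \<forall>m\<ge>K. \<forall>n\<ge>K. nrm (s m - s n) < e"
    proof (intro allI impI)
      fix e :: real assume "0 < e"
      then have "0 < e / C" using assms(1) by simp
      then obtain K where K: "\<And>m n. m \<ge> K \<Longrightarrow> n \<ge> K \<Longrightarrow> dist (J (s m)) (J (s n)) < e / C"
        using metric_CauchyD[OF L] by blast
      have "nrm (s m - s n) < e" if "m \<ge> K" "n \<ge> K" for m n
      proof -
        have "C * dist (J (s m)) (J (s n)) < e" using K[OF that] assms(1) by (simp add: field_simps)
        moreover have "nrm (s m - s n) \<le> C * dist (J (s m)) (J (s n))" using assms(2) s by blast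
        ultimately show ?thesis by linarith
      qed
      then show "\<exists>K. \<forall>m\<ge>K. \<forall>n\<ge>K. nrm (s m - s n) < e" by blast
    qed
  qed
  then have "x \<in> completion_in nrm A \<longleftrightarrow> (\<exists>s. (\<forall>n. s n \<in> A) \<and> s \<longlonglongrightarrow> x \<and> Cauchy (\<lambda>n. J (s n)))"
    unfolding completion_in_def mem_Collect_eq by (intro iff_exI) blast
  then show ?thesis unfolding Cauchy_convergent_iff convergent_def by blast
qed

text \<open>The lower triangular shape shared by \<open>\<pi>\<^sup>1\<close> and \<open>\<pi>\<^sup>2\<close>; the Leibniz rules for commutators
  say that both are multiplicative.\<close>

definition blk :: "('a :: real_normed_vector \<Rightarrow>\<^sub>L 'a) \<Rightarrow> ('a \<Rightarrow>\<^sub>L 'a) \<Rightarrow> ('a \<Rightarrow>\<^sub>L 'a) \<Rightarrow>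
    (('a \<times> 'a) \<Rightarrow>\<^sub>L ('a \<times> 'a))"
  where "blk A B C = Blinfun (\<lambda>(h, k). (A h, B h + C k))"

lemma blk_apply [simp]: "blk A B C (h, k) = (A h, B h + C k)"
proof -
  have "bounded_linear (\<lambda>x. (A (fst x), B (fst x) + C (snd x)))"
    by (intro bounded_linear_Pair bounded_linear_add blinfun.bounded_linear_right[THEN bounded_linear_compose]
        bounded_linear_fst bounded_linear_snd)
  moreover have "(\<lambda>(h, k). (A h, B h + C k)) = (\<lambda>x. (A (fst x), B (fst x) + C (snd x)))"
    by auto
  ultimately show ?thesis by (simp add: blk_def bounded_linear_Blinfun_apply)
qed

lemma blk_compose:
  "blk A B C o\<^sub>L blk A' B' C' = blk (A o\<^sub>L A') ((B o\<^sub>L A') + (C o\<^sub>L B')) (C o\<^sub>L C')"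
  by (rule blinfun_eqI) (auto simp: blinfun.add_left blinfun.add_right)

lemma norm_blk_le: "norm (blk A B C) \<le> norm A + norm B + norm C"
proof (rule norm_blinfun_bound)
  fix x :: "'a \<times> 'a"
  obtain h k where x: "x = (h, k)" by fastforce
  have hk: "norm h \<le> norm x" "norm k \<le> norm x"
    unfolding x by (rule norm_fst_le norm_snd_le)+
  have "norm (blk A B C x) \<le> norm (A h) + norm (B h + C k)"
    by (simp add: x norm_Pair_le)
  also have "\<dots> \<le> norm (A h) + (norm (B h) + norm (C k))"
    by (intro add_left_mono norm_triangle_ineq)
  also have "\<dots> \<le> norm A * norm x + (norm B * norm x + norm C * norm x)"
    using hk by (intro add_mono order.trans[OF norm_blinfun] mult_left_mono) auto
  finally show "norm (blk A B C x) \<le> (norm A + norm B + norm C) * norm x"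
    by (simp add: algebra_simps)
qed simp

lemma norm_blk_corner:
  fixes A B C :: "'a :: real_normed_vector \<Rightarrow>\<^sub>L 'a"
  shows "norm (A h) \<le> norm (blk A B C (h, 0))" "norm (B h) \<le> norm (blk A B C (h, 0))"
  using norm_fst_le[of "A h" "B h"] norm_snd_le[of "B h" "A h"] by simp_all

lemma norm_le_norm_blk: "norm A \<le> norm (blk A B C)" "norm B \<le> norm (blk A B C)"
proof -
  have *: "norm (blk A B C (h, 0)) \<le> norm (blk A B C) * norm h" for h
    using norm_blinfun[of "blk A B C" "(h, 0)"] by (simp del: blk_apply)
  show "norm A \<le> norm (blk A B C)"
    by (rule norm_blinfun_bound[OF norm_ge_zero order.trans[OF norm_blk_corner(1) *]])
  show "norm B \<le> norm (blk A B C)"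
    by (rule norm_blinfun_bound[OF norm_ge_zero order.trans[OF norm_blk_corner(2) *]])
qed

context spectral_triple
begin

lemma pi1_eq_blk: "pi1 T b = blk b (comm1 T b) b"
  by (simp add: pi1_def blk_def)

lemma pi2_eq_blk: "C1_op b \<Longrightarrow> pi2 T b = blk (conj_op b) (comm2R T b) b"
  by (simp add: pi2_def blk_def conj_op_apply)

lemma pi1_compose: "C1_op a \<Longrightarrow> C1_op b \<Longrightarrow> pi1 T (a o\<^sub>L b) = pi1 T a o\<^sub>L pi1 T b"
  by (simp add: pi1_eq_blk blk_compose comm1_compose)

lemma conj_op_compose:
  assumes "C1_op a" "C1_op b" shows "conj_op (a o\<^sub>L b) = conj_op a o\<^sub>L conj_op b"
proof (rule blinfun_eqI)
  fix k
  have "conj_op b k = D (b (R k)) + \<i> *\<^sub>C b (R k)" by (rule conj_op_apply[OF assms(2)])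
  then have "conj_op a (conj_op b k) = D (a (b (R k))) + \<i> *\<^sub>C a (b (R k))"
    using assms by (simp only: conj_op_D_plus_i C1_op_Dom resolv_in_Dom)
  then show "conj_op (a o\<^sub>L b) k = (conj_op a o\<^sub>L conj_op b) k"
    by (simp add: conj_op_apply C1_op_compose assms)
qed

lemma pi2_compose:
  assumes "C2_op a" "C2_op b" shows "pi2 T (a o\<^sub>L b) = pi2 T a o\<^sub>L pi2 T b"
  using assms[THEN C2_op_C1] comm2R_compose[OF assms]
  by (simp add: pi2_eq_blk blk_compose conj_op_compose C1_op_compose)

lemma norm_conj_op_le: "norm (conj_op b) \<le> norm b + norm (comm1 T b)"
proof -
  have "norm (comm1 T b o\<^sub>L R) \<le> norm (comm1 T b) * norm R" by (rule norm_blinfun_compose)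
  also have "\<dots> \<le> norm (comm1 T b) * 1" by (intro mult_left_mono norm_resolv) simp
  finally show ?thesis using norm_triangle_ineq[of b "comm1 T b o\<^sub>L R"] by (simp add: conj_op_def)
qed

lemmas Alg_diff = complex_vector.subspace_diff[OF csubspace_Alg]
lemmas Alg_add = complex_vector.subspace_add[OF csubspace_Alg]
lemmas Alg_scaleC = complex_vector.subspace_scale[OF csubspace_Alg]

lemma clinear_op_Alg: "b \<in> Alg T \<Longrightarrow> clinear_op b"
  by (rule C1_op_clinear[OF C1_op_Alg])

lemma cadj_diff_Alg: "a \<in> Alg T \<Longrightarrow> b \<in> Alg T \<Longrightarrow> cadj (a - b) = cadj a - cadj b"
  using cadj_add[of a "- b"] cadj_scaleC[of b "-1"] clinear_op_scaleC[of b "-1"]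
  by (simp add: clinear_op_Alg scaleC_minus_one)

lemma B1_iff_sequence:
  "b \<in> B1 T \<longleftrightarrow> (\<exists>s A. (\<forall>n. s n \<in> Alg T) \<and> s \<longlonglongrightarrow> b \<and> (\<lambda>n. comm1 T (s n)) \<longlonglongrightarrow> A)"
proof -
  have dist: "dist (x, comm1 T x) (y, comm1 T y) = norm (x - y, comm1 T (x - y))"
    if "x \<in> Alg T" "y \<in> Alg T" for x y
    using that by (simp add: dist_norm comm1_diff C1_op_Alg)
  have "b \<in> B1 T \<longleftrightarrow> (\<exists>s l. (\<forall>n. s n \<in> Alg T) \<and> s \<longlonglongrightarrow> b \<and> (\<lambda>n. (s n, comm1 T (s n))) \<longlonglongrightarrow> l)"
    unfolding B1_def
  proof (rule completion_in_iff[where C = 3])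
    fix x y assume xy: "x \<in> Alg T" "y \<in> Alg T"
    define d where "d = x - y"
    have "norm (pi1 T d) \<le> 2 * norm d + norm (comm1 T d)"
      unfolding pi1_eq_blk using norm_blk_le[of d "comm1 T d" d] by simp
    also have "\<dots> \<le> 3 * norm (d, comm1 T d)"
      using norm_fst_le[of d "comm1 T d"] norm_snd_le[of "comm1 T d" d] by linarith
    finally show "norm1 T (x - y) \<le> 3 * dist (x, comm1 T x) (y, comm1 T y)"
      unfolding dist[OF xy] by (simp add: norm1_def d_def)
    have "norm (d, comm1 T d) \<le> norm d + norm (comm1 T d)" by (rule norm_Pair_le)
    also have "\<dots> \<le> 3 * norm (pi1 T d)"
      unfolding pi1_eq_blk using norm_le_norm_blk[where A = d and B = "comm1 T d" and C = d]
        norm_ge_zero[of "blk d (comm1 T d) d"] by linarith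
    finally show "dist (x, comm1 T x) (y, comm1 T y) \<le> 3 * norm1 T (x - y)"
      unfolding dist[OF xy] by (simp add: norm1_def d_def)
  qed simp
  also have "\<dots> \<longleftrightarrow> (\<exists>s A. (\<forall>n. s n \<in> Alg T) \<and> s \<longlonglongrightarrow> b \<and> (\<lambda>n. comm1 T (s n)) \<longlonglongrightarrow> A)"
    (is "?L \<longleftrightarrow> ?R")
  proof
    assume ?L
    then obtain s l where s: "\<forall>n. s n \<in> Alg T" "s \<longlonglongrightarrow> b"
      and l: "(\<lambda>n. (s n, comm1 T (s n))) \<longlonglongrightarrow> l" by blast
    from tendsto_snd[OF l] s show ?R unfolding snd_conv by blast
  next
    assume ?R
    then obtain s A where s: "\<forall>n. s n \<in> Alg T" "s \<longlonglongrightarrow> b" "(\<lambda>n. comm1 T (s n)) \<longlonglongrightarrow> A" by blast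
    then have "(\<lambda>n. (s n, comm1 T (s n))) \<longlonglongrightarrow> (b, A)" by (intro tendsto_Pair)
    with s show ?L by blast
  qed
  finally show ?thesis .
qed

lemma B1I:
  "(\<And>n. s n \<in> Alg T) \<Longrightarrow> s \<longlonglongrightarrow> b \<Longrightarrow> (\<lambda>n. comm1 T (s n)) \<longlonglongrightarrow> A \<Longrightarrow> b \<in> B1 T"
  unfolding B1_iff_sequence by blast

lemma B1E:
  assumes "b \<in> B1 T"
  obtains s where "\<And>n. s n \<in> Alg T" "s \<longlonglongrightarrow> b" "(\<lambda>n. comm1 T (s n)) \<longlonglongrightarrow> comm1 T b"
proof -
  obtain s A where s: "\<And>n. s n \<in> Alg T" "s \<longlonglongrightarrow> b" "(\<lambda>n. comm1 T (s n)) \<longlonglongrightarrow> A"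
    using assms unfolding B1_iff_sequence by blast
  moreover have "comm1 T b = A" by (rule C1_op_limit(2)[OF C1_op_Alg[OF s(1)] s(2,3)])
  ultimately show ?thesis using that by blast
qed

lemma C1_op_B1: assumes "b \<in> B1 T" shows "C1_op b"
  using assms by (rule B1E) (rule C1_op_limit(1)[OF C1_op_Alg])

lemma clinear_op_B1: "b \<in> B1 T \<Longrightarrow> clinear_op b"
  by (rule C1_op_clinear[OF C1_op_B1])

text \<open>Completeness of \<open>B\<^sub>1\<close>: its elements correspond to the closure of the graph of
  \<open>b \<mapsto> [D, b]\<close>. It is what makes \<open>v\<close> map \<open>X\<^sub>v\<close> to columns over \<open>B\<^sub>1\<close>.\<close>

lemma B1_limit:
  assumes s: "\<And>n. s n \<in> B1 T" "s \<longlonglongrightarrow> b" "(\<lambda>n. comm1 T (s n)) \<longlonglongrightarrow> A"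
  shows "b \<in> B1 T"
proof -
  define G where "G = {(x, comm1 T x) |x. x \<in> Alg T}"
  have "(x, comm1 T x) \<in> closure G" if x: "x \<in> B1 T" for x
  proof -
    obtain t where t: "\<And>n. t n \<in> Alg T" "t \<longlonglongrightarrow> x" "(\<lambda>n. comm1 T (t n)) \<longlonglongrightarrow> comm1 T x"
      using B1E[OF x] by metis
    then have "(\<lambda>n. (t n, comm1 T (t n))) \<longlonglongrightarrow> (x, comm1 T x)" by (intro tendsto_Pair)
    moreover have "(t n, comm1 T (t n)) \<in> G" for n using t(1) by (auto simp: G_def)
    ultimately show ?thesis unfolding closure_sequential by (intro exI[of _ "\<lambda>n. (t n, comm1 T (t n))"]) simp
  qed
  then have "(b, A) \<in> closure G"
    using closed_sequentially[OF closed_closure, of "\<lambda>n. (s n, comm1 T (s n))" G "(b, A)"] s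
    by (simp add: tendsto_Pair)
  then obtain g where g: "\<And>n. g n \<in> G" "g \<longlonglongrightarrow> (b, A)" unfolding closure_sequential by blast
  have gn: "comm1 T (fst (g n)) = snd (g n)" "fst (g n) \<in> Alg T" for n
    using g(1)[of n] by (auto simp: G_def)
  have "(\<lambda>n. comm1 T (fst (g n))) \<longlonglongrightarrow> A"
    unfolding gn using tendsto_snd[OF g(2)] by simp
  moreover have "(\<lambda>n. fst (g n)) \<longlonglongrightarrow> b" using tendsto_fst[OF g(2)] by simp
  ultimately show ?thesis using B1I[of "\<lambda>n. fst (g n)"] gn(2) by blast
qed

lemma csubspace_B1: "csubspace (B1 T)"
  unfolding complex_vector.subspace_def
proof (intro conjI ballI allI)
  show "0 \<in> B1 T"
    using complex_vector.subspace_0[OF csubspace_Alg]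
    by (intro B1I[of "\<lambda>_. 0"]) (auto intro: tendsto_const)
next
  fix a b assume "a \<in> B1 T" "b \<in> B1 T"
  then obtain s t where s: "\<And>n. s n \<in> Alg T" "s \<longlonglongrightarrow> a" "(\<lambda>n. comm1 T (s n)) \<longlonglongrightarrow> comm1 T a"
    and t: "\<And>n. t n \<in> Alg T" "t \<longlonglongrightarrow> b" "(\<lambda>n. comm1 T (t n)) \<longlonglongrightarrow> comm1 T b"
    using B1E by metis
  have "(\<lambda>n. comm1 T (s n + t n)) \<longlonglongrightarrow> comm1 T a + comm1 T b"
    using tendsto_add[OF s(3) t(3)] by (simp add: comm1_add C1_op_Alg s t)
  then show "a + b \<in> B1 T"
    by (rule B1I[rotated 2]) (intro Alg_add s t tendsto_add)+
next
  fix c b assume "b \<in> B1 T"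
  then obtain s where s: "\<And>n. s n \<in> Alg T" "s \<longlonglongrightarrow> b" "(\<lambda>n. comm1 T (s n)) \<longlonglongrightarrow> comm1 T b"
    using B1E by metis
  have "(\<lambda>n. comm1 T (c *\<^sub>C s n)) \<longlonglongrightarrow> c *\<^sub>C comm1 T b"
    using tendsto_scaleC[OF s(3)] by (simp add: comm1_scaleC C1_op_Alg s)
  then show "c *\<^sub>C b \<in> B1 T"
    by (rule B1I[rotated 2]) (intro Alg_scaleC s tendsto_scaleC)+
qed

lemma B1_compose:
  assumes "a \<in> B1 T" "b \<in> B1 T" shows "a o\<^sub>L b \<in> B1 T"
proof -
  obtain s t where s: "\<And>n. s n \<in> Alg T" "s \<longlonglongrightarrow> a" "(\<lambda>n. comm1 T (s n)) \<longlonglongrightarrow> comm1 T a"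
    and t: "\<And>n. t n \<in> Alg T" "t \<longlonglongrightarrow> b" "(\<lambda>n. comm1 T (t n)) \<longlonglongrightarrow> comm1 T b"
    using B1E assms by metis
  have "(\<lambda>n. (comm1 T (s n) o\<^sub>L t n) + (s n o\<^sub>L comm1 T (t n))) \<longlonglongrightarrow>
      (comm1 T a o\<^sub>L b) + (a o\<^sub>L comm1 T b)"
    by (intro tendsto_add tendsto_blinfun_compose s t)
  then have "(\<lambda>n. comm1 T (s n o\<^sub>L t n)) \<longlonglongrightarrow> (comm1 T a o\<^sub>L b) + (a o\<^sub>L comm1 T b)"
    by (simp add: comm1_compose C1_op_Alg s t)
  then show ?thesis
    by (rule B1I[rotated 2]) (intro Alg_compose s t tendsto_blinfun_compose)+
qed

text \<open>The norm of \<open>\<pi>\<^sup>2(b\<^sup>*)\<close> contributes only \<open>[D\<^sup>2, b\<^sup>*] (D + i)\<inverse>\<close>, since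
  \<open>[D, b\<^sup>*] = - [D, b]\<^sup>*\<close> is controlled by \<open>[D, b]\<close>.\<close>

lemma B2_iff_sequence:
  "b \<in> B2 T \<longleftrightarrow> (\<exists>s A A' A''. (\<forall>n. s n \<in> Alg T) \<and> s \<longlonglongrightarrow> b \<and> (\<lambda>n. comm1 T (s n)) \<longlonglongrightarrow> A \<and>
    (\<lambda>n. comm2R T (s n)) \<longlonglongrightarrow> A' \<and> (\<lambda>n. comm2R T (cadj (s n))) \<longlonglongrightarrow> A'')"
proof -
  define J where "J x = ((x, comm1 T x), (comm2R T x, comm2R T (cadj x)))" for x
  have dist: "dist (J x) (J y) = norm (J (x - y))" if "x \<in> Alg T" "y \<in> Alg T" for x y
    using that by (simp add: J_def dist_norm comm1_diff C1_op_Alg comm2R_diff C2_op_Alg cadj_diff_Alg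
        Alg_cadj)
  have "b \<in> B2 T \<longleftrightarrow> (\<exists>s l. (\<forall>n. s n \<in> Alg T) \<and> s \<longlonglongrightarrow> b \<and> (\<lambda>n. J (s n)) \<longlonglongrightarrow> l)"
    unfolding B2_def
  proof (rule completion_in_iff[where C = 4])
    fix x y assume xy: "x \<in> Alg T" "y \<in> Alg T"
    define d where "d = x - y"
    have d: "d \<in> Alg T" using xy by (simp add: d_def Alg_diff)
    note C1 = C1_op_Alg[OF d] C1_op_Alg[OF Alg_cadj[OF d]]
    have J: "0 \<le> norm (J d)" "norm d \<le> norm (J d)" "norm (comm1 T d) \<le> norm (J d)"
      "norm (comm2R T d) \<le> norm (J d)" "norm (comm2R T (cadj d)) \<le> norm (J d)"
      unfolding J_def
      using norm_fst_le[of "(d, comm1 T d)" "(comm2R T d, comm2R T (cadj d))"]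
        norm_snd_le[of "(comm2R T d, comm2R T (cadj d))" "(d, comm1 T d)"]
        norm_fst_le[of d "comm1 T d"] norm_snd_le[of "comm1 T d" d]
        norm_fst_le[of "comm2R T d" "comm2R T (cadj d)"] norm_snd_le[of "comm2R T (cadj d)" "comm2R T d"]
        norm_ge_zero[of "((d, comm1 T d), (comm2R T d, comm2R T (cadj d)))"]
      by linarith+
    have adj: "norm (cadj d) \<le> norm d" "norm (comm1 T (cadj d)) \<le> norm (comm1 T d)"
      using norm_cadj_le[OF C1_op_clinear[OF C1(1)]] norm_cadj_le[OF clinear_op_comm1[OF C1(1)]]
      by (simp_all add: comm1_cadj C1)
    have "norm (pi1 T d) \<le> 4 * norm (J d)"
      unfolding pi1_eq_blk using norm_blk_le[of d "comm1 T d" d] J by linarith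
    moreover have "norm (pi2 T d) \<le> 4 * norm (J d)"
      unfolding pi2_eq_blk[OF C1(1)]
      using norm_blk_le[of "conj_op d" "comm2R T d" d] norm_conj_op_le[of d] J by linarith
    moreover have "norm (pi2 T (cadj d)) \<le> 4 * norm (J d)"
      unfolding pi2_eq_blk[OF C1(2)]
      using norm_blk_le[of "conj_op (cadj d)" "comm2R T (cadj d)" "cadj d"]
        norm_conj_op_le[of "cadj d"] J adj by linarith
    ultimately show "norm2 T (x - y) \<le> 4 * dist (J x) (J y)"
      unfolding dist[OF xy] by (simp add: norm2_def d_def)
    have "norm (J d) \<le> (norm d + norm (comm1 T d)) + (norm (comm2R T d) + norm (comm2R T (cadj d)))"
      unfolding J_def by (intro order.trans[OF norm_Pair_le] add_mono norm_Pair_le order.refl)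
    moreover have "norm d \<le> norm (pi1 T d)" "norm (comm1 T d) \<le> norm (pi1 T d)"
      "norm (comm2R T d) \<le> norm (pi2 T d)" "norm (comm2R T (cadj d)) \<le> norm (pi2 T (cadj d))"
      by (simp_all add: pi1_eq_blk pi2_eq_blk C1 norm_le_norm_blk)
    moreover have "norm (pi1 T d) \<le> norm2 T d" "norm (pi2 T d) \<le> norm2 T d"
      "norm (pi2 T (cadj d)) \<le> norm2 T d"
      by (simp_all add: norm2_def)
    ultimately show "dist (J x) (J y) \<le> 4 * norm2 T (x - y)"
      unfolding dist[OF xy] d_def[symmetric] by linarith
  qed simp
  also have "\<dots> \<longleftrightarrow> (\<exists>s A A' A''. (\<forall>n. s n \<in> Alg T) \<and> s \<longlonglongrightarrow> b \<and> (\<lambda>n. comm1 T (s n)) \<longlonglongrightarrow> A \<and>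
    (\<lambda>n. comm2R T (s n)) \<longlonglongrightarrow> A' \<and> (\<lambda>n. comm2R T (cadj (s n))) \<longlonglongrightarrow> A'')"
    (is "?L \<longleftrightarrow> ?R")
  proof
    assume ?L
    then obtain s l where s: "\<forall>n. s n \<in> Alg T" "s \<longlonglongrightarrow> b" and l: "(\<lambda>n. J (s n)) \<longlonglongrightarrow> l" by blast
    from tendsto_snd[OF tendsto_fst[OF l]] tendsto_fst[OF tendsto_snd[OF l]]
      tendsto_snd[OF tendsto_snd[OF l]] s
    show ?R unfolding J_def fst_conv snd_conv by blast
  next
    assume ?R
    then obtain s A A' A'' where s: "\<forall>n. s n \<in> Alg T" "s \<longlonglongrightarrow> b" "(\<lambda>n. comm1 T (s n)) \<longlonglongrightarrow> A"
      "(\<lambda>n. comm2R T (s n)) \<longlonglongrightarrow> A'" "(\<lambda>n. comm2R T (cadj (s n))) \<longlonglongrightarrow> A''" by blast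
    then have "(\<lambda>n. J (s n)) \<longlonglongrightarrow> ((b, A), (A', A''))"
      unfolding J_def by (intro tendsto_Pair)
    with s show ?L by blast
  qed
  finally show ?thesis .
qed

lemma B2I:
  "(\<And>n. s n \<in> Alg T) \<Longrightarrow> s \<longlonglongrightarrow> b \<Longrightarrow> (\<lambda>n. comm1 T (s n)) \<longlonglongrightarrow> A \<Longrightarrow>
    (\<lambda>n. comm2R T (s n)) \<longlonglongrightarrow> A' \<Longrightarrow> (\<lambda>n. comm2R T (cadj (s n))) \<longlonglongrightarrow> A'' \<Longrightarrow> b \<in> B2 T"
  unfolding B2_iff_sequence by blast

text \<open>All the convergences that membership in \<open>B\<^sub>2\<close> provides for one and the same sequence.
  Those of the adjoints are what carries \<open>B\<^sub>2\<close> through products, because the norm of \<open>B\<^sub>2\<close>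
  contains \<open>\<pi>\<^sup>2((a b)\<^sup>*) = \<pi>\<^sup>2(b\<^sup>*) \<pi>\<^sup>2(a\<^sup>*)\<close>.\<close>

definition approximates :: "(nat \<Rightarrow> 'h \<Rightarrow>\<^sub>L 'h) \<Rightarrow> ('h \<Rightarrow>\<^sub>L 'h) \<Rightarrow> bool"
  where "approximates s b \<longleftrightarrow> (\<forall>n. s n \<in> Alg T) \<and> s \<longlonglongrightarrow> b \<and>
    (\<lambda>n. comm1 T (s n)) \<longlonglongrightarrow> comm1 T b \<and> (\<lambda>n. comm2R T (s n)) \<longlonglongrightarrow> comm2R T b \<and>
    (\<lambda>n. cadj (s n)) \<longlonglongrightarrow> cadj b \<and> (\<lambda>n. comm1 T (cadj (s n))) \<longlonglongrightarrow> comm1 T (cadj b) \<and>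
    (\<lambda>n. comm2R T (cadj (s n))) \<longlonglongrightarrow> comm2R T (cadj b)"

lemma approximatesD:
  assumes "approximates s b"
  shows "s n \<in> Alg T" "s \<longlonglongrightarrow> b"
    "(\<lambda>n. comm1 T (s n)) \<longlonglongrightarrow> comm1 T b" "(\<lambda>n. comm2R T (s n)) \<longlonglongrightarrow> comm2R T b"
    "(\<lambda>n. cadj (s n)) \<longlonglongrightarrow> cadj b" "(\<lambda>n. comm1 T (cadj (s n))) \<longlonglongrightarrow> comm1 T (cadj b)"
    "(\<lambda>n. comm2R T (cadj (s n))) \<longlonglongrightarrow> comm2R T (cadj b)"
  using assms unfolding approximates_def by simp_all

lemma B2_approximation:
  assumes "b \<in> B2 T"
  shows "C2_op b \<and> C2_op (cadj b) \<and> (\<exists>s. approximates s b)"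
proof -
  obtain s A A' A'' where s: "\<And>n. s n \<in> Alg T" "s \<longlonglongrightarrow> b" "(\<lambda>n. comm1 T (s n)) \<longlonglongrightarrow> A"
    "(\<lambda>n. comm2R T (s n)) \<longlonglongrightarrow> A'" "(\<lambda>n. comm2R T (cadj (s n))) \<longlonglongrightarrow> A''"
    using assms unfolding B2_iff_sequence by blast
  have b: "C2_op b" "comm2R T b = A'" "comm1 T b = A"
    using C2_op_limit[OF C2_op_Alg[OF s(1)] s(2,3,4)] C1_op_limit(2)[OF C1_op_Alg[OF s(1)] s(2,3)]
    by blast+
  have adj: "(\<lambda>n. cadj (s n)) \<longlonglongrightarrow> cadj b"
    by (rule tendsto_cadj[OF clinear_op_Alg[OF s(1)] C1_op_clinear[OF C2_op_C1[OF b(1)]] s(2)])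
  have "(\<lambda>n. - cadj (comm1 T (s n))) \<longlonglongrightarrow> - cadj (comm1 T b)"
    using s(3) unfolding b(3)[symmetric]
    by (intro tendsto_minus tendsto_cadj clinear_op_comm1 C1_op_Alg[OF s(1)] C2_op_C1[OF b(1)])
  then have adj1: "(\<lambda>n. comm1 T (cadj (s n))) \<longlonglongrightarrow> comm1 T (cadj b)"
    using b(1) by (simp add: comm1_cadj C1_op_Alg s C2_op_C1)
  have "C2_op (cadj b)" "comm2R T (cadj b) = A''"
    using C2_op_limit[OF C2_op_Alg[OF Alg_cadj[OF s(1)]] adj adj1 s(5)] by blast+
  with b adj adj1 s have "approximates s b" unfolding approximates_def by simp
  with b \<open>C2_op (cadj b)\<close> show ?thesis by blast
qed

lemma C2_op_B2: "b \<in> B2 T \<Longrightarrow> C2_op b" and C2_op_cadj_B2: "b \<in> B2 T \<Longrightarrow> C2_op (cadj b)"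
  using B2_approximation by blast+

lemma C1_op_B2: "b \<in> B2 T \<Longrightarrow> C1_op b"
  by (rule C2_op_C1[OF C2_op_B2])

lemma clinear_op_B2: "b \<in> B2 T \<Longrightarrow> clinear_op b"
  by (rule C1_op_clinear[OF C1_op_B2])

lemma B2_imp_B1:
  assumes "b \<in> B2 T" shows "b \<in> B1 T"
proof -
  obtain s where "approximates s b" using B2_approximation[OF assms] by blast
  from approximatesD(1-3)[OF this] show ?thesis by (rule B1I)
qed

lemma Alg_imp_B2: "b \<in> Alg T \<Longrightarrow> b \<in> B2 T"
  by (rule B2I[of "\<lambda>_. b"]) (auto intro: tendsto_const)

lemma id_in_B2: "id_blinfun \<in> B2 T"
  by (rule Alg_imp_B2[OF id_in_Alg])

lemma id_in_B1: "id_blinfun \<in> B1 T"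
  by (rule B2_imp_B1[OF id_in_B2])

lemma csubspace_B2: "csubspace (B2 T)"
  unfolding complex_vector.subspace_def
proof (intro conjI ballI allI)
  show "0 \<in> B2 T" by (rule Alg_imp_B2[OF complex_vector.subspace_0[OF csubspace_Alg]])
next
  fix a b assume "a \<in> B2 T" "b \<in> B2 T"
  then obtain s t where "approximates s a" "approximates t b" using B2_approximation by blast
  note s = approximatesD[OF this(1)] and t = approximatesD[OF this(2)]
  have "(\<lambda>n. comm1 T (s n + t n)) \<longlonglongrightarrow> comm1 T a + comm1 T b"
    using tendsto_add[OF s(3) t(3)] by (simp add: comm1_add C1_op_Alg s t)
  moreover have "(\<lambda>n. comm2R T (s n + t n)) \<longlonglongrightarrow> comm2R T a + comm2R T b"
    using tendsto_add[OF s(4) t(4)] by (simp add: comm2R_add C2_op_Alg s t)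
  moreover have "(\<lambda>n. comm2R T (cadj (s n + t n))) \<longlonglongrightarrow> comm2R T (cadj a) + comm2R T (cadj b)"
    using tendsto_add[OF s(7) t(7)]
    by (simp add: comm2R_add C2_op_Alg Alg_cadj s t cadj_add clinear_op_Alg)
  ultimately show "a + b \<in> B2 T"
    by (rule B2I[rotated 2]) (intro Alg_add s t tendsto_add)+
next
  fix c b assume "b \<in> B2 T"
  then obtain s where "approximates s b" using B2_approximation by blast
  note s = approximatesD[OF this]
  have "(\<lambda>n. comm1 T (c *\<^sub>C s n)) \<longlonglongrightarrow> c *\<^sub>C comm1 T b"
    using tendsto_scaleC[OF s(3)] by (simp add: comm1_scaleC C1_op_Alg s)
  moreover have "(\<lambda>n. comm2R T (c *\<^sub>C s n)) \<longlonglongrightarrow> c *\<^sub>C comm2R T b"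
    using tendsto_scaleC[OF s(4)] by (simp add: comm2R_scaleC C2_op_Alg s)
  moreover have "(\<lambda>n. comm2R T (cadj (c *\<^sub>C s n))) \<longlonglongrightarrow> cnj c *\<^sub>C comm2R T (cadj b)"
    using tendsto_scaleC[OF s(7)]
    by (simp add: comm2R_scaleC C2_op_Alg Alg_cadj s cadj_scaleC clinear_op_Alg)
  ultimately show "c *\<^sub>C b \<in> B2 T"
    by (rule B2I[rotated 2]) (intro Alg_scaleC s tendsto_scaleC)+
qed

lemma tendsto_conj_op:
  "s \<longlonglongrightarrow> b \<Longrightarrow> (\<lambda>n. comm1 T (s n)) \<longlonglongrightarrow> comm1 T b \<Longrightarrow> (\<lambda>n. conj_op (s n)) \<longlonglongrightarrow> conj_op b"
  unfolding conj_op_def by (intro tendsto_add tendsto_blinfun_compose tendsto_const)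

lemma B2_compose:
  assumes "a \<in> B2 T" "b \<in> B2 T" shows "a o\<^sub>L b \<in> B2 T"
proof -
  obtain s t where "approximates s a" "approximates t b" using B2_approximation assms by blast
  note s = approximatesD[OF this(1)] and t = approximatesD[OF this(2)]
  have "(\<lambda>n. comm1 T (s n o\<^sub>L t n)) \<longlonglongrightarrow> (comm1 T a o\<^sub>L b) + (a o\<^sub>L comm1 T b)"
    unfolding comm1_compose[OF C1_op_Alg[OF s(1)] C1_op_Alg[OF t(1)]]
    by (intro tendsto_add tendsto_blinfun_compose s t)
  moreover have "(\<lambda>n. comm2R T (s n o\<^sub>L t n)) \<longlonglongrightarrow> (comm2R T a o\<^sub>L conj_op b) + (a o\<^sub>L comm2R T b)"
    unfolding comm2R_compose[OF C2_op_Alg[OF s(1)] C2_op_Alg[OF t(1)]]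
    by (intro tendsto_add tendsto_blinfun_compose tendsto_conj_op s t)
  moreover have "(\<lambda>n. comm2R T (cadj (s n o\<^sub>L t n))) \<longlonglongrightarrow>
      (comm2R T (cadj b) o\<^sub>L conj_op (cadj a)) + (cadj b o\<^sub>L comm2R T (cadj a))"
    unfolding cadj_compose[OF clinear_op_Alg[OF s(1)] clinear_op_Alg[OF t(1)]]
      comm2R_compose[OF C2_op_Alg[OF Alg_cadj[OF t(1)]] C2_op_Alg[OF Alg_cadj[OF s(1)]]]
    by (intro tendsto_add tendsto_blinfun_compose tendsto_conj_op s t)
  ultimately show ?thesis
    by (rule B2I[rotated 2]) (intro Alg_compose s t tendsto_blinfun_compose)+
qed

lemma B1_imp_Balg:
  assumes "b \<in> B1 T" shows "b \<in> Balg T"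
proof -
  obtain s where "\<And>n. s n \<in> Alg T" "s \<longlonglongrightarrow> b" using B1E[OF assms] by metis
  then show ?thesis unfolding Balg_def closure_sequential by (intro exI[of _ s]) simp
qed

lemma clinear_op_Balg:
  assumes "b \<in> Balg T" shows "clinear_op b"
proof -
  have "Balg T \<subseteq> {b. clinear_op b}"
    unfolding Balg_def by (rule closure_minimal[OF _ closed_clinear_op]) (auto intro: clinear_op_Alg)
  with assms show ?thesis by blast
qed

lemmas B1_add = complex_vector.subspace_add[OF csubspace_B1]
lemmas B1_scaleC = complex_vector.subspace_scale[OF csubspace_B1]
lemmas B1_0 = complex_vector.subspace_0[OF csubspace_B1]
lemmas B1_sum = complex_vector.subspace_sum[OF csubspace_B1]
lemmas B2_add = complex_vector.subspace_add[OF csubspace_B2]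
lemmas B2_scaleC = complex_vector.subspace_scale[OF csubspace_B2]
lemmas B2_0 = complex_vector.subspace_0[OF csubspace_B2]

end

section \<open>Row and column norms\<close>

text \<open>Both the row and the column norm are infima of the constants \<open>C\<close> in an inequality
  \<open>x \<le> C y\<close>. The infimum is itself such a constant.\<close>

lemma Inf_bounds:
  fixes x y :: "'j \<Rightarrow> real"
  defines "S \<equiv> {C. 0 \<le> C \<and> (\<forall>j. x j \<le> C * y j)}"
  assumes y: "\<And>j. 0 \<le> y j"
  shows "0 \<le> C \<Longrightarrow> (\<And>j. x j \<le> C * y j) \<Longrightarrow> Inf S \<le> C"
    and "S \<noteq> {} \<Longrightarrow> 0 \<le> Inf S"
    and "S \<noteq> {} \<Longrightarrow> x j \<le> Inf S * y j"
proof -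
  have "bdd_below S" by (rule bdd_belowI[of _ 0]) (simp add: S_def)
  then show "Inf S \<le> C" if "0 \<le> C" "\<And>j. x j \<le> C * y j"
    using that by (intro cInf_lower) (simp_all add: S_def)
  show "0 \<le> Inf S" if "S \<noteq> {}" using that by (rule cInf_greatest) (simp add: S_def)
  show "x j \<le> Inf S * y j" if ne: "S \<noteq> {}"
  proof (cases "y j = 0")
    case True
    from ne obtain C where "x j \<le> C * y j" by (auto simp: S_def)
    with True show ?thesis by simp
  next
    case False
    then have pos: "0 < y j" using y[of j] by simp
    have "x j / y j \<le> Inf S"
      using ne by (rule cInf_greatest) (use pos in \<open>auto simp: S_def divide_le_eq\<close>)
    then show ?thesis using pos by (simp add: divide_le_eq)
  qed
qed

context
  fixes I :: "'i set" and a :: "'i \<Rightarrow> ('a :: real_normed_vector \<Rightarrow>\<^sub>L 'b :: real_normed_vector)"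
  assumes fin: "finite I"
begin

lemma row_norm_set_nonempty:
  "{C. 0 \<le> C \<and> (\<forall>\<xi>. norm (\<Sum>i\<in>I. a i (\<xi> i)) \<le> C * L2_set (\<lambda>i. norm (\<xi> i)) I)} \<noteq> {}"
proof -
  have "norm (\<Sum>i\<in>I. a i (\<xi> i)) \<le> L2_set (\<lambda>i. norm (a i)) I * L2_set (\<lambda>i. norm (\<xi> i)) I" for \<xi>
  proof -
    have "norm (\<Sum>i\<in>I. a i (\<xi> i)) \<le> (\<Sum>i\<in>I. norm (a i) * norm (\<xi> i))"
      by (intro sum_norm_le norm_blinfun)
    also have "\<dots> \<le> (\<Sum>i\<in>I. \<bar>norm (a i)\<bar> * \<bar>norm (\<xi> i)\<bar>)" by simp
    also have "\<dots> \<le> L2_set (\<lambda>i. norm (a i)) I * L2_set (\<lambda>i. norm (\<xi> i)) I"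
      by (rule L2_set_mult_ineq)
    finally show ?thesis .
  qed
  then have "L2_set (\<lambda>i. norm (a i)) I \<in>
      {C. 0 \<le> C \<and> (\<forall>\<xi>. norm (\<Sum>i\<in>I. a i (\<xi> i)) \<le> C * L2_set (\<lambda>i. norm (\<xi> i)) I)}" by simp
  then show ?thesis by blast
qed

lemma col_norm_set_nonempty:
  "{C. 0 \<le> C \<and> (\<forall>\<xi>. L2_set (\<lambda>i. norm (a i \<xi>)) I \<le> C * norm \<xi>)} \<noteq> {}"
proof -
  have "L2_set (\<lambda>i. norm (a i \<xi>)) I \<le> L2_set (\<lambda>i. norm (a i)) I * norm \<xi>" for \<xi>
    unfolding L2_set_left_distrib[OF norm_ge_zero] by (intro L2_set_mono norm_blinfun) simp
  then have "L2_set (\<lambda>i. norm (a i)) I \<in>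
      {C. 0 \<le> C \<and> (\<forall>\<xi>. L2_set (\<lambda>i. norm (a i \<xi>)) I \<le> C * norm \<xi>)}" by simp
  then show ?thesis by blast
qed

lemma row_norm_nonneg: "0 \<le> row_norm I a"
  unfolding row_norm_def by (rule Inf_bounds(2)[OF _ row_norm_set_nonempty]) simp

lemma col_norm_nonneg: "0 \<le> col_norm I a"
  unfolding col_norm_def by (rule Inf_bounds(2)[OF _ col_norm_set_nonempty]) simp

lemma row_norm_bound: "norm (\<Sum>i\<in>I. a i (\<xi> i)) \<le> row_norm I a * L2_set (\<lambda>i. norm (\<xi> i)) I"
  unfolding row_norm_def
  by (rule Inf_bounds(3)[OF _ row_norm_set_nonempty]) simp

lemma col_norm_bound: "L2_set (\<lambda>i. norm (a i \<xi>)) I \<le> col_norm I a * norm \<xi>"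
  unfolding col_norm_def by (rule Inf_bounds(3)[OF _ col_norm_set_nonempty]) simp

lemma norm_le_col_norm: "i \<in> I \<Longrightarrow> norm (a i) \<le> col_norm I a"
proof (rule norm_blinfun_bound[OF col_norm_nonneg])
  fix \<xi> assume "i \<in> I"
  then have "norm (a i \<xi>) \<le> L2_set (\<lambda>i. norm (a i \<xi>)) I"
    using fin by (intro member_le_L2_set) auto
  also note col_norm_bound
  finally show "norm (a i \<xi>) \<le> col_norm I a * norm \<xi>" .
qed

end

lemma row_norm_cong: "(\<And>i. i \<in> I \<Longrightarrow> a i = b i) \<Longrightarrow> row_norm I a = row_norm I b"
  by (simp add: row_norm_def)

lemma col_norm_cong: "(\<And>i. i \<in> I \<Longrightarrow> a i = b i) \<Longrightarrow> col_norm I a = col_norm I b"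
  by (simp add: col_norm_def cong: L2_set_cong)

lemma row_norm_le:
  fixes a :: "'i \<Rightarrow> ('a :: real_normed_vector \<Rightarrow>\<^sub>L 'b :: real_normed_vector)"
  assumes "0 \<le> C" "\<And>\<xi>. norm (\<Sum>i\<in>I. a i (\<xi> i)) \<le> C * L2_set (\<lambda>i. norm (\<xi> i)) I"
  shows "row_norm I a \<le> C"
  unfolding row_norm_def by (rule Inf_bounds(1)) (use assms in simp_all)

lemma col_norm_le:
  fixes a :: "'i \<Rightarrow> ('a :: real_normed_vector \<Rightarrow>\<^sub>L 'b :: real_normed_vector)"
  assumes "0 \<le> C" "\<And>\<xi>. L2_set (\<lambda>i. norm (a i \<xi>)) I \<le> C * norm \<xi>"
  shows "col_norm I a \<le> C"
  unfolding col_norm_def by (rule Inf_bounds(1)) (use assms in simp_all)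

lemma norm_sum_compose_le:
  fixes a :: "'i \<Rightarrow> ('b :: real_normed_vector \<Rightarrow>\<^sub>L 'c :: real_normed_vector)"
    and b :: "'i \<Rightarrow> ('a :: real_normed_vector \<Rightarrow>\<^sub>L 'b)"
  assumes fin: "finite I"
  shows "norm (\<Sum>i\<in>I. a i o\<^sub>L b i) \<le> row_norm I a * col_norm I b"
proof (rule norm_blinfun_bound)
  show "0 \<le> row_norm I a * col_norm I b"
    by (intro mult_nonneg_nonneg row_norm_nonneg col_norm_nonneg fin)
  fix x
  have "norm ((\<Sum>i\<in>I. a i o\<^sub>L b i) x) = norm (\<Sum>i\<in>I. a i (b i x))"
    by (simp add: blinfun.sum_left)
  also have "\<dots> \<le> row_norm I a * L2_set (\<lambda>i. norm (b i x)) I"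
    by (rule row_norm_bound[OF fin])
  also have "\<dots> \<le> row_norm I a * (col_norm I b * norm x)"
    by (intro mult_left_mono col_norm_bound row_norm_nonneg fin)
  finally show "norm ((\<Sum>i\<in>I. a i o\<^sub>L b i) x) \<le> row_norm I a * col_norm I b * norm x"
    by (simp add: mult.assoc)
qed

text \<open>Test vectors of the form \<open>(\<xi>\<^sub>i, 0)\<close> single out the first column of the blocks.\<close>

lemma row_norm_corner_le:
  fixes A B C :: "'i \<Rightarrow> ('a :: real_normed_vector \<Rightarrow>\<^sub>L 'a)"
  assumes fin: "finite I"
  shows "row_norm I A \<le> row_norm I (\<lambda>i. blk (A i) (B i) (C i))" (is ?A)
    and "row_norm I B \<le> row_norm I (\<lambda>i. blk (A i) (B i) (C i))" (is ?B)
proof -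
  define P where "P i = blk (A i) (B i) (C i)" for i
  have *: "norm (\<Sum>i\<in>I. A i (\<xi> i), \<Sum>i\<in>I. B i (\<xi> i)) \<le> row_norm I P * L2_set (\<lambda>i. norm (\<xi> i)) I" for \<xi>
  proof -
    have "(\<Sum>i\<in>I. P i (\<xi> i, 0)) = (\<Sum>i\<in>I. A i (\<xi> i), \<Sum>i\<in>I. B i (\<xi> i))"
      by (simp add: P_def sum_prod)
    then show ?thesis using row_norm_bound[OF fin, of P "\<lambda>i. (\<xi> i, 0)"] by simp
  qed
  show ?A ?B
    unfolding P_def[symmetric]
    by (intro row_norm_le row_norm_nonneg fin order.trans[OF _ *] norm_fst_le norm_snd_le)+
qed

lemma col_norm_corner_le:
  fixes A B C :: "'i \<Rightarrow> ('a :: real_normed_vector \<Rightarrow>\<^sub>L 'a)"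
  assumes fin: "finite I"
  shows "col_norm I A \<le> col_norm I (\<lambda>i. blk (A i) (B i) (C i))" (is ?A)
    and "col_norm I B \<le> col_norm I (\<lambda>i. blk (A i) (B i) (C i))" (is ?B)
proof -
  define P where "P i = blk (A i) (B i) (C i)" for i
  have *: "L2_set (\<lambda>i. norm (P i (\<xi>, 0))) I \<le> col_norm I P * norm \<xi>" for \<xi>
    using col_norm_bound[OF fin, of P "(\<xi>, 0)"] by simp
  show ?A ?B
    unfolding P_def[symmetric]
    by (intro col_norm_le col_norm_nonneg fin order.trans[OF _ *] L2_set_mono;
      simp add: P_def norm_fst_le norm_snd_le)+
qed

lemma row_norm_compose_le:
  fixes A :: "'b :: real_normed_vector \<Rightarrow>\<^sub>L 'c :: real_normed_vector"
    and P :: "'i \<Rightarrow> ('a :: real_normed_vector \<Rightarrow>\<^sub>L 'b)"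
  assumes fin: "finite I"
  shows "row_norm I (\<lambda>i. A o\<^sub>L P i) \<le> norm A * row_norm I P"
proof (rule row_norm_le)
  fix \<xi>
  have "norm (\<Sum>i\<in>I. (A o\<^sub>L P i) (\<xi> i)) = norm (A (\<Sum>i\<in>I. P i (\<xi> i)))"
    by (simp add: blinfun.sum_right)
  also have "\<dots> \<le> norm A * norm (\<Sum>i\<in>I. P i (\<xi> i))" by (rule norm_blinfun)
  also have "\<dots> \<le> norm A * (row_norm I P * L2_set (\<lambda>i. norm (\<xi> i)) I)"
    by (intro mult_left_mono row_norm_bound fin) simp
  finally show "norm (\<Sum>i\<in>I. (A o\<^sub>L P i) (\<xi> i)) \<le> norm A * row_norm I P * L2_set (\<lambda>i. norm (\<xi> i)) I"
    by (simp add: mult.assoc)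
qed (simp add: row_norm_nonneg fin)

lemma col_norm_compose_le:
  fixes A :: "'a :: real_normed_vector \<Rightarrow>\<^sub>L 'b :: real_normed_vector"
    and P :: "'i \<Rightarrow> ('b \<Rightarrow>\<^sub>L 'c :: real_normed_vector)"
  assumes fin: "finite I"
  shows "col_norm I (\<lambda>i. P i o\<^sub>L A) \<le> col_norm I P * norm A"
proof (rule col_norm_le)
  fix \<xi>
  have "L2_set (\<lambda>i. norm ((P i o\<^sub>L A) \<xi>)) I \<le> col_norm I P * norm (A \<xi>)"
    using col_norm_bound[OF fin, of P "A \<xi>"] by simp
  also have "\<dots> \<le> col_norm I P * (norm A * norm \<xi>)"
    by (intro mult_left_mono norm_blinfun col_norm_nonneg fin)
  finally show "L2_set (\<lambda>i. norm ((P i o\<^sub>L A) \<xi>)) I \<le> col_norm I P * norm A * norm \<xi>"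
    by (simp add: mult.assoc)
qed (simp add: col_norm_nonneg fin)

lemma col_norm2_ge:
  "col_norm I (\<lambda>i. pi1 T (b i)) \<le> col_norm2 T I b"
  "col_norm I (\<lambda>i. pi2 T (b i)) \<le> col_norm2 T I b"
  "row_norm I (\<lambda>i. pi2 T (cadj (b i))) \<le> col_norm2 T I b"
  by (simp_all add: col_norm2_def)

lemma col_norm2_nonneg: "finite I \<Longrightarrow> 0 \<le> col_norm2 T I b"
  using col_norm2_ge(1)[of I T b] col_norm_nonneg[of I "\<lambda>i. pi1 T (b i)"] by linarith

section \<open>Sums over formal tensors\<close>

lemma sum_mset_mset_nth: "(\<Sum>x\<in>#mset l. f x) = (\<Sum>k<length l. f (l ! k))"
  unfolding mset_map[symmetric] sum_mset_sum_list
  by (simp add: sum_list_sum_nth atLeast0LessThan)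

text \<open>The well-definedness of the map that \<open>f\<close> induces on the tensor product, for tensors
  rendered as formal sums modulo congruence.\<close>

lemma tensor_eq_sum_mset:
  fixes f :: "'a :: ab_group_add \<Rightarrow> 'b :: ab_group_add \<Rightarrow> 'c :: comm_monoid_add"
  assumes "tensor_eq M N R ra la u u'"
    and "\<And>x x' y. x \<in> M \<Longrightarrow> x' \<in> M \<Longrightarrow> y \<in> N \<Longrightarrow> f (x + x') y = f x y + f x' y"
    and "\<And>x y y'. x \<in> M \<Longrightarrow> y \<in> N \<Longrightarrow> y' \<in> N \<Longrightarrow> f x (y + y') = f x y + f x y'"
    and "\<And>y. y \<in> N \<Longrightarrow> f 0 y = 0"
    and "\<And>x r y. x \<in> M \<Longrightarrow> r \<in> R \<Longrightarrow> y \<in> N \<Longrightarrow> f (ra x r) y = f x (la r y)"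
  shows "(\<Sum>(x, y)\<in>#u. f x y) = (\<Sum>(x, y)\<in>#u'. f x y)"
  using assms(1) by induction (simp_all add: assms(2-))

lemma tensor_eq_subset:
  assumes "tensor_eq M N R ra la u u'"
    and "\<And>x x'. x \<in> M \<Longrightarrow> x' \<in> M \<Longrightarrow> x + x' \<in> M" "0 \<in> M"
    and "\<And>y y'. y \<in> N \<Longrightarrow> y' \<in> N \<Longrightarrow> y + y' \<in> N"
    and "\<And>x r. x \<in> M \<Longrightarrow> r \<in> R \<Longrightarrow> ra x r \<in> M" "\<And>r y. r \<in> R \<Longrightarrow> y \<in> N \<Longrightarrow> la r y \<in> N"
  shows "set_mset u \<subseteq> M \<times> N \<and> set_mset u' \<subseteq> M \<times> N"
  using assms(1) by induction (use assms(2-) in auto)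

lemma sum_mset_scaleC_left:
  assumes "\<And>a b. (a, b) \<in># u \<Longrightarrow> f (c *\<^sub>C a) b = c *\<^sub>C f a b"
  shows "(\<Sum>(a, b)\<in>#image_mset (\<lambda>(a, b). (c *\<^sub>C a, b)) u. f a b) = c *\<^sub>C (\<Sum>(a, b)\<in>#u. f a b)"
  using assms by (induction u) (auto simp: scaleC_add_right)

lemma sum_mset_Pair_cong:
  "(\<And>a b. (a, b) \<in># u \<Longrightarrow> f a b = g a b) \<Longrightarrow> (\<Sum>(a, b)\<in>#u. f a b) = (\<Sum>(a, b)\<in>#u. g a b)"
  by (intro arg_cong[of _ _ sum_mset] image_mset_cong) auto

lemma sum_mset_sum_singleton:
  "finite I \<Longrightarrow> (\<Sum>x\<in>#(\<Sum>i\<in>I. {#a i#}). g x) = (\<Sum>i\<in>I. g (a i))"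
  by (induction I rule: finite_induct) simp_all

lemma sum_mset_image_Pair:
  "(\<Sum>(x, y)\<in>#image_mset (\<lambda>(x, y). (p x y, q x y)) u. f x y) = (\<Sum>(x, y)\<in>#u. f (p x y) (q x y))"
  by (induction u) auto

section \<open>Maps on the Haagerup tensor product\<close>

locale haagerup_tensor = spectral_triple T
  for T :: "'h :: chilbert_space striple" +
  fixes \<theta> :: "('h \<Rightarrow>\<^sub>L 'h) \<Rightarrow> ('h \<Rightarrow>\<^sub>L 'h) \<Rightarrow> 'w :: complex_banach"
  assumes H: "is_haagerup_tensor T \<theta>"
begin

lemma \<theta>_add_left: "a \<in> B1 T \<Longrightarrow> a' \<in> B1 T \<Longrightarrow> b \<in> B2 T \<Longrightarrow> \<theta> (a + a') b = \<theta> a b + \<theta> a' b"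
  and \<theta>_add_right: "a \<in> B1 T \<Longrightarrow> b \<in> B2 T \<Longrightarrow> b' \<in> B2 T \<Longrightarrow> \<theta> a (b + b') = \<theta> a b + \<theta> a b'"
  and \<theta>_scaleC_left: "a \<in> B1 T \<Longrightarrow> b \<in> B2 T \<Longrightarrow> \<theta> (c *\<^sub>C a) b = c *\<^sub>C \<theta> a b"
  and \<theta>_scaleC_right: "a \<in> B1 T \<Longrightarrow> b \<in> B2 T \<Longrightarrow> \<theta> a (c *\<^sub>C b) = c *\<^sub>C \<theta> a b"
  and norm_sum_\<theta>: "set_mset u \<subseteq> B1 T \<times> B2 T \<Longrightarrow> norm (\<Sum>(a, b)\<in>#u. \<theta> a b) = haagerup_norm T u"
  and dense_\<theta>: "closure (cspan {\<theta> a b | a b. a \<in> B1 T \<and> b \<in> B2 T}) = UNIV"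
  using H unfolding is_haagerup_tensor_def by simp_all

text \<open>The Haagerup norm of a tensor is the infimum of this quantity over the lists that
  represent it.\<close>

abbreviation haagerup_value :: "(('h \<Rightarrow>\<^sub>L 'h) \<times> ('h \<Rightarrow>\<^sub>L 'h)) list \<Rightarrow> real"
  where "haagerup_value l \<equiv> row_norm {..<length l} (\<lambda>k. pi1 T (fst (l ! k))) *
    col_norm2 T {..<length l} (\<lambda>k. snd (l ! k))"

lemma haagerup_value_nonneg: "0 \<le> haagerup_value l"
  by (intro mult_nonneg_nonneg row_norm_nonneg col_norm2_nonneg finite_lessThan)

lemma haagerup_norm_le:
  assumes "set l \<subseteq> B1 T \<times> B2 T"
  shows "haagerup_norm T (mset l) \<le> haagerup_value l"
  unfolding haagerup_norm_def
proof (rule cInf_lower)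
  show "haagerup_value l \<in> {haagerup_value l' |l'.
      tensor_eq (B1 T) (B2 T) UNIV (\<lambda>a c. c *\<^sub>C a) scaleC (mset l) (mset l')}"
    using assms by (auto intro!: exI[of _ l] tensor_eq.refl)
  show "bdd_below {haagerup_value l' |l'.
      tensor_eq (B1 T) (B2 T) UNIV (\<lambda>a c. c *\<^sub>C a) scaleC (mset l) (mset l')}"
    by (rule bdd_belowI[of _ 0]) (use haagerup_value_nonneg in auto)
qed

text \<open>These are the bilinear maps that extend to the Haagerup tensor product. The bound is asked
  of lists, since it is over lists that the infimum in the Haagerup norm is taken.\<close>

definition haagerup_bounded :: "(('h \<Rightarrow>\<^sub>L 'h) \<Rightarrow> ('h \<Rightarrow>\<^sub>L 'h) \<Rightarrow> 'z :: complex_normed_vector) \<Rightarrow> bool"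
  where "haagerup_bounded \<Phi> \<longleftrightarrow>
    (\<forall>a\<in>B1 T. \<forall>a'\<in>B1 T. \<forall>b\<in>B2 T. \<Phi> (a + a') b = \<Phi> a b + \<Phi> a' b) \<and>
    (\<forall>a\<in>B1 T. \<forall>b\<in>B2 T. \<forall>b'\<in>B2 T. \<Phi> a (b + b') = \<Phi> a b + \<Phi> a b') \<and>
    (\<forall>c. \<forall>a\<in>B1 T. \<forall>b\<in>B2 T. \<Phi> (c *\<^sub>C a) b = c *\<^sub>C \<Phi> a b \<and> \<Phi> a (c *\<^sub>C b) = c *\<^sub>C \<Phi> a b) \<and>
    (\<exists>K. \<forall>l. set l \<subseteq> B1 T \<times> B2 T \<longrightarrow> norm (\<Sum>(a, b)\<in>#mset l. \<Phi> a b) \<le> K * haagerup_value l)"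

lemma haagerup_bounded_tensor_eq:
  assumes "haagerup_bounded \<Phi>"
    and "tensor_eq (B1 T) (B2 T) (UNIV :: complex set) (\<lambda>a c. c *\<^sub>C a) scaleC u u'"
  shows "(\<Sum>(a, b)\<in>#u. \<Phi> a b) = (\<Sum>(a, b)\<in>#u'. \<Phi> a b)"
proof (rule tensor_eq_sum_mset[OF assms(2)])
  show "\<Phi> 0 b = 0" if "b \<in> B2 T" for b
  proof -
    have "\<Phi> (0 *\<^sub>C 0) b = 0 *\<^sub>C \<Phi> 0 b"
      using assms(1) that B1_0 unfolding haagerup_bounded_def by blast
    then show ?thesis by simp
  qed
qed (use assms(1) in \<open>simp_all add: haagerup_bounded_def\<close>)

text \<open>Every list representing \<open>u\<close> gives the same sum of values of \<open>\<Phi>\<close>, so the bound on lists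
  passes to the infimum.\<close>

lemma haagerup_bounded_norm_le:
  assumes "haagerup_bounded \<Phi>"
  shows "\<exists>K. \<forall>u. set_mset u \<subseteq> B1 T \<times> B2 T \<longrightarrow>
    norm (\<Sum>(a, b)\<in>#u. \<Phi> a b) \<le> K * norm (\<Sum>(a, b)\<in>#u. \<theta> a b)"
proof -
  obtain K0 where K0: "\<And>l. set l \<subseteq> B1 T \<times> B2 T \<Longrightarrow>
      norm (\<Sum>(a, b)\<in>#mset l. \<Phi> a b) \<le> K0 * haagerup_value l"
    using assms unfolding haagerup_bounded_def by blast
  define K where "K = max K0 1"
  have K: "K > 0" "norm (\<Sum>(a, b)\<in>#mset l. \<Phi> a b) \<le> K * haagerup_value l"
    if "set l \<subseteq> B1 T \<times> B2 T" for l
    using K0[OF that] mult_right_mono[OF _ haagerup_value_nonneg[of l], of K0 K] by (auto simp: K_def)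
  show ?thesis
  proof (intro exI[of _ K] allI impI)
    fix u assume u: "set_mset u \<subseteq> B1 T \<times> B2 T"
    have "norm (\<Sum>(a, b)\<in>#u. \<Phi> a b) / K \<le> haagerup_norm T u"
      unfolding haagerup_norm_def
    proof (rule cInf_greatest)
      obtain l where "mset l = u" using ex_mset by blast
      then show "{haagerup_value l |l.
          tensor_eq (B1 T) (B2 T) UNIV (\<lambda>a c. c *\<^sub>C a) scaleC u (mset l)} \<noteq> {}"
        using tensor_eq.refl[OF u] by blast
      fix x assume "x \<in> {haagerup_value l |l.
          tensor_eq (B1 T) (B2 T) UNIV (\<lambda>a c. c *\<^sub>C a) scaleC u (mset l)}"
      then obtain l where l: "x = haagerup_value l"
        "tensor_eq (B1 T) (B2 T) UNIV (\<lambda>a c. c *\<^sub>C a) scaleC u (mset l)" by blast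
      have "set_mset u \<subseteq> B1 T \<times> B2 T \<and> set_mset (mset l) \<subseteq> B1 T \<times> B2 T"
        by (rule tensor_eq_subset[OF l(2)])
          (auto intro: B1_add B1_0 B2_add B1_scaleC B2_scaleC)
      then have "set l \<subseteq> B1 T \<times> B2 T" by simp
      from K[OF this] show "norm (\<Sum>(a, b)\<in>#u. \<Phi> a b) / K \<le> x"
        unfolding haagerup_bounded_tensor_eq[OF assms l(2)] l(1) by (simp add: field_simps)
    qed
    then show "norm (\<Sum>(a, b)\<in>#u. \<Phi> a b) \<le> K * norm (\<Sum>(a, b)\<in>#u. \<theta> a b)"
      unfolding norm_sum_\<theta>[OF u] by (simp add: K_def field_simps)
  qed
qed

definition alg_tensor :: "'w set"
  where "alg_tensor = {\<Sum>(a, b)\<in>#u. \<theta> a b | u. set_mset u \<subseteq> B1 T \<times> B2 T}"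

lemma \<theta>_in_alg_tensor: "a \<in> B1 T \<Longrightarrow> b \<in> B2 T \<Longrightarrow> \<theta> a b \<in> alg_tensor"
  unfolding alg_tensor_def by (rule CollectI, rule exI[of _ "{#(a, b)#}"]) simp

lemma csubspace_alg_tensor: "csubspace alg_tensor"
  unfolding complex_vector.subspace_def
proof (intro conjI ballI allI)
  show "0 \<in> alg_tensor" unfolding alg_tensor_def by (rule CollectI, rule exI[of _ "{#}"]) simp
next
  fix x y assume "x \<in> alg_tensor" "y \<in> alg_tensor"
  then obtain u u' where "set_mset u \<subseteq> B1 T \<times> B2 T" "x = (\<Sum>(a, b)\<in>#u. \<theta> a b)"
    "set_mset u' \<subseteq> B1 T \<times> B2 T" "y = (\<Sum>(a, b)\<in>#u'. \<theta> a b)"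
    unfolding alg_tensor_def by blast
  then show "x + y \<in> alg_tensor"
    unfolding alg_tensor_def by (intro CollectI exI[of _ "u + u'"]) simp
next
  fix c x assume "x \<in> alg_tensor"
  then obtain u where u: "set_mset u \<subseteq> B1 T \<times> B2 T" "x = (\<Sum>(a, b)\<in>#u. \<theta> a b)"
    unfolding alg_tensor_def by blast
  have "c *\<^sub>C x = (\<Sum>(a, b)\<in>#image_mset (\<lambda>(a, b). (c *\<^sub>C a, b)) u. \<theta> a b)"
    unfolding u(2) using u(1) by (intro sum_mset_scaleC_left[symmetric] \<theta>_scaleC_left) auto
  moreover have "set_mset (image_mset (\<lambda>(a, b). (c *\<^sub>C a, b)) u) \<subseteq> B1 T \<times> B2 T"
    using u(1) by (auto intro: B1_scaleC)
  ultimately show "c *\<^sub>C x \<in> alg_tensor"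
    unfolding alg_tensor_def by blast
qed

lemma dense_alg_tensor: "closure alg_tensor = UNIV"
proof -
  have "cspan {\<theta> a b | a b. a \<in> B1 T \<and> b \<in> B2 T} \<subseteq> alg_tensor"
    by (rule complex_vector.span_minimal[OF _ csubspace_alg_tensor]) (auto intro: \<theta>_in_alg_tensor)
  from closure_mono[OF this] dense_\<theta> show ?thesis by auto
qed

lemma sum_mset_B_scaleC:
  fixes f :: "('h \<Rightarrow>\<^sub>L 'h) \<Rightarrow> ('h \<Rightarrow>\<^sub>L 'h) \<Rightarrow> 'y :: complex_vector"
  assumes "set_mset u \<subseteq> B1 T \<times> B2 T"
    and "\<And>a b. a \<in> B1 T \<Longrightarrow> b \<in> B2 T \<Longrightarrow> f (c *\<^sub>C a) b = c *\<^sub>C f a b"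
  shows "(\<Sum>(a, b)\<in>#image_mset (\<lambda>(a, b). (c *\<^sub>C a, b)) u. f a b) = c *\<^sub>C (\<Sum>(a, b)\<in>#u. f a b)"
  using assms by (intro sum_mset_scaleC_left) auto

text \<open>On finite sums the extension is forced. It is well defined because the difference of two
  sums with the same image has Haagerup norm zero, so the sum of its \<open>\<Phi>\<close>-values vanishes.\<close>

lemma ex_haagerup_ext:
  fixes \<Phi> :: "('h \<Rightarrow>\<^sub>L 'h) \<Rightarrow> ('h \<Rightarrow>\<^sub>L 'h) \<Rightarrow> 'z :: complex_banach"
  assumes \<Phi>: "haagerup_bounded \<Phi>"
  shows "\<exists>F. bounded_clinear F \<and> (\<forall>a\<in>B1 T. \<forall>b\<in>B2 T. F (\<theta> a b) = \<Phi> a b)"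
proof -
  obtain K where K: "\<And>u. set_mset u \<subseteq> B1 T \<times> B2 T \<Longrightarrow>
    norm (\<Sum>(a, b)\<in>#u. \<Phi> a b) \<le> K * norm (\<Sum>(a, b)\<in>#u. \<theta> a b)"
    using haagerup_bounded_norm_le[OF \<Phi>] by blast
  have scale: "\<Phi> (c *\<^sub>C a) b = c *\<^sub>C \<Phi> a b" if "a \<in> B1 T" "b \<in> B2 T" for a b c
    using \<Phi> that unfolding haagerup_bounded_def by blast
  have scset: "set_mset (image_mset (\<lambda>(a, b). (c *\<^sub>C a, b)) u) \<subseteq> B1 T \<times> B2 T"
    if "set_mset u \<subseteq> B1 T \<times> B2 T" for u :: "(('h \<Rightarrow>\<^sub>L 'h) \<times> ('h \<Rightarrow>\<^sub>L 'h)) multiset" and c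
    using that by (auto intro: B1_scaleC)
  define g where "g x = (\<Sum>(a, b)\<in>#(SOME u. set_mset u \<subseteq> B1 T \<times> B2 T \<and> (\<Sum>(a, b)\<in>#u. \<theta> a b) = x). \<Phi> a b)" for x
  have g: "g (\<Sum>(a, b)\<in>#u. \<theta> a b) = (\<Sum>(a, b)\<in>#u. \<Phi> a b)" if u: "set_mset u \<subseteq> B1 T \<times> B2 T" for u
  proof -
    define u' where "u' = (SOME u'. set_mset u' \<subseteq> B1 T \<times> B2 T \<and>
      (\<Sum>(a, b)\<in>#u'. \<theta> a b) = (\<Sum>(a, b)\<in>#u. \<theta> a b))"
    have u': "set_mset u' \<subseteq> B1 T \<times> B2 T \<and> (\<Sum>(a, b)\<in>#u'. \<theta> a b) = (\<Sum>(a, b)\<in>#u. \<theta> a b)"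
      unfolding u'_def by (rule someI[of _ u]) (use u in simp)
    define w where "w = u' + image_mset (\<lambda>(a, b). ((-1) *\<^sub>C a, b)) u"
    have w: "set_mset w \<subseteq> B1 T \<times> B2 T" using u' scset[OF u, of "-1"] by (simp add: w_def)
    have "(\<Sum>(a, b)\<in>#image_mset (\<lambda>(a, b). ((-1) *\<^sub>C a, b)) u. \<theta> a b) =
        (-1) *\<^sub>C (\<Sum>(a, b)\<in>#u. \<theta> a b)"
      by (rule sum_mset_B_scaleC[OF u]) (rule \<theta>_scaleC_left)
    then have "(\<Sum>(a, b)\<in>#w. \<theta> a b) = 0"
      using u' by (simp only: w_def image_mset_union sum_mset.union scaleC_minus_one) simp
    with K[OF w] have "(\<Sum>(a, b)\<in>#w. \<Phi> a b) = 0" by simp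
    moreover have "(\<Sum>(a, b)\<in>#image_mset (\<lambda>(a, b). ((-1) *\<^sub>C a, b)) u. \<Phi> a b) =
        (-1) *\<^sub>C (\<Sum>(a, b)\<in>#u. \<Phi> a b)"
      by (rule sum_mset_B_scaleC[OF u]) (rule scale)
    then have "(\<Sum>(a, b)\<in>#w. \<Phi> a b) = (\<Sum>(a, b)\<in>#u'. \<Phi> a b) - (\<Sum>(a, b)\<in>#u. \<Phi> a b)"
      by (simp only: w_def image_mset_union sum_mset.union scaleC_minus_one) simp
    ultimately show ?thesis unfolding g_def u'_def by simp
  qed
  have "\<exists>F. bounded_clinear F \<and> (\<forall>x\<in>alg_tensor. F x = g x)"
  proof (rule bounded_clinear_extension[OF csubspace_alg_tensor dense_alg_tensor])
    fix x assume "x \<in> alg_tensor"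
    then obtain u where u: "set_mset u \<subseteq> B1 T \<times> B2 T" "x = (\<Sum>(a, b)\<in>#u. \<theta> a b)"
      unfolding alg_tensor_def by blast
    show "norm (g x) \<le> K * norm x" unfolding u(2) g[OF u(1)] by (rule K[OF u(1)])
    show "g (c *\<^sub>C x) = c *\<^sub>C g x" for c
    proof -
      have "c *\<^sub>C x = (\<Sum>(a, b)\<in>#image_mset (\<lambda>(a, b). (c *\<^sub>C a, b)) u. \<theta> a b)"
        unfolding u(2) by (rule sum_mset_B_scaleC[OF u(1), symmetric]) (rule \<theta>_scaleC_left)
      then have "g (c *\<^sub>C x) = (\<Sum>(a, b)\<in>#image_mset (\<lambda>(a, b). (c *\<^sub>C a, b)) u. \<Phi> a b)"
        using g[OF scset[OF u(1)]] by simp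
      also have "\<dots> = c *\<^sub>C (\<Sum>(a, b)\<in>#u. \<Phi> a b)"
        by (rule sum_mset_B_scaleC[OF u(1)]) (rule scale)
      finally show ?thesis by (simp add: u(2) g[OF u(1)])
    qed
    fix y assume "y \<in> alg_tensor"
    then obtain u' where u': "set_mset u' \<subseteq> B1 T \<times> B2 T" "y = (\<Sum>(a, b)\<in>#u'. \<theta> a b)"
      unfolding alg_tensor_def by blast
    show "g (x + y) = g x + g y"
      using g[of "u + u'"] u u' g by simp
  qed
  then obtain F where F: "bounded_clinear F" "\<And>x. x \<in> alg_tensor \<Longrightarrow> F x = g x" by blast
  have "F (\<theta> a b) = \<Phi> a b" if "a \<in> B1 T" "b \<in> B2 T" for a b
    using F(2)[OF \<theta>_in_alg_tensor[OF that]] g[of "{#(a, b)#}"] that by simp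
  with F(1) show ?thesis by blast
qed

lemma haagerup_eqI:
  assumes "bounded_clinear F" "bounded_clinear G"
    and "\<And>a b. a \<in> B1 T \<Longrightarrow> b \<in> B2 T \<Longrightarrow> F (\<theta> a b) = G (\<theta> a b)"
  shows "F = G"
proof (rule bounded_clinear_eq_on_dense[OF assms(1,2) dense_alg_tensor])
  fix x assume "x \<in> alg_tensor"
  then obtain u where u: "set_mset u \<subseteq> B1 T \<times> B2 T" "x = (\<Sum>(a, b)\<in>#u. \<theta> a b)"
    unfolding alg_tensor_def by blast
  show "F x = G x"
    unfolding u(2) assms(1,2)[THEN bounded_clinear_sum_mset]
    using u(1) assms(3) by (intro arg_cong[of _ _ sum_mset] image_mset_cong) auto
qed

lemma haagerup_ext:
  fixes \<Phi> :: "('h \<Rightarrow>\<^sub>L 'h) \<Rightarrow> ('h \<Rightarrow>\<^sub>L 'h) \<Rightarrow> 'z :: complex_banach"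
  assumes \<Phi>: "haagerup_bounded \<Phi>"
  shows "bounded_clinear (haagerup_ext T \<theta> \<Phi>)"
    and "a \<in> B1 T \<Longrightarrow> b \<in> B2 T \<Longrightarrow> haagerup_ext T \<theta> \<Phi> (\<theta> a b) = \<Phi> a b"
proof -
  have "\<exists>!F. bounded_clinear F \<and> (\<forall>a\<in>B1 T. \<forall>b\<in>B2 T. F (\<theta> a b) = \<Phi> a b)"
  proof (rule ex_ex1I[OF ex_haagerup_ext[OF \<Phi>]])
    fix F G assume "bounded_clinear F \<and> (\<forall>a\<in>B1 T. \<forall>b\<in>B2 T. F (\<theta> a b) = \<Phi> a b)"
      "bounded_clinear G \<and> (\<forall>a\<in>B1 T. \<forall>b\<in>B2 T. G (\<theta> a b) = \<Phi> a b)"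
    then show "F = G" by (intro haagerup_eqI) auto
  qed
  from theI'[OF this] show "bounded_clinear (haagerup_ext T \<theta> \<Phi>)"
    "a \<in> B1 T \<Longrightarrow> b \<in> B2 T \<Longrightarrow> haagerup_ext T \<theta> \<Phi> (\<theta> a b) = \<Phi> a b"
    unfolding haagerup_ext_def by blast+
qed

lemma haagerup_induct:
  assumes lim: "\<And>s \<eta>. (\<And>n. P (s n)) \<Longrightarrow> s \<longlonglongrightarrow> \<eta> \<Longrightarrow> P \<eta>"
    and "P 0" "\<And>\<eta> \<eta>'. P \<eta> \<Longrightarrow> P \<eta>' \<Longrightarrow> P (\<eta> + \<eta>')"
    and "\<And>a b. a \<in> B1 T \<Longrightarrow> b \<in> B2 T \<Longrightarrow> P (\<theta> a b)"
  shows "P \<eta>"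
proof -
  have alg: "P x" if "x \<in> alg_tensor" for x
  proof -
    obtain u where u: "set_mset u \<subseteq> B1 T \<times> B2 T" "x = (\<Sum>(a, b)\<in>#u. \<theta> a b)"
      using \<open>x \<in> alg_tensor\<close> unfolding alg_tensor_def by blast
    from u(1) have "P (\<Sum>(a, b)\<in>#u. \<theta> a b)" by (induction u) (auto intro: assms(2-))
    then show ?thesis by (simp add: u)
  qed
  obtain s where "\<And>n. s n \<in> alg_tensor" "s \<longlonglongrightarrow> \<eta>"
    using dense_alg_tensor closure_sequential[of \<eta> alg_tensor] by auto
  with lim[of s] alg show ?thesis by blast
qed

subsection \<open>Maps into operators\<close>

text \<open>A product \<open>\<phi>(a) \<psi>(b)\<close> of entries of \<open>\<pi>\<^sup>1(a)\<close> and of \<open>\<pi>\<^sup>1(b)\<close> or \<open>\<pi>\<^sup>2(b)\<close> is controlled by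
  the Haagerup norm, since the row norm of an entry is at most that of the block matrix.\<close>

lemma haagerup_bounded_compose:
  fixes \<phi> \<psi> :: "('h \<Rightarrow>\<^sub>L 'h) \<Rightarrow> ('h \<Rightarrow>\<^sub>L 'h)"
  assumes \<phi>: "\<And>a a'. a \<in> B1 T \<Longrightarrow> a' \<in> B1 T \<Longrightarrow> \<phi> (a + a') = \<phi> a + \<phi> a'"
    "\<And>a c. a \<in> B1 T \<Longrightarrow> \<phi> (c *\<^sub>C a) = c *\<^sub>C \<phi> a" "\<And>a. a \<in> B1 T \<Longrightarrow> clinear_op (\<phi> a)"
    and \<psi>: "\<And>b b'. b \<in> B2 T \<Longrightarrow> b' \<in> B2 T \<Longrightarrow> \<psi> (b + b') = \<psi> b + \<psi> b'"
    "\<And>b c. b \<in> B2 T \<Longrightarrow> \<psi> (c *\<^sub>C b) = c *\<^sub>C \<psi> b"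
    and row: "\<And>l. set l \<subseteq> B1 T \<times> B2 T \<Longrightarrow>
      row_norm {..<length l} (\<lambda>k. \<phi> (fst (l ! k))) \<le> row_norm {..<length l} (\<lambda>k. pi1 T (fst (l ! k)))"
    and col: "\<And>l. set l \<subseteq> B1 T \<times> B2 T \<Longrightarrow>
      col_norm {..<length l} (\<lambda>k. \<psi> (snd (l ! k))) \<le> col_norm2 T {..<length l} (\<lambda>k. snd (l ! k))"
  shows "haagerup_bounded (\<lambda>a b. \<phi> a o\<^sub>L \<psi> b)"
  unfolding haagerup_bounded_def
proof (intro conjI ballI allI exI[of _ 1] impI)
  fix l :: "(('h \<Rightarrow>\<^sub>L 'h) \<times> ('h \<Rightarrow>\<^sub>L 'h)) list"
  assume l: "set l \<subseteq> B1 T \<times> B2 T"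
  have "(\<Sum>(a, b)\<in>#mset l. \<phi> a o\<^sub>L \<psi> b) = (\<Sum>k<length l. \<phi> (fst (l ! k)) o\<^sub>L \<psi> (snd (l ! k)))"
    unfolding sum_mset_mset_nth by (simp add: case_prod_beta)
  also have "norm \<dots> \<le> row_norm {..<length l} (\<lambda>k. \<phi> (fst (l ! k))) *
      col_norm {..<length l} (\<lambda>k. \<psi> (snd (l ! k)))"
    by (rule norm_sum_compose_le) simp
  also have "\<dots> \<le> haagerup_value l"
    by (intro mult_mono row col l row_norm_nonneg col_norm_nonneg finite_lessThan)
  finally show "norm (\<Sum>(a, b)\<in>#mset l. \<phi> a o\<^sub>L \<psi> b) \<le> 1 * haagerup_value l" by simp
qed (simp_all add: \<phi> \<psi> blinfun_compose_add_left blinfun_compose_add_right scaleC_compose_blinfun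
    clinear_op_compose_scaleC)

end

context haagerup_tensor
begin

lemma row_norm_fst_le:
  "row_norm {..<length l} (\<lambda>k. fst (l ! k)) \<le> row_norm {..<length l} (\<lambda>k. pi1 T (fst (l ! k)))"
  "row_norm {..<length l} (\<lambda>k. comm1 T (fst (l ! k))) \<le> row_norm {..<length l} (\<lambda>k. pi1 T (fst (l ! k)))"
  unfolding pi1_eq_blk by (rule row_norm_corner_le; simp)+

lemma col_norm_snd_le:
  "col_norm {..<length l} (\<lambda>k. snd (l ! k)) \<le> col_norm2 T {..<length l} (\<lambda>k. snd (l ! k))"
  "col_norm {..<length l} (\<lambda>k. comm1 T (snd (l ! k))) \<le> col_norm2 T {..<length l} (\<lambda>k. snd (l ! k))"
  by (rule order.trans[OF _ col_norm2_ge(1)], unfold pi1_eq_blk, rule col_norm_corner_le, simp)+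

lemma col_norm_comm2R_le:
  assumes "set l \<subseteq> B1 T \<times> B2 T"
  shows "col_norm {..<length l} (\<lambda>k. comm2R T (snd (l ! k))) \<le> col_norm2 T {..<length l} (\<lambda>k. snd (l ! k))"
proof (rule order.trans[OF _ col_norm2_ge(2)])
  have "snd (l ! k) \<in> B2 T" if "k < length l" for k
    using assms nth_mem[OF that] by auto
  then have "col_norm {..<length l} (\<lambda>k. pi2 T (snd (l ! k))) =
      col_norm {..<length l} (\<lambda>k. blk (conj_op (snd (l ! k))) (comm2R T (snd (l ! k))) (snd (l ! k)))"
    by (intro col_norm_cong pi2_eq_blk C1_op_B2) simp
  then show "col_norm {..<length l} (\<lambda>k. comm2R T (snd (l ! k))) \<le>
      col_norm {..<length l} (\<lambda>k. pi2 T (snd (l ! k)))"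
    by (simp add: col_norm_corner_le(2))
qed

abbreviation mu :: "'w \<Rightarrow> ('h \<Rightarrow>\<^sub>L 'h)"
  where "mu \<equiv> haagerup_ext T \<theta> (\<lambda>a b. a o\<^sub>L b)"

abbreviation piD2R :: "'w \<Rightarrow> ('h \<Rightarrow>\<^sub>L 'h)"
  where "piD2R \<equiv> haagerup_ext T \<theta> (\<lambda>a b. a o\<^sub>L comm2R T b)"

lemma haagerup_bounded_mu: "haagerup_bounded (\<lambda>a b. a o\<^sub>L b)"
  by (rule haagerup_bounded_compose[where \<phi> = "\<lambda>a. a" and \<psi> = "\<lambda>b. b"])
    (simp_all add: clinear_op_B1 row_norm_fst_le col_norm_snd_le)

lemma haagerup_bounded_piD: "haagerup_bounded (\<lambda>a b. a o\<^sub>L comm1 T b)"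
  by (rule haagerup_bounded_compose[where \<phi> = "\<lambda>a. a" and \<psi> = "comm1 T"])
    (simp_all add: clinear_op_B1 row_norm_fst_le col_norm_snd_le comm1_add comm1_scaleC C1_op_B2)

lemma haagerup_bounded_piD_delta: "haagerup_bounded (\<lambda>a b. comm1 T a o\<^sub>L comm1 T b)"
  by (rule haagerup_bounded_compose[where \<phi> = "comm1 T" and \<psi> = "comm1 T"])
    (simp_all add: clinear_op_comm1 C1_op_B1 row_norm_fst_le col_norm_snd_le comm1_add comm1_scaleC
      C1_op_B2)

lemma haagerup_bounded_piD2R: "haagerup_bounded (\<lambda>a b. a o\<^sub>L comm2R T b)"
  by (rule haagerup_bounded_compose[where \<phi> = "\<lambda>a. a" and \<psi> = "comm2R T"])
    (simp_all add: clinear_op_B1 row_norm_fst_le col_norm_comm2R_le comm2R_add comm2R_scaleC C2_op_B2)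

lemma bounded_clinear_mu: "bounded_clinear mu"
  and mu_\<theta>: "a \<in> B1 T \<Longrightarrow> b \<in> B2 T \<Longrightarrow> mu (\<theta> a b) = a o\<^sub>L b"
  by (rule haagerup_ext[OF haagerup_bounded_mu]; assumption)+

lemma bounded_clinear_piD: "bounded_clinear (piD T \<theta>)"
  and piD_\<theta>: "a \<in> B1 T \<Longrightarrow> b \<in> B2 T \<Longrightarrow> piD T \<theta> (\<theta> a b) = a o\<^sub>L comm1 T b"
  unfolding piD_def by (rule haagerup_ext[OF haagerup_bounded_piD]; assumption)+

lemma bounded_clinear_piD_delta: "bounded_clinear (piD_delta T \<theta>)"
  and piD_delta_\<theta>: "a \<in> B1 T \<Longrightarrow> b \<in> B2 T \<Longrightarrow> piD_delta T \<theta> (\<theta> a b) = comm1 T a o\<^sub>L comm1 T b"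
  unfolding piD_delta_def by (rule haagerup_ext[OF haagerup_bounded_piD_delta]; assumption)+

lemma bounded_clinear_piD2R: "bounded_clinear piD2R"
  and piD2R_\<theta>: "a \<in> B1 T \<Longrightarrow> b \<in> B2 T \<Longrightarrow> piD2R (\<theta> a b) = a o\<^sub>L comm2R T b"
  by (rule haagerup_ext[OF haagerup_bounded_piD2R]; assumption)+

lemma piD2_eq: "piD2 T \<theta> \<eta> h = piD2R \<eta> (D h + \<i> *\<^sub>C h)"
  by (simp add: piD2_def)

text \<open>Boundedness holds since \<open>\<pi>\<^sup>1(a a') = \<pi>\<^sup>1(a) \<pi>\<^sup>1(a')\<close>, which multiplies row norms by at
  most \<open>\<parallel>\<pi>\<^sup>1(a)\<parallel>\<close>.\<close>

lemma haagerup_bounded_lmult: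
  assumes a: "a \<in> B1 T"
  shows "haagerup_bounded (\<lambda>a' b. \<theta> (a o\<^sub>L a') b)"
  unfolding haagerup_bounded_def
proof (intro conjI ballI allI exI[of _ "norm (pi1 T a)"] impI)
  fix l :: "(('h \<Rightarrow>\<^sub>L 'h) \<times> ('h \<Rightarrow>\<^sub>L 'h)) list"
  assume l: "set l \<subseteq> B1 T \<times> B2 T"
  define l' where "l' = map (\<lambda>(a', b). (a o\<^sub>L a', b)) l"
  have l': "set l' \<subseteq> B1 T \<times> B2 T" using l by (auto simp: l'_def intro: B1_compose a)
  have length: "length l' = length l" by (simp add: l'_def)
  have nth: "pi1 T (fst (l' ! k)) = pi1 T a o\<^sub>L pi1 T (fst (l ! k))" "snd (l' ! k) = snd (l ! k)"
    if "k < length l" for k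
  proof -
    have "l ! k \<in> B1 T \<times> B2 T" using l nth_mem[OF that] by blast
    then show "pi1 T (fst (l' ! k)) = pi1 T a o\<^sub>L pi1 T (fst (l ! k))" "snd (l' ! k) = snd (l ! k)"
      using that by (simp_all add: l'_def case_prod_beta mem_Times_iff pi1_compose C1_op_B1 a)
  qed
  have "(\<Sum>(a', b)\<in>#mset l. \<theta> (a o\<^sub>L a') b) = (\<Sum>(a', b)\<in>#mset l'. \<theta> a' b)"
    unfolding sum_mset_mset_nth by (simp add: l'_def case_prod_beta)
  also have "norm \<dots> = haagerup_norm T (mset l')" using l' by (intro norm_sum_\<theta>) simp
  also have "\<dots> \<le> haagerup_value l'" by (rule haagerup_norm_le[OF l'])
  also have "\<dots> = row_norm {..<length l} (\<lambda>k. pi1 T a o\<^sub>L pi1 T (fst (l ! k))) *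
      col_norm2 T {..<length l} (\<lambda>k. snd (l ! k))"
    unfolding length col_norm2_def
    by (intro arg_cong2[of _ _ _ _ times] arg_cong[of _ _ Max] arg_cong2[of _ _ _ _ insert]
        row_norm_cong col_norm_cong) (simp_all add: nth)
  also have "\<dots> \<le> (norm (pi1 T a) * row_norm {..<length l} (\<lambda>k. pi1 T (fst (l ! k)))) *
      col_norm2 T {..<length l} (\<lambda>k. snd (l ! k))"
    by (intro mult_right_mono row_norm_compose_le col_norm2_nonneg finite_lessThan)
  finally show "norm (\<Sum>(a', b)\<in>#mset l. \<theta> (a o\<^sub>L a') b) \<le> norm (pi1 T a) * haagerup_value l"
    by (simp add: mult.assoc)
qed (simp_all add: blinfun_compose_add_right \<theta>_add_left \<theta>_add_right B1_compose a clinear_op_compose_scaleC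
    clinear_op_B1 \<theta>_scaleC_left \<theta>_scaleC_right)

lemma bounded_clinear_lmult: "a \<in> B1 T \<Longrightarrow> bounded_clinear (lmult T \<theta> a)"
  and lmult_\<theta>: "a \<in> B1 T \<Longrightarrow> a' \<in> B1 T \<Longrightarrow> b \<in> B2 T \<Longrightarrow> lmult T \<theta> a (\<theta> a' b) = \<theta> (a o\<^sub>L a') b"
  unfolding lmult_def by (rule haagerup_ext[OF haagerup_bounded_lmult]; assumption)+

text \<open>All three parts of the norm are submultiplicative because \<open>\<pi>\<^sup>1\<close> and \<open>\<pi>\<^sup>2\<close> are
  multiplicative; the adjoint in the row part reverses the order, so that there \<open>b\<close> multiplies
  from the left.\<close>

lemma col_norm2_compose_le:
  assumes b: "b \<in> B2 T" and I: "finite I" and c: "\<And>i. i \<in> I \<Longrightarrow> c i \<in> B2 T"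
  shows "col_norm2 T I (\<lambda>i. c i o\<^sub>L b) \<le> norm2 T b * col_norm2 T I c"
proof -
  have n: "norm (pi1 T b) \<le> norm2 T b" "norm (pi2 T b) \<le> norm2 T b" "norm (pi2 T (cadj b)) \<le> norm2 T b"
    by (simp_all add: norm2_def)
  have "col_norm I (\<lambda>i. pi1 T (c i o\<^sub>L b)) = col_norm I (\<lambda>i. pi1 T (c i) o\<^sub>L pi1 T b)"
    using b c by (intro col_norm_cong) (simp add: pi1_compose C1_op_B2)
  also have "\<dots> \<le> col_norm I (\<lambda>i. pi1 T (c i)) * norm (pi1 T b)"
    by (rule col_norm_compose_le[OF I])
  also have "\<dots> \<le> col_norm2 T I c * norm2 T b"
    by (intro mult_mono col_norm2_ge n col_norm2_nonneg I norm_ge_zero)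
  finally have 1: "col_norm I (\<lambda>i. pi1 T (c i o\<^sub>L b)) \<le> norm2 T b * col_norm2 T I c"
    by (simp add: mult.commute)
  have "col_norm I (\<lambda>i. pi2 T (c i o\<^sub>L b)) = col_norm I (\<lambda>i. pi2 T (c i) o\<^sub>L pi2 T b)"
    using b c by (intro col_norm_cong) (simp add: pi2_compose C2_op_B2)
  also have "\<dots> \<le> col_norm I (\<lambda>i. pi2 T (c i)) * norm (pi2 T b)"
    by (rule col_norm_compose_le[OF I])
  also have "\<dots> \<le> col_norm2 T I c * norm2 T b"
    by (intro mult_mono col_norm2_ge n col_norm2_nonneg I norm_ge_zero)
  finally have 2: "col_norm I (\<lambda>i. pi2 T (c i o\<^sub>L b)) \<le> norm2 T b * col_norm2 T I c"
    by (simp add: mult.commute)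
  have "row_norm I (\<lambda>i. pi2 T (cadj (c i o\<^sub>L b))) = row_norm I (\<lambda>i. pi2 T (cadj b) o\<^sub>L pi2 T (cadj (c i)))"
    using b c
    by (intro row_norm_cong) (simp add: cadj_compose clinear_op_B2 pi2_compose C2_op_cadj_B2)
  also have "\<dots> \<le> norm (pi2 T (cadj b)) * row_norm I (\<lambda>i. pi2 T (cadj (c i)))"
    by (rule row_norm_compose_le[OF I])
  also have "\<dots> \<le> norm2 T b * col_norm2 T I c"
    by (intro mult_mono col_norm2_ge n row_norm_nonneg I order.trans[OF norm_ge_zero n(1)])
  finally have 3: "row_norm I (\<lambda>i. pi2 T (cadj (c i o\<^sub>L b))) \<le> norm2 T b * col_norm2 T I c" .
  from 1 2 3 show ?thesis by (simp add: col_norm2_def[of _ _ "\<lambda>i. c i o\<^sub>L b"])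
qed

lemma haagerup_bounded_rmult:
  assumes b: "b \<in> B2 T"
  shows "haagerup_bounded (\<lambda>a b'. \<theta> a (b' o\<^sub>L b))"
  unfolding haagerup_bounded_def
proof (intro conjI ballI allI exI[of _ "norm2 T b"] impI)
  fix l :: "(('h \<Rightarrow>\<^sub>L 'h) \<times> ('h \<Rightarrow>\<^sub>L 'h)) list"
  assume l: "set l \<subseteq> B1 T \<times> B2 T"
  define l' where "l' = map (\<lambda>(a, b'). (a, b' o\<^sub>L b)) l"
  have l': "set l' \<subseteq> B1 T \<times> B2 T" using l by (auto simp: l'_def intro: B2_compose b)
  have length: "length l' = length l" by (simp add: l'_def)
  have nth: "fst (l' ! k) = fst (l ! k)" "snd (l' ! k) = snd (l ! k) o\<^sub>L b" "snd (l ! k) \<in> B2 T"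
    if "k < length l" for k
  proof -
    have "l ! k \<in> B1 T \<times> B2 T" using l nth_mem[OF that] by blast
    then show "fst (l' ! k) = fst (l ! k)" "snd (l' ! k) = snd (l ! k) o\<^sub>L b" "snd (l ! k) \<in> B2 T"
      using that by (simp_all add: l'_def case_prod_beta mem_Times_iff)
  qed
  have "(\<Sum>(a, b')\<in>#mset l. \<theta> a (b' o\<^sub>L b)) = (\<Sum>(a, b')\<in>#mset l'. \<theta> a b')"
    unfolding sum_mset_mset_nth by (simp add: l'_def case_prod_beta)
  also have "norm \<dots> = haagerup_norm T (mset l')" using l' by (intro norm_sum_\<theta>) simp
  also have "\<dots> \<le> haagerup_value l'" by (rule haagerup_norm_le[OF l'])
  also have "\<dots> = row_norm {..<length l} (\<lambda>k. pi1 T (fst (l ! k))) *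
      col_norm2 T {..<length l} (\<lambda>k. snd (l ! k) o\<^sub>L b)"
    unfolding length col_norm2_def
    by (intro arg_cong2[of _ _ _ _ times] arg_cong[of _ _ Max] arg_cong2[of _ _ _ _ insert]
        row_norm_cong col_norm_cong) (simp_all add: nth)
  also have "\<dots> \<le> row_norm {..<length l} (\<lambda>k. pi1 T (fst (l ! k))) *
      (norm2 T b * col_norm2 T {..<length l} (\<lambda>k. snd (l ! k)))"
    using nth by (intro mult_left_mono col_norm2_compose_le b row_norm_nonneg finite_lessThan) simp
  finally show "norm (\<Sum>(a, b')\<in>#mset l. \<theta> a (b' o\<^sub>L b)) \<le> norm2 T b * haagerup_value l"
    by (simp add: mult_ac)
qed (simp_all add: blinfun_compose_add_left \<theta>_add_left \<theta>_add_right B2_compose b scaleC_compose_blinfun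
    \<theta>_scaleC_left \<theta>_scaleC_right)

lemma bounded_clinear_rmult: "b \<in> B2 T \<Longrightarrow> bounded_clinear (\<lambda>\<eta>. rmult T \<theta> \<eta> b)"
  and rmult_\<theta>: "b \<in> B2 T \<Longrightarrow> a \<in> B1 T \<Longrightarrow> b' \<in> B2 T \<Longrightarrow> rmult T \<theta> (\<theta> a b') b = \<theta> a (b' o\<^sub>L b)"
  unfolding rmult_def by (rule haagerup_ext[OF haagerup_bounded_rmult]; assumption)+

subsection \<open>Bimodule structure and one-forms\<close>

lemma mu_lmult: "a \<in> B1 T \<Longrightarrow> mu (lmult T \<theta> a \<eta>) = a o\<^sub>L mu \<eta>"
  by (rule fun_cong[OF haagerup_eqI, of "\<lambda>\<eta>. mu (lmult T \<theta> a \<eta>)" "\<lambda>\<eta>. a o\<^sub>L mu \<eta>"])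
    (simp_all add: bounded_clinear_compose[OF bounded_clinear_mu] bounded_clinear_lmult
      bounded_clinear_compose_left bounded_clinear_mu clinear_op_B1 lmult_\<theta> mu_\<theta> B1_compose
      blinfun_compose_assoc)

lemma piD_lmult: "a \<in> B1 T \<Longrightarrow> piD T \<theta> (lmult T \<theta> a \<eta>) = a o\<^sub>L piD T \<theta> \<eta>"
  by (rule fun_cong[OF haagerup_eqI, of "\<lambda>\<eta>. piD T \<theta> (lmult T \<theta> a \<eta>)" "\<lambda>\<eta>. a o\<^sub>L piD T \<theta> \<eta>"])
    (simp_all add: bounded_clinear_compose[OF bounded_clinear_piD] bounded_clinear_lmult
      bounded_clinear_compose_left bounded_clinear_piD clinear_op_B1 lmult_\<theta> piD_\<theta> B1_compose
      blinfun_compose_assoc)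

lemma piD2R_lmult: "a \<in> B1 T \<Longrightarrow> piD2R (lmult T \<theta> a \<eta>) = a o\<^sub>L piD2R \<eta>"
  by (rule fun_cong[OF haagerup_eqI, of "\<lambda>\<eta>. piD2R (lmult T \<theta> a \<eta>)" "\<lambda>\<eta>. a o\<^sub>L piD2R \<eta>"])
    (simp_all add: bounded_clinear_compose[OF bounded_clinear_piD2R] bounded_clinear_lmult
      bounded_clinear_compose_left bounded_clinear_piD2R clinear_op_B1 lmult_\<theta> piD2R_\<theta> B1_compose
      blinfun_compose_assoc)

lemma piD2_lmult: "a \<in> B1 T \<Longrightarrow> piD2 T \<theta> (lmult T \<theta> a \<eta>) h = a (piD2 T \<theta> \<eta> h)"
  by (simp add: piD2_eq piD2R_lmult)

lemma lmult_add: "a \<in> B1 T \<Longrightarrow> a' \<in> B1 T \<Longrightarrow>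
    lmult T \<theta> (a + a') \<eta> = lmult T \<theta> a \<eta> + lmult T \<theta> a' \<eta>"
  by (rule fun_cong[OF haagerup_eqI, of "lmult T \<theta> (a + a')" "\<lambda>\<eta>. lmult T \<theta> a \<eta> + lmult T \<theta> a' \<eta>"])
    (simp_all add: bounded_clinear_add bounded_clinear_lmult B1_add lmult_\<theta> blinfun_compose_add_left
      \<theta>_add_left B1_compose)

lemma lmult_scaleC: "a \<in> B1 T \<Longrightarrow> lmult T \<theta> (c *\<^sub>C a) \<eta> = c *\<^sub>C lmult T \<theta> a \<eta>"
  by (rule fun_cong[OF haagerup_eqI, of "lmult T \<theta> (c *\<^sub>C a)" "\<lambda>\<eta>. c *\<^sub>C lmult T \<theta> a \<eta>"])
    (simp_all add: bounded_clinear_scale bounded_clinear_lmult B1_scaleC lmult_\<theta>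
      scaleC_compose_blinfun \<theta>_scaleC_left B1_compose)

lemma lmult_compose: "a \<in> B1 T \<Longrightarrow> r \<in> B1 T \<Longrightarrow>
    lmult T \<theta> (a o\<^sub>L r) \<eta> = lmult T \<theta> a (lmult T \<theta> r \<eta>)"
  by (rule fun_cong[OF haagerup_eqI, of "lmult T \<theta> (a o\<^sub>L r)" "\<lambda>\<eta>. lmult T \<theta> a (lmult T \<theta> r \<eta>)"])
    (simp_all add: bounded_clinear_compose[OF bounded_clinear_lmult] bounded_clinear_lmult B1_compose
      lmult_\<theta> blinfun_compose_assoc)

lemma lmult_rmult: "a \<in> B1 T \<Longrightarrow> b \<in> B2 T \<Longrightarrow>
    lmult T \<theta> a (rmult T \<theta> \<eta> b) = rmult T \<theta> (lmult T \<theta> a \<eta>) b"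
  by (rule fun_cong[OF haagerup_eqI, of "\<lambda>\<eta>. lmult T \<theta> a (rmult T \<theta> \<eta> b)"
      "\<lambda>\<eta>. rmult T \<theta> (lmult T \<theta> a \<eta>) b"])
    (simp_all add: bounded_clinear_compose[OF bounded_clinear_lmult bounded_clinear_rmult]
      bounded_clinear_compose[OF bounded_clinear_rmult bounded_clinear_lmult] B1_compose B2_compose
      lmult_\<theta> rmult_\<theta>)

text \<open>The terms \<open>m(\<eta>) [D, b]\<close> and \<open>m(\<eta>) [D\<^sup>2, b]\<close> are why \<open>\<pi>\<^sub>D\<close> and \<open>\<pi>\<^bsub>D\<^sup>2\<^esub>\<close> are right module maps
  only on one-forms.\<close>

lemma piD_rmult:
  "b \<in> B2 T \<Longrightarrow> piD T \<theta> (rmult T \<theta> \<eta> b) = (piD T \<theta> \<eta> o\<^sub>L b) + (mu \<eta> o\<^sub>L comm1 T b)"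
  by (rule fun_cong[OF haagerup_eqI, of "\<lambda>\<eta>. piD T \<theta> (rmult T \<theta> \<eta> b)"
      "\<lambda>\<eta>. (piD T \<theta> \<eta> o\<^sub>L b) + (mu \<eta> o\<^sub>L comm1 T b)"])
    (simp_all add: bounded_clinear_compose[OF bounded_clinear_piD bounded_clinear_rmult]
      bounded_clinear_compose_right bounded_clinear_add bounded_clinear_mu bounded_clinear_piD
      rmult_\<theta> mu_\<theta> piD_\<theta> B2_compose blinfun_compose_assoc comm1_compose C1_op_B2 blinfun_compose_add_right)

lemma piD2R_rmult:
  "b \<in> B2 T \<Longrightarrow> piD2R (rmult T \<theta> \<eta> b) = (piD2R \<eta> o\<^sub>L conj_op b) + (mu \<eta> o\<^sub>L comm2R T b)"
  by (rule fun_cong[OF haagerup_eqI, of "\<lambda>\<eta>. piD2R (rmult T \<theta> \<eta> b)"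
      "\<lambda>\<eta>. (piD2R \<eta> o\<^sub>L conj_op b) + (mu \<eta> o\<^sub>L comm2R T b)"])
    (simp_all add: bounded_clinear_compose[OF bounded_clinear_piD2R bounded_clinear_rmult]
      bounded_clinear_compose_right bounded_clinear_add bounded_clinear_mu bounded_clinear_piD2R
      rmult_\<theta> mu_\<theta> piD2R_\<theta> B2_compose blinfun_compose_assoc comm2R_compose C2_op_B2
      blinfun_compose_add_right)

lemma Omega1_iff: "\<eta> \<in> Omega1 T \<theta> \<longleftrightarrow> mu \<eta> = 0"
  by (simp add: Omega1_def)

lemma piD_rmult_Omega1:
  "\<eta> \<in> Omega1 T \<theta> \<Longrightarrow> b \<in> B2 T \<Longrightarrow> piD T \<theta> (rmult T \<theta> \<eta> b) = piD T \<theta> \<eta> o\<^sub>L b"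
  by (simp add: piD_rmult Omega1_iff)

lemma piD2_rmult_Omega1:
  "\<eta> \<in> Omega1 T \<theta> \<Longrightarrow> b \<in> B2 T \<Longrightarrow> h \<in> Dom T \<Longrightarrow> piD2 T \<theta> (rmult T \<theta> \<eta> b) h = piD2 T \<theta> \<eta> (b h)"
  using conj_op_D_plus_i[OF C1_op_B2, of b h]
  by (simp add: piD2_eq piD2R_rmult Omega1_iff)

lemma udelta_Omega1: "b \<in> B2 T \<Longrightarrow> udelta \<theta> b \<in> Omega1 T \<theta>"
  using bounded_clinear_linear[OF bounded_clinear_mu]
  by (simp add: Omega1_iff udelta_def linear_simps mu_\<theta> id_in_B1 id_in_B2 B2_imp_B1)

lemma piD_udelta: "b \<in> B2 T \<Longrightarrow> piD T \<theta> (udelta \<theta> b) = comm1 T b"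
  using bounded_clinear_linear[OF bounded_clinear_piD]
  by (simp add: udelta_def linear_simps piD_\<theta> id_in_B1 id_in_B2 B2_imp_B1 comm1_id)

lemma piD2R_udelta: "b \<in> B2 T \<Longrightarrow> piD2R (udelta \<theta> b) = comm2R T b"
  using bounded_clinear_linear[OF bounded_clinear_piD2R]
  by (simp add: udelta_def linear_simps piD2R_\<theta> id_in_B1 id_in_B2 B2_imp_B1 comm2R_id)

lemma piD2_udelta: "b \<in> B2 T \<Longrightarrow> h \<in> Dom2 T \<Longrightarrow> piD2 T \<theta> (udelta \<theta> b) h = D (D (b h)) - b (D (D h))"
  using comm2R_apply[OF C2_op_B2, of b h]
  by (simp add: piD2_eq piD2R_udelta)

text \<open>The Leibniz rule of the universal derivation: the two terms \<open>\<plusminus> a \<otimes> b\<close> cancel.\<close>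

lemma udelta_compose:
  assumes "a \<in> B2 T" "b \<in> B2 T"
  shows "udelta \<theta> (a o\<^sub>L b) = rmult T \<theta> (udelta \<theta> a) b + lmult T \<theta> a (udelta \<theta> b)"
  using linear_diff[OF bounded_linear.linear[OF bounded_clinear_linear[OF bounded_clinear_rmult[OF assms(2)]]]]
    linear_diff[OF bounded_linear.linear[OF bounded_clinear_linear[OF bounded_clinear_lmult[OF B2_imp_B1[OF assms(1)]]]]]
    assms
  by (simp add: udelta_def rmult_\<theta> lmult_\<theta> id_in_B1 id_in_B2 B2_imp_B1 B1_compose)

lemma lmult_minus: "a \<in> B1 T \<Longrightarrow> lmult T \<theta> (- a) \<eta> = - lmult T \<theta> a \<eta>"
  using lmult_scaleC[of a "-1" \<eta>] by (simp add: scaleC_minus_one)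

lemma lmult_zero: "lmult T \<theta> 0 \<eta> = 0"
  using lmult_scaleC[OF B1_0, of 0 \<eta>] by simp

lemma lmult_sum:
  "(\<And>k. k \<in> I \<Longrightarrow> a k \<in> B1 T) \<Longrightarrow> lmult T \<theta> (\<Sum>k\<in>I. a k) \<eta> = (\<Sum>k\<in>I. lmult T \<theta> (a k) \<eta>)"
  by (induction I rule: infinite_finite_induct) (simp_all add: lmult_zero lmult_add B1_sum)

lemma lmult_Omega1: "a \<in> B1 T \<Longrightarrow> \<eta> \<in> Omega1 T \<theta> \<Longrightarrow> lmult T \<theta> a \<eta> \<in> Omega1 T \<theta>"
  by (simp add: Omega1_iff mu_lmult)

lemma csubspace_Omega1: "csubspace (Omega1 T \<theta>)"
  unfolding complex_vector.subspace_def
  by (auto simp: Omega1_iff bounded_clinear_mu bounded_clinear_zero bounded_clinear_add_apply bounded_clinear_scaleC)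

lemma udelta_add: "a \<in> B2 T \<Longrightarrow> b \<in> B2 T \<Longrightarrow> udelta \<theta> (a + b) = udelta \<theta> a + udelta \<theta> b"
  by (simp add: udelta_def \<theta>_add_left \<theta>_add_right id_in_B1 id_in_B2 B2_imp_B1)

lemma udelta_scaleC: "b \<in> B2 T \<Longrightarrow> udelta \<theta> (c *\<^sub>C b) = c *\<^sub>C udelta \<theta> b"
  by (simp add: udelta_def \<theta>_scaleC_left \<theta>_scaleC_right id_in_B1 id_in_B2 B2_imp_B1
      complex_vector.scale_right_diff_distrib)

lemma clinear_op_haagerup:
  assumes F: "bounded_clinear F" and \<theta>: "\<And>a b. a \<in> B1 T \<Longrightarrow> b \<in> B2 T \<Longrightarrow> clinear_op (F (\<theta> a b))"
  shows "clinear_op (F \<eta>)"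
proof (rule haagerup_induct)
  show "clinear_op (F \<eta>)" if "\<And>n. clinear_op (F (s n))" "s \<longlonglongrightarrow> \<eta>" for s \<eta>
    using closed_sequentially[OF closed_clinear_op _ tendsto_bounded_clinear[OF F that(2)]] that(1) by simp
  show "clinear_op (F 0)" unfolding bounded_clinear_zero[OF F] by (rule clinear_op_0)
  show "clinear_op (F (\<eta> + \<eta>'))" if "clinear_op (F \<eta>)" "clinear_op (F \<eta>')" for \<eta> \<eta>'
    unfolding bounded_clinear_add_apply[OF F] by (rule clinear_op_add[OF that])
qed (rule \<theta>)

lemma clinear_op_piD: "clinear_op (piD T \<theta> \<eta>)"
  and clinear_op_piD_delta: "clinear_op (piD_delta T \<theta> \<eta>)"
  and clinear_op_piD2R: "clinear_op (piD2R \<eta>)"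
proof -
  note lin = clinear_op_compose clinear_op_B1 clinear_op_comm1 clinear_op_comm2R C1_op_B1 C1_op_B2 C2_op_B2
  show "clinear_op (piD T \<theta> \<eta>)"
    by (rule clinear_op_haagerup[OF bounded_clinear_piD]) (simp only: piD_\<theta> lin)
  show "clinear_op (piD_delta T \<theta> \<eta>)"
    by (rule clinear_op_haagerup[OF bounded_clinear_piD_delta]) (simp only: piD_delta_\<theta> lin)
  show "clinear_op (piD2R \<eta>)"
    by (rule clinear_op_haagerup[OF bounded_clinear_piD2R]) (simp only: piD2R_\<theta> lin)
qed

text \<open>For \<open>a \<delta>(b)\<close> this is \<open>D a [D, b] + a [D, b] D = [D, a] [D, b] + a [D\<^sup>2, b]\<close>, from
  \<open>[D\<^sup>2, b] = D [D, b] + [D, b] D\<close>; the general case follows since \<open>D\<close> is closed. It is the source of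
  the curvature term \<open>\<pi>\<^sub>D(\<delta>(v \<omega> v\<^sup>*))\<close>.\<close>

lemma D_piD:
  assumes h: "h \<in> Dom2 T"
  shows "piD T \<theta> \<eta> h \<in> Dom T"
    and "D (piD T \<theta> \<eta> h) + piD T \<theta> \<eta> (D h) = piD_delta T \<theta> \<eta> h + piD2 T \<theta> \<eta> h"
proof -
  define X where "X \<eta> = piD_delta T \<theta> \<eta> h + piD2 T \<theta> \<eta> h - piD T \<theta> \<eta> (D h)" for \<eta>
  have X_add: "X (\<eta> + \<eta>') = X \<eta> + X \<eta>'" for \<eta> \<eta>'
    by (simp add: X_def piD2_eq bounded_clinear_add_apply bounded_clinear_piD bounded_clinear_piD_delta
        bounded_clinear_piD2R blinfun.add_left)
  have "piD T \<theta> \<eta> h \<in> Dom T \<and> D (piD T \<theta> \<eta> h) = X \<eta>"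
  proof (rule haagerup_induct)
    fix s \<eta> assume s: "\<And>n. piD T \<theta> (s n) h \<in> Dom T \<and> D (piD T \<theta> (s n) h) = X (s n)" "s \<longlonglongrightarrow> \<eta>"
    show "piD T \<theta> \<eta> h \<in> Dom T \<and> D (piD T \<theta> \<eta> h) = X \<eta>"
    proof (rule D_closed[of "\<lambda>n. piD T \<theta> (s n) h"])
      show "(\<lambda>n. piD T \<theta> (s n) h) \<longlonglongrightarrow> piD T \<theta> \<eta> h"
        by (intro tendsto_blinfun_apply tendsto_bounded_clinear[OF bounded_clinear_piD] s(2) tendsto_const)
      have "(\<lambda>n. X (s n)) \<longlonglongrightarrow> X \<eta>"
        unfolding X_def piD2_eq
        by (intro tendsto_add tendsto_diff tendsto_blinfun_apply tendsto_const s(2)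
            tendsto_bounded_clinear[OF bounded_clinear_piD]
            tendsto_bounded_clinear[OF bounded_clinear_piD_delta]
            tendsto_bounded_clinear[OF bounded_clinear_piD2R])
      then show "(\<lambda>n. D (piD T \<theta> (s n) h)) \<longlonglongrightarrow> X \<eta>" using s(1) by simp
    qed (use s(1) in simp)
  next
    show "piD T \<theta> 0 h \<in> Dom T \<and> D (piD T \<theta> 0 h) = X 0"
      by (simp add: X_def piD2_eq bounded_clinear_zero bounded_clinear_piD bounded_clinear_piD_delta
          bounded_clinear_piD2R Dom_0)
  next
    fix \<eta> \<eta>' assume "piD T \<theta> \<eta> h \<in> Dom T \<and> D (piD T \<theta> \<eta> h) = X \<eta>"
      "piD T \<theta> \<eta>' h \<in> Dom T \<and> D (piD T \<theta> \<eta>' h) = X \<eta>'"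
    then show "piD T \<theta> (\<eta> + \<eta>') h \<in> Dom T \<and> D (piD T \<theta> (\<eta> + \<eta>') h) = X (\<eta> + \<eta>')"
      by (simp add: X_add bounded_clinear_add_apply bounded_clinear_piD blinfun.add_left Dom_add D_add)
  next
    fix a b assume a: "a \<in> B1 T" and b: "b \<in> B2 T"
    have hD: "h \<in> Dom T" "D h \<in> Dom T" using h by (simp_all add: Dom2_iff)
    have bh: "b h \<in> Dom2 T" "b h \<in> Dom T" "D (b h) \<in> Dom T" "b (D h) \<in> Dom T"
      using C2_op_Dom2[OF C2_op_B2[OF b] h] C1_op_Dom[OF C1_op_B2[OF b] hD(2)] by (simp_all add: Dom2_iff)
    have eq: "comm1 T b h = D (b h) - b (D h)" "comm1 T b (D h) = D (b (D h)) - b (D (D h))"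
      using comm1_apply[OF C1_op_B2[OF b] hD(1)] comm1_apply[OF C1_op_B2[OF b] hD(2)] by simp_all
    have c: "comm1 T b h \<in> Dom T" unfolding eq by (intro Dom_diff bh)
    have "D (a (comm1 T b h)) = comm1 T a (comm1 T b h) + a (D (comm1 T b h))"
      using comm1_apply[OF C1_op_B1[OF a] c] by simp
    also have "D (comm1 T b h) = (D (D (b h)) - b (D (D h))) - comm1 T b (D h)"
      unfolding eq by (simp add: D_diff bh)
    also have "D (D (b h)) - b (D (D h)) = comm2R T b (D h + \<i> *\<^sub>C h)"
      using comm2R_apply[OF C2_op_B2[OF b] h] by simp
    finally have "D (a (comm1 T b h)) = X (\<theta> a b)"
      by (simp add: X_def piD2_eq piD_\<theta> piD_delta_\<theta> piD2R_\<theta> a b blinfun.diff_right)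
    then show "piD T \<theta> (\<theta> a b) h \<in> Dom T \<and> D (piD T \<theta> (\<theta> a b) h) = X (\<theta> a b)"
      using C1_op_Dom[OF C1_op_B1[OF a] c] by (simp add: piD_\<theta> a b)
  qed
  then show "piD T \<theta> \<eta> h \<in> Dom T"
    "D (piD T \<theta> \<eta> h) + piD T \<theta> \<eta> (D h) = piD_delta T \<theta> \<eta> h + piD2 T \<theta> \<eta> h"
    by (simp_all add: X_def)
qed

end

section \<open>The module and the interior tensor product\<close>

locale differentiable_module = haagerup_tensor T \<theta>
  for T :: "'h :: chilbert_space striple"
    and \<theta> :: "('h \<Rightarrow>\<^sub>L 'h) \<Rightarrow> ('h \<Rightarrow>\<^sub>L 'h) \<Rightarrow> 'w :: complex_banach" +
  fixes E :: "('h, 'x :: complex_banach, 'n :: finite) smodule"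
  assumes module: "C2_module T E"
begin

abbreviation "v \<equiv> vv E"
abbreviation "\<gamma> \<equiv> grX E"

lemma act_add_left: "b \<in> Balg T \<Longrightarrow> act E (x + y) b = act E x b + act E y b"
  and act_scalar: "act E x (c *\<^sub>C id_blinfun) = c *\<^sub>C x"
  and ip_cadj: "ip E y x = cadj (ip E x y)"
  and norm_eq_ip: "norm x = sqrt (norm (ip E x x))"
  and grX_grX: "\<gamma> (\<gamma> x) = x"
  and grX_add: "\<gamma> (x + y) = \<gamma> x + \<gamma> y"
  and grX_act: "b \<in> Balg T \<Longrightarrow> \<gamma> (act E x b) = act E (\<gamma> x) b"
  and ip_grX: "ip E (\<gamma> x) (\<gamma> y) = ip E x y"
proof -
  have full: "full_graded_hilbert_module T E"
    using module unfolding C2_module_def by (elim conjE)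
  note F = full[unfolded full_graded_hilbert_module_def]
  have "\<forall>x y. \<forall>b\<in>Balg T. act E (x + y) b = act E x b + act E y b" using F by (elim conjE)
  then show "b \<in> Balg T \<Longrightarrow> act E (x + y) b = act E x b + act E y b" by blast
  have "\<forall>x c. act E x (c *\<^sub>C id_blinfun) = c *\<^sub>C x" using F by (elim conjE)
  then show "act E x (c *\<^sub>C id_blinfun) = c *\<^sub>C x" by blast
  have "\<forall>x y. ip E y x = cadj (ip E x y)" using F by (elim conjE)
  then show "ip E y x = cadj (ip E x y)" by blast
  have "\<forall>x. norm x = sqrt (norm (ip E x x))" using F by (elim conjE)
  then show "norm x = sqrt (norm (ip E x x))" by blast
  have "\<forall>x. \<gamma> (\<gamma> x) = x" using F by (elim conjE)
  then show "\<gamma> (\<gamma> x) = x" by blast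
  have "\<forall>x y. \<gamma> (x + y) = \<gamma> x + \<gamma> y" using F by (elim conjE)
  then show "\<gamma> (x + y) = \<gamma> x + \<gamma> y" by blast
  have "\<forall>x. \<forall>b\<in>Balg T. \<gamma> (act E x b) = act E (\<gamma> x) b" using F by (elim conjE)
  then show "b \<in> Balg T \<Longrightarrow> \<gamma> (act E x b) = act E (\<gamma> x) b" by blast
  have "\<forall>x y. ip E (\<gamma> x) (\<gamma> y) = ip E x y" using F by (elim conjE)
  then show "ip E (\<gamma> x) (\<gamma> y) = ip E x y" by blast
qed

lemma csubspace_Xc: "csubspace (Xc E)"
  and dense_Xc: "closure (Xc E) = UNIV"
  and grX_Xc: "x \<in> Xc E \<Longrightarrow> \<gamma> x \<in> Xc E"
  and act_Xc: "x \<in> Xc E \<Longrightarrow> b \<in> B2 T \<Longrightarrow> act E x b \<in> Xc E"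
  and v_add: "v (x + y) i = v x i + v y i"
  and v_act: "b \<in> Balg T \<Longrightarrow> v (act E x b) i = v x i o\<^sub>L b"
  and ip_eq: "ip E x y = (\<Sum>i\<in>UNIV. cadj (v x i) o\<^sub>L v y i)"
  and v_grX: "v (\<gamma> x) i = parity i *\<^sub>R v x i"
  and v_Balg: "v x i \<in> Balg T"
  and v_B2: "x \<in> Xc E \<Longrightarrow> v x i \<in> B2 T"
  and ex_vadj: "(\<And>i. \<xi> i \<in> B2 T) \<Longrightarrow>
      \<exists>x\<in>Xc E. \<forall>y\<in>Xc E. ip E y x = (\<Sum>i\<in>UNIV. cadj (v y i) o\<^sub>L \<xi> i)"
proof -
  note M = module[unfolded C2_module_def]
  show "csubspace (Xc E)" using M by (elim conjE)
  show "closure (Xc E) = UNIV" using M by (elim conjE)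
  have "\<forall>x\<in>Xc E. \<gamma> x \<in> Xc E \<and> (\<forall>b\<in>B2 T. act E x b \<in> Xc E)" using M by (elim conjE)
  then show "x \<in> Xc E \<Longrightarrow> \<gamma> x \<in> Xc E" "x \<in> Xc E \<Longrightarrow> b \<in> B2 T \<Longrightarrow> act E x b \<in> Xc E"
    by blast+
  have "\<forall>x y i. v (x + y) i = v x i + v y i" using M by (elim conjE)
  then show "v (x + y) i = v x i + v y i" by blast
  have "\<forall>x i. \<forall>b\<in>Balg T. v (act E x b) i = v x i o\<^sub>L b" using M by (elim conjE)
  then show "b \<in> Balg T \<Longrightarrow> v (act E x b) i = v x i o\<^sub>L b" by blast
  have "\<forall>x y. ip E x y = (\<Sum>i\<in>UNIV. cadj (v x i) o\<^sub>L v y i)" using M by (elim conjE)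
  then show "ip E x y = (\<Sum>i\<in>UNIV. cadj (v x i) o\<^sub>L v y i)" by blast
  have "\<forall>x i. v (\<gamma> x) i = parity i *\<^sub>R v x i" using M by (elim conjE)
  then show "v (\<gamma> x) i = parity i *\<^sub>R v x i" by blast
  have "\<forall>x i. v x i \<in> Balg T" using M by (elim conjE)
  then show "v x i \<in> Balg T" by blast
  have "\<forall>x\<in>Xc E. \<forall>i. v x i \<in> B2 T" using M by (elim conjE)
  then show "x \<in> Xc E \<Longrightarrow> v x i \<in> B2 T" by blast
  have "\<forall>\<xi>. (\<forall>i. \<xi> i \<in> B2 T) \<longrightarrow>
      (\<exists>x\<in>Xc E. \<forall>y\<in>Xc E. ip E y x = (\<Sum>i\<in>UNIV. cadj (v y i) o\<^sub>L \<xi> i))" using M by (elim conjE)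
  then show "(\<And>i. \<xi> i \<in> B2 T) \<Longrightarrow>
      \<exists>x\<in>Xc E. \<forall>y\<in>Xc E. ip E y x = (\<Sum>i\<in>UNIV. cadj (v y i) o\<^sub>L \<xi> i)" by blast
qed

lemmas Xc_add = complex_vector.subspace_add[OF csubspace_Xc]
lemmas Xc_scaleC = complex_vector.subspace_scale[OF csubspace_Xc]
lemmas Xc_diff = complex_vector.subspace_diff[OF csubspace_Xc]
lemmas Xc_0 = complex_vector.subspace_0[OF csubspace_Xc]
lemmas Xc_neg = complex_vector.subspace_neg[OF csubspace_Xc]
lemmas Xc_sum = complex_vector.subspace_sum[OF csubspace_Xc]

lemma parity_parity [simp]: "parity i * parity i = 1"
  by (simp add: parity_def split: sum.split)

lemma clinear_op_v: "clinear_op (v x i)"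
  by (rule clinear_op_Balg[OF v_Balg])

lemma scalar_in_Balg: "c *\<^sub>C id_blinfun \<in> Balg T"
  by (intro B1_imp_Balg B1_scaleC id_in_B1)

lemma v_scaleC: "v (c *\<^sub>C x) i = c *\<^sub>C v x i"
  unfolding act_scalar[symmetric] v_act[OF scalar_in_Balg]
  by (simp add: clinear_op_compose_scaleC clinear_op_v)

lemma v_0: "v 0 i = 0"
  using v_add[of 0 0 i] by simp

lemma v_minus: "v (- x) i = - v x i"
  using v_scaleC[of "-1" x i] by (simp add: scaleC_minus_one)

lemma v_diff: "v (x - y) i = v x i - v y i"
  using v_add[of x "- y" i] by (simp add: v_minus)

lemma v_sum: "v (sum f A) i = (\<Sum>a\<in>A. v (f a) i)"
  by (induction A rule: infinite_finite_induct) (simp_all add: v_0 v_add)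

lemma grX_0: "\<gamma> 0 = 0"
  using grX_add[of 0 0] by simp

lemma grX_sum: "\<gamma> (sum f A) = (\<Sum>a\<in>A. \<gamma> (f a))"
  by (induction A rule: infinite_finite_induct) (simp_all add: grX_0 grX_add)

lemma grX_minus: "\<gamma> (- x) = - \<gamma> x"
  using grX_add[of x "- x"] by (simp add: grX_0 eq_neg_iff_add_eq_0 add.commute)

lemma act_minus: "b \<in> Balg T \<Longrightarrow> act E (- x) b = - act E x b"
  using act_add_left[of b x "- x"] act_add_left[of b 0 0]
  by (simp add: eq_neg_iff_add_eq_0 add.commute)

lemma v_eqI: "(\<And>i. v x i = v y i) \<Longrightarrow> x = y"
  using norm_eq_ip[of "x - y"] by (simp add: ip_eq v_diff)

lemma norm_v_le: "norm (v x i) \<le> norm x"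
proof (rule norm_blinfun_bound)
  fix h
  have "(norm (v x i h))\<^sup>2 \<le> (\<Sum>j\<in>UNIV. (norm (v x j h))\<^sup>2)"
    by (rule member_le_sum) auto
  also have "\<dots> = Re (\<Sum>j\<in>UNIV. cinner (v x j h) (v x j h))"
    unfolding cinner_self by simp
  also have "(\<Sum>j\<in>UNIV. cinner (v x j h) (v x j h)) = cinner h (ip E x x h)"
    by (simp add: ip_eq blinfun.sum_left cinner_sum_right cadj_right[OF clinear_op_v])
  also have "Re \<dots> \<le> norm h * norm (ip E x x h)"
    using complex_Re_le_cmod cmod_cinner_le order.trans by blast
  also have "\<dots> \<le> norm h * (norm (ip E x x) * norm h)"
    by (intro mult_left_mono norm_blinfun) simp
  also have "\<dots> = (norm x * norm h)\<^sup>2"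
    using norm_eq_ip[of x] by (simp add: power_mult_distrib) (simp add: power2_eq_square)
  finally show "norm (v x i h) \<le> norm x * norm h"
    by (rule power2_le_imp_le) simp
qed simp

lemma bounded_clinear_v: "bounded_clinear (\<lambda>x. v x i)"
  unfolding bounded_clinear_def
  by (intro conjI bounded_linear_intro[where K = 1])
    (simp_all add: v_add v_scaleC scaleR_scaleC norm_v_le)

abbreviation "x\<^sub>v \<equiv> frame E"

text \<open>The frame vector \<open>v\<^sup>* e\<^sub>j\<close> is unique because the inner product is positive definite.\<close>

lemma frame_in_Xc: "x\<^sub>v j \<in> Xc E"
  and ip_frame_right: "y \<in> Xc E \<Longrightarrow> ip E y (x\<^sub>v j) = cadj (v y j)"
proof -
  let ?P = "\<lambda>x. x \<in> Xc E \<and> (\<forall>y\<in>Xc E. ip E y x = (\<Sum>i\<in>UNIV. cadj (v y i) o\<^sub>L stdbasis j i))"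
  have "\<exists>!x. ?P x"
  proof (rule ex_ex1I)
    have "stdbasis j i \<in> B2 T" for i by (simp add: stdbasis_def id_in_B2 B2_0)
    from ex_vadj[of "stdbasis j", OF this] show "\<exists>x. ?P x" by blast
    fix x x' assume x: "?P x" "?P x'"
    have "x - x' \<in> Xc E" using x by (auto intro: Xc_diff)
    with x have "ip E (x - x') x = ip E (x - x') x'" by simp
    then have "ip E (x - x') (x - x') = 0"
      unfolding ip_eq[of _ "x - x'"] ip_eq[of _ x] ip_eq[of _ x'] v_diff
      by (simp add: bounded_bilinear.diff_right[OF bounded_bilinear_blinfun_compose] sum_subtractf)
    then show "x = x'" using norm_eq_ip[of "x - x'"] by simp
  qed
  from theI'[OF this] have *: "?P (x\<^sub>v j)" unfolding frame_def vadj_def .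
  then show "x\<^sub>v j \<in> Xc E" by blast
  assume "y \<in> Xc E"
  then have "ip E y (x\<^sub>v j) = (\<Sum>i\<in>UNIV. cadj (v y i) o\<^sub>L stdbasis j i)" using * by blast
  also have "\<dots> = (\<Sum>i\<in>UNIV. if i = j then cadj (v y i) else 0)"
    by (intro sum.cong) (auto simp: stdbasis_def)
  finally show "ip E y (x\<^sub>v j) = cadj (v y j)" by simp
qed

lemma pmat_eq: "pmat E i j = v (x\<^sub>v j) i"
  by (simp add: pmat_def frame_def)

text \<open>On the dense submodule this is the adjoint of the defining property; both sides are
  continuous.\<close>

lemma ip_frame_left: "ip E (x\<^sub>v j) x = v x j"
proof -
  have "ip E (x\<^sub>v j) = (\<lambda>x. v x j)"
  proof (rule bounded_clinear_eq_on_dense[OF _ bounded_clinear_v dense_Xc])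
    have "bounded_clinear (\<lambda>x. \<Sum>i\<in>I. cadj (v (x\<^sub>v j) i) o\<^sub>L v x i)" if "finite I" for I
      using that
    proof (induction I)
      case empty
      then show ?case by (simp add: bounded_clinear_def bounded_linear_zero)
    next
      case (insert i I)
      then show ?case
        by (simp add: bounded_clinear_add bounded_clinear_compose_left clinear_op_cadj clinear_op_v
            bounded_clinear_v)
    qed
    then show "bounded_clinear (ip E (x\<^sub>v j))" by (simp add: ip_eq[abs_def])
    show "ip E (x\<^sub>v j) x = v x j" if "x \<in> Xc E" for x
      using ip_cadj[of "x\<^sub>v j" x] ip_frame_right[OF that] by (simp add: cadj_cadj clinear_op_v)
  qed
  then show ?thesis by (rule fun_cong)
qed

lemma cadj_pmat: "cadj (pmat E i j) = pmat E j i"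
  using ip_cadj[of "x\<^sub>v j" "x\<^sub>v i"] by (simp add: ip_frame_left pmat_eq)

lemma pmat_v: "(\<Sum>j\<in>UNIV. pmat E i j o\<^sub>L v x j) = v x i"
  using ip_frame_left[of i x] by (simp add: ip_eq pmat_eq[symmetric] cadj_pmat)

lemma frame_expansion: "x = (\<Sum>j\<in>UNIV. act E (x\<^sub>v j) (v x j))"
  by (rule v_eqI) (simp add: v_sum v_act v_Balg pmat_eq[symmetric] pmat_v)

text \<open>\<open>v\<^sup>*\<close> is even, so it maps the homogeneous vector \<open>e\<^sub>j\<close> to a homogeneous vector.\<close>

lemma grX_frame: "\<gamma> (x\<^sub>v j) = parity j *\<^sub>R x\<^sub>v j"
proof -
  have "v (\<gamma> (x\<^sub>v j)) i = v (parity j *\<^sub>R x\<^sub>v j) i" for i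
  proof -
    have "v (\<gamma> (x\<^sub>v j)) i = ip E (\<gamma> (x\<^sub>v i)) (x\<^sub>v j)"
      using ip_grX[of "\<gamma> (x\<^sub>v i)" "x\<^sub>v j"] by (simp add: grX_grX ip_frame_left)
    also have "\<dots> = cadj (v (\<gamma> (x\<^sub>v i)) j)" by (intro ip_frame_right grX_Xc frame_in_Xc)
    also have "\<dots> = parity j *\<^sub>R cadj (v (x\<^sub>v i) j)" by (simp add: v_grX cadj_scaleR clinear_op_v)
    also have "cadj (v (x\<^sub>v i) j) = v (x\<^sub>v j) i" using cadj_pmat by (simp add: pmat_eq)
    finally show ?thesis by (simp add: scaleR_scaleC v_scaleC)
  qed
  then show ?thesis by (rule v_eqI)
qed

lemma parity_pmat: "parity i *\<^sub>R pmat E i j = parity j *\<^sub>R pmat E i j"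
proof -
  have "v (\<gamma> (x\<^sub>v j)) i = parity j *\<^sub>R v (x\<^sub>v j) i"
    by (simp add: grX_frame scaleR_scaleC v_scaleC)
  then show ?thesis unfolding pmat_eq by (rule HOL.trans[OF v_grX[symmetric]])
qed

lemma pmat_B2: "pmat E i j \<in> B2 T"
  by (simp add: pmat_eq v_B2 frame_in_Xc)

lemma Xc_subset_Xv: "x \<in> Xc E \<Longrightarrow> x \<in> Xv T E"
  unfolding Xv_def completion_in_def
proof (intro CollectI exI[of _ "\<lambda>_. x"] conjI allI impI tendsto_const)
  fix e :: real assume e: "0 < e"
  \<comment> \<open>the constant sequence is Cauchy since the column norm of \<open>0\<close> vanishes\<close>
  have "pi1 T 0 = 0"
    using comm1_scaleC[OF C1_op_id, of 0]
    by (intro blinfun_eqI) (auto simp: pi1_eq_blk zero_prod_def)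
  then have "col_norm UNIV (\<lambda>i. pi1 T (v (x - x) i)) \<le> 0"
    by (intro col_norm_le) (simp_all add: v_0 L2_set_def)
  with e show "\<exists>K. \<forall>m\<ge>K. \<forall>n\<ge>K. col_norm UNIV (\<lambda>i. pi1 T (v (x - x) i)) < e" by auto
qed

lemma Xv_minus: "x \<in> Xv T E \<Longrightarrow> - x \<in> Xv T E"
proof -
  assume "x \<in> Xv T E"
  then obtain s where s: "\<And>n. s n \<in> Xc E" "s \<longlonglongrightarrow> x"
    "\<And>e. e > 0 \<Longrightarrow> \<exists>K. \<forall>m\<ge>K. \<forall>n\<ge>K. col_norm UNIV (\<lambda>i. pi1 T (v (s m - s n) i)) < e"
    unfolding Xv_def completion_in_def by blast
  show "- x \<in> Xv T E"
    unfolding Xv_def completion_in_def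
  proof (intro CollectI exI[of _ "\<lambda>n. - s n"] conjI allI impI)
    fix e :: real assume "0 < e"
    then obtain K where "\<forall>m\<ge>K. \<forall>n\<ge>K. col_norm UNIV (\<lambda>i. pi1 T (v (s m - s n) i)) < e"
      using s(3) by blast
    then show "\<exists>K. \<forall>m\<ge>K. \<forall>n\<ge>K. col_norm UNIV (\<lambda>i. pi1 T (v (- s m - - s n) i)) < e"
      by (intro exI[of _ K]) simp
  qed (use s in \<open>auto intro: Xc_neg tendsto_minus\<close>)
qed

lemma v_B1: assumes "x \<in> Xv T E" shows "v x i \<in> B1 T"
proof -
  obtain s where s: "\<And>n. s n \<in> Xc E" "s \<longlonglongrightarrow> x"
    "\<And>e. e > 0 \<Longrightarrow> \<exists>K. \<forall>m\<ge>K. \<forall>n\<ge>K. col_norm UNIV (\<lambda>i. pi1 T (v (s m - s n) i)) < e"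
    using assms unfolding Xv_def completion_in_def by blast
  have "Cauchy (\<lambda>n. comm1 T (v (s n) i))"
  proof (rule metric_CauchyI)
    fix e :: real assume "0 < e"
    then obtain K where K: "\<And>m n. m \<ge> K \<Longrightarrow> n \<ge> K \<Longrightarrow> col_norm UNIV (\<lambda>i. pi1 T (v (s m - s n) i)) < e"
      using s(3) by blast
    have "dist (comm1 T (v (s m) i)) (comm1 T (v (s n) i)) < e" if "m \<ge> K" "n \<ge> K" for m n
    proof -
      have "dist (comm1 T (v (s m) i)) (comm1 T (v (s n) i)) = norm (comm1 T (v (s m - s n) i))"
        by (simp add: dist_norm v_diff comm1_diff C1_op_B2 v_B2 s(1))
      also have "\<dots> \<le> norm (pi1 T (v (s m - s n) i))"
        unfolding pi1_eq_blk by (rule norm_le_norm_blk)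
      also have "\<dots> \<le> col_norm UNIV (\<lambda>i. pi1 T (v (s m - s n) i))"
        by (rule norm_le_col_norm) simp_all
      also note K[OF that]
      finally show ?thesis .
    qed
    then show "\<exists>K. \<forall>m\<ge>K. \<forall>n\<ge>K. dist (comm1 T (v (s m) i)) (comm1 T (v (s n) i)) < e" by blast
  qed
  then obtain A where "(\<lambda>n. comm1 T (v (s n) i)) \<longlonglongrightarrow> A"
    using convergentD[OF Cauchy_convergent] by blast
  with tendsto_bounded_clinear[OF bounded_clinear_v s(2)] show ?thesis
    using B1_limit[of "\<lambda>n. v (s n) i"] B2_imp_B1[OF v_B2[OF s(1)]] by blast
qed

end

locale interior_tensor = differentiable_module T \<theta> E
  for T :: "'h :: chilbert_space striple"
    and \<theta> :: "('h \<Rightarrow>\<^sub>L 'h) \<Rightarrow> ('h \<Rightarrow>\<^sub>L 'h) \<Rightarrow> 'w :: complex_banach"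
    and E :: "('h, 'x :: complex_banach, 'n :: finite) smodule" +
  fixes \<tau> :: "'x \<Rightarrow> 'h \<Rightarrow> 'k :: chilbert_space"
  assumes interior: "is_interior_tensor T E \<tau>"
begin

lemma \<tau>_add_left: "\<tau> (x + y) h = \<tau> x h + \<tau> y h"
  and \<tau>_add_right: "\<tau> x (h + k) = \<tau> x h + \<tau> x k"
  and \<tau>_scaleC_left: "\<tau> (c *\<^sub>C x) h = c *\<^sub>C \<tau> x h"
  and \<tau>_scaleC_right: "\<tau> x (c *\<^sub>C h) = c *\<^sub>C \<tau> x h"
  and \<tau>_act: "b \<in> Balg T \<Longrightarrow> \<tau> (act E x b) h = \<tau> x (b h)"
  and cinner_\<tau>: "cinner (\<tau> x h) (\<tau> y k) = cinner h (ip E x y k)"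
  and dense_\<tau>: "closure (cspan {\<tau> x h | x h. True}) = UNIV"
  using interior unfolding is_interior_tensor_def by simp_all

lemma bounded_bilinear_\<tau>: "bounded_bilinear \<tau>"
proof
  have "norm (\<tau> x h) \<le> norm x * norm h * 1" for x h
  proof -
    have "(norm (\<tau> x h))\<^sup>2 = cmod (cinner h (ip E x x h))"
      by (simp add: norm_square_cinner cinner_\<tau>)
    also have "\<dots> \<le> norm h * norm (ip E x x h)" by (rule cmod_cinner_le)
    also have "\<dots> \<le> norm h * (norm (ip E x x) * norm h)"
      by (intro mult_left_mono norm_blinfun) simp
    also have "\<dots> = (norm x * norm h)\<^sup>2"
      using norm_eq_ip[of x] by (simp add: power_mult_distrib) (simp add: power2_eq_square)
    finally have "norm (\<tau> x h) \<le> norm x * norm h" by (rule power2_le_imp_le) simp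
    then show ?thesis by simp
  qed
  then show "\<exists>K. \<forall>x h. norm (\<tau> x h) \<le> norm x * norm h * K" by blast
qed (simp_all add: \<tau>_add_left \<tau>_add_right scaleR_scaleC \<tau>_scaleC_left \<tau>_scaleC_right)

lemmas \<tau>_sum_left = bounded_bilinear.sum_left[OF bounded_bilinear_\<tau>]
lemmas \<tau>_minus_left = bounded_bilinear.minus_left[OF bounded_bilinear_\<tau>]
lemmas \<tau>_scaleR_left = bounded_bilinear.scaleR_left[OF bounded_bilinear_\<tau>]
lemmas \<tau>_scaleR_right = bounded_bilinear.scaleR_right[OF bounded_bilinear_\<tau>]
lemmas \<tau>_diff_right = bounded_bilinear.diff_right[OF bounded_bilinear_\<tau>]

lemma dense_\<tau>_core:
  assumes "closure S = UNIV"
  shows "closure (cspan {\<tau> x h | x h. x \<in> Xc E \<and> h \<in> S}) = UNIV"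
proof -
  let ?W = "cspan {\<tau> x h | x h. x \<in> Xc E \<and> h \<in> S}"
  have "\<tau> x h \<in> closure ?W" for x h
  proof -
    obtain s where s: "\<And>n. s n \<in> Xc E" "s \<longlonglongrightarrow> x"
      using dense_Xc closure_sequential[of x "Xc E"] by auto
    obtain t where t: "\<And>n. t n \<in> S" "t \<longlonglongrightarrow> h"
      using assms closure_sequential[of h S] by auto
    have "(\<lambda>n. \<tau> (s n) (t n)) \<longlonglongrightarrow> \<tau> x h"
      by (rule bounded_bilinear.tendsto[OF bounded_bilinear_\<tau> s(2) t(2)])
    moreover have "\<tau> (s n) (t n) \<in> ?W" for n
      using s(1) t(1) by (intro complex_vector.span_base) blast
    ultimately show ?thesis
      unfolding closure_sequential by (intro exI[of _ "\<lambda>n. \<tau> (s n) (t n)"]) simp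
  qed
  then have "cspan {\<tau> x h | x h. True} \<subseteq> closure ?W"
    by (intro complex_vector.span_minimal csubspace_closure complex_vector.subspace_span) auto
  from closure_mono[OF this] dense_\<tau> show ?thesis by auto
qed

text \<open>Linear combinations of \<open>x \<otimes> h\<close> are sums of such tensors, because scalars can be moved into
  \<open>h\<close>.\<close>

lemma blinfun_eq_on_\<tau>:
  fixes A B :: "'k \<Rightarrow>\<^sub>L 'z :: real_normed_vector"
  assumes "\<And>x h. x \<in> Xc E \<Longrightarrow> A (\<tau> x h) = B (\<tau> x h)"
  shows "A = B"
proof (rule blinfun_eq_on_dense[OF dense_\<tau>_core[of UNIV]])
  fix \<zeta> assume "\<zeta> \<in> cspan {\<tau> x h | x h. x \<in> Xc E \<and> h \<in> UNIV}"
  then show "A \<zeta> = B \<zeta>"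
    by (induction rule: complex_vector.span_induct_alt)
      (use assms in \<open>auto simp: blinfun.add_right simp flip: \<tau>_scaleC_right\<close>)
qed simp

text \<open>The operator \<open>v\<^sup>* : H\<^sup>2\<^sup>N \<rightarrow> X \<otimes>\<^sub>B H\<close>, \<open>e\<^sub>j \<otimes> h \<mapsto> v\<^sup>* e\<^sub>j \<otimes> h\<close>.\<close>

definition U :: "('h ^ ('n + 'n)) \<Rightarrow>\<^sub>L 'k"
  where "U = Blinfun (\<lambda>\<xi>. \<Sum>j\<in>UNIV. \<tau> (x\<^sub>v j) (\<xi> $ j))"

lemma U_apply: "U \<xi> = (\<Sum>j\<in>UNIV. \<tau> (x\<^sub>v j) (\<xi> $ j))"
proof -
  have "bounded_linear (\<lambda>\<xi>. \<Sum>j\<in>UNIV. \<tau> (x\<^sub>v j) (\<xi> $ j))"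
    by (intro bounded_linear_sum bounded_linear_compose[OF
          bounded_bilinear.bounded_linear_right[OF bounded_bilinear_\<tau>]] bounded_linear_vec_nth)
  then show ?thesis by (simp add: U_def bounded_linear_Blinfun_apply)
qed

lemma clinear_op_U: "clinear_op U"
  unfolding clinear_op_iff
  by (simp add: U_apply scaleC_vec_def \<tau>_scaleC_right complex_vector.scale_sum_right)

abbreviation "V \<equiv> vtensor E \<tau>"

text \<open>This shows at once that the isometry \<open>v \<otimes> 1\<close> exists and that its adjoint is \<open>U\<close>.\<close>

lemma cadj_U_\<tau>: "cadj U (\<tau> x h) = (\<chi> i. v x i h)"
proof (rule cinner_eqI[of UNIV])
  fix \<xi>
  have "cinner \<xi> (cadj U (\<tau> x h)) = cinner (U \<xi>) (\<tau> x h)"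
    by (simp add: cadj_right[OF clinear_op_U])
  also have "\<dots> = cinner \<xi> (\<chi> i. v x i h)"
    by (simp add: U_apply cinner_sum_left cinner_\<tau> ip_frame_left cinner_vec_def)
  finally show "cinner \<xi> (cadj U (\<tau> x h)) = cinner \<xi> (\<chi> i. v x i h)" .
qed simp

lemma V_eq_cadj_U: "V = cadj U"
  unfolding vtensor_def
proof (rule the_equality)
  show "A = cadj U" if "\<forall>x h. A (\<tau> x h) = (\<chi> i. v x i h)" for A :: "'k \<Rightarrow>\<^sub>L ('h ^ ('n + 'n))"
    by (rule blinfun_eq_on_\<tau>) (simp add: that cadj_U_\<tau>)
qed (simp add: cadj_U_\<tau>)

lemma V_\<tau>: "V (\<tau> x h) = (\<chi> i. v x i h)"
  by (simp add: V_eq_cadj_U cadj_U_\<tau>)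

lemma clinear_op_V: "clinear_op V"
  by (simp add: V_eq_cadj_U clinear_op_cadj clinear_op_U)

lemma cadj_V: "cadj V = U"
  by (simp add: V_eq_cadj_U cadj_cadj clinear_op_U)

lemma cinner_U: "cinner (U \<xi>) \<zeta> = cinner \<xi> (V \<zeta>)"
  by (simp add: V_eq_cadj_U cadj_right clinear_op_U)

lemma cinner_V: "cinner (V \<zeta>) \<xi> = cinner \<zeta> (U \<xi>)"
  using cadj_right[OF clinear_op_V] by (simp add: cadj_V)

lemma U_V: "U (V \<zeta>) = \<zeta>"
proof -
  have "U o\<^sub>L V = id_blinfun"
  proof (rule blinfun_eq_on_\<tau>)
    fix x h
    have "U (V (\<tau> x h)) = (\<Sum>j\<in>UNIV. \<tau> (act E (x\<^sub>v j) (v x j)) h)"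
      by (simp add: U_apply V_\<tau> \<tau>_act v_Balg)
    also have "\<dots> = \<tau> x h" by (simp flip: \<tau>_sum_left frame_expansion)
    finally show "(U o\<^sub>L V) (\<tau> x h) = id_blinfun (\<tau> x h)" by simp
  qed
  then have "(U o\<^sub>L V) \<zeta> = id_blinfun \<zeta>" by simp
  then show ?thesis by simp
qed

lemma V_U: "V (U \<xi>) = matrix_op (pmat E) \<xi>"
  by (simp add: U_apply blinfun.sum_right V_\<tau> matrix_op_apply vec_eq_iff pmat_eq)

end

section \<open>The connection form\<close>

locale connection = interior_tensor T \<theta> E \<tau>
  for T :: "'h :: chilbert_space striple"
    and \<theta> :: "('h \<Rightarrow>\<^sub>L 'h) \<Rightarrow> ('h \<Rightarrow>\<^sub>L 'h) \<Rightarrow> 'w :: complex_banach"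
    and E :: "('h, 'x :: complex_banach, 'n :: finite) smodule"
    and \<tau> :: "'x \<Rightarrow> 'h \<Rightarrow> 'k :: chilbert_space" +
  fixes nab :: "'x \<Rightarrow> ('x \<times> 'w) multiset set"
  assumes conn: "C2_connection T E \<theta> nab"
begin

lemma nab_representative:
    "x \<in> Xc E \<Longrightarrow> \<exists>u. set_mset u \<subseteq> Xv T E \<times> Omega1 T \<theta> \<and> nab x = {u'. conn_eq T E \<theta> u u'}"
  and nab_add: "x \<in> Xc E \<Longrightarrow> y \<in> Xc E \<Longrightarrow> u \<in> nab x \<Longrightarrow> u' \<in> nab y \<Longrightarrow> u + u' \<in> nab (x + y)"
  and nab_scaleC: "x \<in> Xc E \<Longrightarrow> u \<in> nab x \<Longrightarrow> image_mset (\<lambda>(y, \<eta>). (c *\<^sub>C y, \<eta>)) u \<in> nab (c *\<^sub>C x)"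
  and nab_grX: "x \<in> Xc E \<Longrightarrow> u \<in> nab x \<Longrightarrow> image_mset (\<lambda>(y, \<eta>). (\<gamma> y, \<eta>)) u \<in> nab (\<gamma> x)"
  and nab_act: "x \<in> Xc E \<Longrightarrow> b \<in> B2 T \<Longrightarrow> u \<in> nab x \<Longrightarrow>
      image_mset (\<lambda>(y, \<eta>). (y, rmult T \<theta> \<eta> b)) u + {#(\<gamma> x, udelta \<theta> b)#} \<in> nab (act E x b)"
  using conn unfolding C2_connection_def by blast+

text \<open>The maps for which evaluation on representatives of \<open>X\<^sub>v \<otimes> \<Omega>\<^sup>1\<close>, balanced over \<open>B\<^sub>1\<close>, is
  independent of the representative.\<close>

definition balanced :: "('x \<Rightarrow> 'w \<Rightarrow> 'c :: ab_group_add) \<Rightarrow> bool"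
  where "balanced f \<longleftrightarrow>
    (\<forall>x\<in>Xv T E. \<forall>x'\<in>Xv T E. \<forall>\<eta>\<in>Omega1 T \<theta>. f (x + x') \<eta> = f x \<eta> + f x' \<eta>) \<and>
    (\<forall>x\<in>Xv T E. \<forall>\<eta>\<in>Omega1 T \<theta>. \<forall>\<eta>'\<in>Omega1 T \<theta>. f x (\<eta> + \<eta>') = f x \<eta> + f x \<eta>') \<and>
    (\<forall>x\<in>Xv T E. \<forall>r\<in>B1 T. \<forall>\<eta>\<in>Omega1 T \<theta>. f (act E x r) \<eta> = f x (lmult T \<theta> r \<eta>))"

lemma balanced_conn_eq:
  assumes f: "balanced f" and u: "conn_eq T E \<theta> u u'"
  shows "(\<Sum>(y, \<eta>)\<in>#u. f y \<eta>) = (\<Sum>(y, \<eta>)\<in>#u'. f y \<eta>)"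
proof (rule tensor_eq_sum_mset[OF u[unfolded conn_eq_def]])
  show "f 0 \<eta> = 0" if "\<eta> \<in> Omega1 T \<theta>" for \<eta>
  proof -
    have "f (0 + 0) \<eta> = f 0 \<eta> + f 0 \<eta>"
      using f that Xc_subset_Xv[OF Xc_0] unfolding balanced_def by blast
    then show ?thesis by simp
  qed
qed (use f in \<open>simp_all add: balanced_def\<close>)

lemma balanced_minus:
  assumes "balanced f" shows "balanced (\<lambda>y \<eta>. f (- y) \<eta>)"
  unfolding balanced_def
proof (intro conjI ballI)
  fix x x' \<eta> assume "x \<in> Xv T E" "x' \<in> Xv T E" "\<eta> \<in> Omega1 T \<theta>"
  then have "f (- x + - x') \<eta> = f (- x) \<eta> + f (- x') \<eta>"
    using assms Xv_minus unfolding balanced_def by blast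
  then show "f (- (x + x')) \<eta> = f (- x) \<eta> + f (- x') \<eta>" by (simp add: add.commute)
next
  fix x r \<eta> assume x: "x \<in> Xv T E" and r: "r \<in> B1 T" and \<eta>: "\<eta> \<in> Omega1 T \<theta>"
  then have "f (act E (- x) r) \<eta> = f (- x) (lmult T \<theta> r \<eta>)"
    using assms Xv_minus unfolding balanced_def by blast
  then show "f (- act E x r) \<eta> = f (- x) (lmult T \<theta> r \<eta>)"
    by (simp add: act_minus B1_imp_Balg[OF r])
qed (use assms Xv_minus in \<open>simp add: balanced_def\<close>)

lemma nab_subset_representative:
  assumes "x \<in> Xc E"
  shows "\<exists>u\<in>nab x. set_mset u \<subseteq> Xv T E \<times> Omega1 T \<theta>"
proof -
  obtain u where u: "set_mset u \<subseteq> Xv T E \<times> Omega1 T \<theta>" "nab x = {u'. conn_eq T E \<theta> u u'}"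
    using nab_representative[OF assms] by blast
  have "u \<in> nab x" unfolding u(2) conn_eq_def using tensor_eq.refl[OF u(1)] by blast
  with u(1) show ?thesis by blast
qed

lemma balanced_nab:
  assumes "balanced f" "x \<in> Xc E" "u \<in> nab x" "u' \<in> nab x"
  shows "(\<Sum>(y, \<eta>)\<in>#u'. f y \<eta>) = (\<Sum>(y, \<eta>)\<in>#u. f y \<eta>)"
proof -
  obtain u0 where u: "nab x = {u'. conn_eq T E \<theta> u0 u'}"
    using nab_representative[OF assms(2)] by blast
  then show ?thesis
    using balanced_conn_eq[OF assms(1), of u0 u] balanced_conn_eq[OF assms(1), of u0 u'] assms(3,4)
    by simp
qed

lemma tensor_lift_nab:
  assumes "balanced f" "x \<in> Xc E" "u \<in> nab x"
  shows "tensor_lift f (nab x) = (\<Sum>(y, \<eta>)\<in>#u. f y \<eta>)"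
  unfolding tensor_lift_def
proof (rule the_equality)
  show "\<forall>u'\<in>nab x. (\<Sum>(y, \<eta>)\<in>#u. f y \<eta>) = (\<Sum>(y, \<eta>)\<in>#u'. f y \<eta>)"
    by (intro ballI balanced_nab[OF assms, symmetric])
qed (use assms(3) in blast)

abbreviation grassmann_sum :: "'x \<Rightarrow> ('x \<times> 'w) multiset"
  where "grassmann_sum x \<equiv> \<Sum>i\<in>UNIV. {#(\<gamma> (x\<^sub>v i), udelta \<theta> (ip E (x\<^sub>v i) x))#}"

lemma grassmann_sum_subset: "x \<in> Xc E \<Longrightarrow> set_mset (grassmann_sum x) \<subseteq> Xc E \<times> Omega1 T \<theta>"
  by (auto simp: set_mset_sum ip_frame_left intro: grX_Xc frame_in_Xc udelta_Omega1 v_B2)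

text \<open>The second sum is minus the Grassmann connection, the sign being carried by the left
  tensor factor. Since the congruence class of a difference is formed by negating
  representatives, the independence of the choices is that of the balanced map \<open>f (- y) \<eta>\<close>.\<close>

lemma tensor_lift_conn_form:
  assumes f: "balanced f" and x: "x \<in> Xc E" and u: "u \<in> nab x"
  shows "tensor_lift f (conn_form T E \<theta> nab x) =
    (\<Sum>(y, \<eta>)\<in>#u. f y \<eta>) + (\<Sum>i\<in>UNIV. f (- \<gamma> (x\<^sub>v i)) (udelta \<theta> (v x i)))"
    (is "_ = ?s")
  unfolding tensor_lift_def
proof (rule the_equality)
  have all: "(\<Sum>(y, \<eta>)\<in>#w. f y \<eta>) = ?s" if w: "w \<in> conn_form T E \<theta> nab x" for w
  proof -
    obtain u1 u' where u': "u1 \<in> nab x" "conn_eq T E \<theta> (grassmann_sum x) u'"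
      "conn_eq T E \<theta> (u1 + image_mset (\<lambda>(y, \<eta>). (- y, \<eta>)) u') w"
      using w unfolding conn_form_def grassmann_def by blast
    have "(\<Sum>(y, \<eta>)\<in>#w. f y \<eta>) = (\<Sum>(y, \<eta>)\<in>#u1. f y \<eta>) + (\<Sum>(y, \<eta>)\<in>#u'. f (- y) \<eta>)"
      using balanced_conn_eq[OF f u'(3)] by (simp add: sum_mset_image_Pair)
    also have "(\<Sum>(y, \<eta>)\<in>#u'. f (- y) \<eta>) = (\<Sum>(y, \<eta>)\<in>#grassmann_sum x. f (- y) \<eta>)"
      by (rule balanced_conn_eq[OF balanced_minus[OF f] u'(2), symmetric])
    also have "\<dots> = (\<Sum>i\<in>UNIV. f (- \<gamma> (x\<^sub>v i)) (udelta \<theta> (v x i)))"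
      by (simp add: sum_mset_sum_singleton ip_frame_left)
    finally show ?thesis using balanced_nab[OF f x u u'(1)] by simp
  qed
  then show "\<forall>w\<in>conn_form T E \<theta> nab x. ?s = (\<Sum>(y, \<eta>)\<in>#w. f y \<eta>)" by simp
  obtain u0 where u0: "u0 \<in> nab x" "set_mset u0 \<subseteq> Xv T E \<times> Omega1 T \<theta>"
    using nab_subset_representative[OF x] by blast
  define w where "w = u0 + image_mset (\<lambda>(y, \<eta>). (- y, \<eta>)) (grassmann_sum x)"
  have sub: "set_mset (grassmann_sum x) \<subseteq> Xv T E \<times> Omega1 T \<theta>"
    using grassmann_sum_subset[OF x] Xc_subset_Xv by blast
  have "set_mset w \<subseteq> Xv T E \<times> Omega1 T \<theta>"
    using u0(2) sub unfolding w_def set_mset_union by (auto intro: Xv_minus)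
  then have "conn_eq T E \<theta> w w" unfolding conn_eq_def by (rule tensor_eq.refl)
  moreover have "conn_eq T E \<theta> (grassmann_sum x) (grassmann_sum x)"
    unfolding conn_eq_def by (rule tensor_eq.refl[OF sub])
  ultimately have w: "w \<in> conn_form T E \<theta> nab x"
    unfolding conn_form_def grassmann_def w_def using u0(1) by blast
  fix s assume s: "\<forall>w\<in>conn_form T E \<theta> nab x. s = (\<Sum>(y, \<eta>)\<in>#w. f y \<eta>)"
  show "s = ?s" by (rule HOL.trans[OF bspec[OF s w] all[OF w]])
qed

subsection \<open>Components of the connection form\<close>

text \<open>The one-form \<open>\<langle>e\<^sub>i, v \<omega>(x)\<rangle>\<close>; on the frame vectors these are the entries of \<open>v \<omega> v\<^sup>*\<close>.\<close>

definition form_component :: "'n + 'n \<Rightarrow> 'x \<Rightarrow> 'w"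
  where "form_component i x =
    tensor_lift (\<lambda>y \<eta>. lmult T \<theta> (v y i) \<eta>) (conn_form T E \<theta> nab x)"

abbreviation \<omega> :: "'n + 'n \<Rightarrow> 'n + 'n \<Rightarrow> 'w"
  where "\<omega> \<equiv> form_matrix T E \<theta> nab"

lemma form_matrix_eq: "\<omega> i j = form_component i (x\<^sub>v j)"
  by (simp add: form_matrix_def form_component_def)

lemma balanced_component: "balanced (\<lambda>y \<eta>. lmult T \<theta> (v y i) \<eta>)"
  unfolding balanced_def
  by (simp add: v_add lmult_add v_B1 bounded_clinear_add_apply bounded_clinear_lmult v_act B1_imp_Balg
      lmult_compose)

lemma v_grX_frame_B1: "v (\<gamma> (x\<^sub>v k)) i \<in> B1 T"
  by (intro B2_imp_B1 v_B2 grX_Xc frame_in_Xc)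

lemma form_component_eq:
  assumes "x \<in> Xc E" "u \<in> nab x"
  shows "form_component i x = (\<Sum>(y, \<eta>)\<in>#u. lmult T \<theta> (v y i) \<eta>) -
    (\<Sum>k\<in>UNIV. lmult T \<theta> (v (\<gamma> (x\<^sub>v k)) i) (udelta \<theta> (v x k)))"
  unfolding form_component_def tensor_lift_conn_form[OF balanced_component assms]
  by (simp add: v_minus lmult_minus v_grX_frame_B1 sum_negf)

lemma form_component_add:
  assumes "x \<in> Xc E" "y \<in> Xc E"
  shows "form_component i (x + y) = form_component i x + form_component i y"
proof -
  obtain u u' where u: "u \<in> nab x" "u' \<in> nab y" 
    using nab_subset_representative[OF assms(1)] nab_subset_representative[OF assms(2)] by blast
  show ?thesis
    unfolding form_component_eq[OF assms(1) u(1)] form_component_eq[OF assms(2) u(2)]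
      form_component_eq[OF Xc_add[OF assms] nab_add[OF assms u]]
    by (simp add: v_add udelta_add v_B2 assms bounded_clinear_add_apply bounded_clinear_lmult
        v_grX_frame_B1 sum.distrib)
qed

lemma form_component_scaleC:
  assumes "x \<in> Xc E"
  shows "form_component i (c *\<^sub>C x) = c *\<^sub>C form_component i x"
proof -
  obtain u where u: "u \<in> nab x" "set_mset u \<subseteq> Xv T E \<times> Omega1 T \<theta>"
    using nab_subset_representative[OF assms] by blast
  have "(\<Sum>(y, \<eta>)\<in>#u. lmult T \<theta> (v (c *\<^sub>C y) i) \<eta>) = (\<Sum>(y, \<eta>)\<in>#u. c *\<^sub>C lmult T \<theta> (v y i) \<eta>)"
    using u(2) by (intro sum_mset_Pair_cong) (auto simp: v_scaleC lmult_scaleC v_B1)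
  also have "\<dots> = c *\<^sub>C (\<Sum>(y, \<eta>)\<in>#u. lmult T \<theta> (v y i) \<eta>)"
    by (rule bounded_clinear_sum_mset_Pair[OF bounded_clinear_scale[OF bounded_clinear_ident], symmetric])
  finally show ?thesis
    unfolding form_component_eq[OF assms u(1)]
      form_component_eq[OF Xc_scaleC[OF assms] nab_scaleC[OF assms u(1)]] sum_mset_image_Pair
    by (simp add: v_scaleC udelta_scaleC v_B2 assms bounded_clinear_scaleC bounded_clinear_lmult
        v_grX_frame_B1 complex_vector.scale_right_diff_distrib complex_vector.scale_sum_right)
qed

lemma form_component_scaleR:
  "x \<in> Xc E \<Longrightarrow> form_component i (r *\<^sub>R x) = r *\<^sub>R form_component i x"
  by (simp add: scaleR_scaleC form_component_scaleC)

lemma form_component_0: "form_component i 0 = 0"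
  using form_component_scaleC[OF Xc_0, of i 0] by simp

lemma form_component_sum:
  "(\<And>k. k \<in> I \<Longrightarrow> f k \<in> Xc E) \<Longrightarrow> form_component i (\<Sum>k\<in>I. f k) = (\<Sum>k\<in>I. form_component i (f k))"
  by (induction I rule: infinite_finite_induct)
    (simp_all add: form_component_0 form_component_add Xc_sum)

text \<open>Both connections commute with the grading, hence so does \<open>\<omega>\<close>, and \<open>v \<omega> v\<^sup>*\<close> is block
  diagonal.\<close>

lemma form_component_grX:
  assumes "x \<in> Xc E"
  shows "form_component i (\<gamma> x) = parity i *\<^sub>R form_component i x"
proof -
  obtain u where u: "u \<in> nab x" "set_mset u \<subseteq> Xv T E \<times> Omega1 T \<theta>"
    using nab_subset_representative[OF assms] by blast
  have lmult_scaleR: "lmult T \<theta> (r *\<^sub>R a) \<eta> = r *\<^sub>R lmult T \<theta> a \<eta>" if "a \<in> B1 T" for r a \<eta>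
    using lmult_scaleC[OF that, of "of_real r"] by (simp add: scaleC_of_real)
  have lmult_scaleR_right: "lmult T \<theta> a (r *\<^sub>R \<eta>) = r *\<^sub>R lmult T \<theta> a \<eta>" if "a \<in> B1 T" for r a \<eta>
    using bounded_clinear_scaleC[OF bounded_clinear_lmult[OF that], of "of_real r"]
    by (simp add: scaleC_of_real)
  have udelta_scaleR: "udelta \<theta> (r *\<^sub>R b) = r *\<^sub>R udelta \<theta> b" if "b \<in> B2 T" for r b
    using udelta_scaleC[OF that, of "of_real r"] by (simp add: scaleC_of_real)
  have "(\<Sum>(y, \<eta>)\<in>#u. lmult T \<theta> (v (\<gamma> y) i) \<eta>) = (\<Sum>(y, \<eta>)\<in>#u. of_real (parity i) *\<^sub>C lmult T \<theta> (v y i) \<eta>)"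
    using u(2) by (intro sum_mset_Pair_cong) (auto simp: v_grX lmult_scaleR v_B1 scaleC_of_real)
  also have "\<dots> = of_real (parity i) *\<^sub>C (\<Sum>(y, \<eta>)\<in>#u. lmult T \<theta> (v y i) \<eta>)"
    by (rule bounded_clinear_sum_mset_Pair[OF bounded_clinear_scale[OF bounded_clinear_ident], symmetric])
  finally have 1: "(\<Sum>(y, \<eta>)\<in>#u. lmult T \<theta> (v (\<gamma> y) i) \<eta>) =
      parity i *\<^sub>R (\<Sum>(y, \<eta>)\<in>#u. lmult T \<theta> (v y i) \<eta>)" by (simp add: scaleC_of_real)
  have 2: "lmult T \<theta> (v (\<gamma> (x\<^sub>v k)) i) (udelta \<theta> (v (\<gamma> x) k)) =
      parity i *\<^sub>R lmult T \<theta> (v (\<gamma> (x\<^sub>v k)) i) (udelta \<theta> (v x k))" for k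
  proof -
    have "lmult T \<theta> (v (\<gamma> (x\<^sub>v k)) i) (udelta \<theta> (v (\<gamma> x) k)) =
        lmult T \<theta> (parity k *\<^sub>R v (\<gamma> (x\<^sub>v k)) i) (udelta \<theta> (v x k))"
      by (simp add: v_grX[of x] udelta_scaleR v_B2 assms lmult_scaleR_right lmult_scaleR v_grX_frame_B1)
    also have "parity k *\<^sub>R v (\<gamma> (x\<^sub>v k)) i = parity i *\<^sub>R v (\<gamma> (x\<^sub>v k)) i"
      unfolding v_grX pmat_eq[symmetric] scaleR_left_commute[of "parity k" "parity i"] parity_pmat[symmetric] ..
    finally show ?thesis by (simp add: lmult_scaleR v_grX_frame_B1)
  qed
  show ?thesis
    unfolding form_component_eq[OF assms u(1)] form_component_eq[OF grX_Xc[OF assms] nab_grX[OF assms u(1)]]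
      sum_mset_image_Pair 1 2
    by (simp add: scaleR_right_diff_distrib scaleR_sum_right)
qed

lemma parity_form_matrix: "parity j *\<^sub>R \<omega> i j = parity i *\<^sub>R \<omega> i j"
  using form_component_grX[OF frame_in_Xc, of i j]
  by (simp add: grX_frame form_component_scaleR frame_in_Xc form_matrix_eq)

text \<open>The inhomogeneous terms of the Leibniz rules of \<open>\<nabla>\<close> and of the Grassmann connection cancel, so
  that \<open>\<omega>\<close> is right linear.\<close>

lemma form_component_act:
  assumes x: "x \<in> Xc E" and b: "b \<in> B2 T"
  shows "form_component i (act E x b) = rmult T \<theta> (form_component i x) b"
proof -
  obtain u where u: "u \<in> nab x" "set_mset u \<subseteq> Xv T E \<times> Omega1 T \<theta>"
    using nab_subset_representative[OF x] by blast
  note r = bounded_clinear_rmult[OF b]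
  let ?a = "\<lambda>k. v (\<gamma> (x\<^sub>v k)) i"
  have a: "?a k \<in> B1 T" for k by (rule v_grX_frame_B1)
  have "(\<Sum>(y, \<eta>)\<in>#u. lmult T \<theta> (v y i) (rmult T \<theta> \<eta> b)) = (\<Sum>(y, \<eta>)\<in>#u. rmult T \<theta> (lmult T \<theta> (v y i) \<eta>) b)"
    using u(2) by (intro sum_mset_Pair_cong) (auto simp: lmult_rmult v_B1 b)
  also have "\<dots> = rmult T \<theta> (\<Sum>(y, \<eta>)\<in>#u. lmult T \<theta> (v y i) \<eta>) b"
    by (rule bounded_clinear_sum_mset_Pair[OF r, symmetric])
  finally have 1: "(\<Sum>(y, \<eta>)\<in>#u. lmult T \<theta> (v y i) (rmult T \<theta> \<eta> b)) =
    rmult T \<theta> (\<Sum>(y, \<eta>)\<in>#u. lmult T \<theta> (v y i) \<eta>) b" .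
  have "lmult T \<theta> (?a k) (udelta \<theta> (v x k o\<^sub>L b)) =
      rmult T \<theta> (lmult T \<theta> (?a k) (udelta \<theta> (v x k))) b + lmult T \<theta> (?a k o\<^sub>L v x k) (udelta \<theta> b)" for k
    by (simp add: udelta_compose v_B2 x b bounded_clinear_add_apply[OF bounded_clinear_lmult[OF a]]
        lmult_rmult a lmult_compose B2_imp_B1)
  then have "(\<Sum>k\<in>UNIV. lmult T \<theta> (?a k) (udelta \<theta> (v x k o\<^sub>L b))) =
      (\<Sum>k\<in>UNIV. rmult T \<theta> (lmult T \<theta> (?a k) (udelta \<theta> (v x k))) b) +
      (\<Sum>k\<in>UNIV. lmult T \<theta> (?a k o\<^sub>L v x k) (udelta \<theta> b))"
    by (simp add: sum.distrib)
  also have "(\<Sum>k\<in>UNIV. lmult T \<theta> (?a k o\<^sub>L v x k) (udelta \<theta> b)) =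
      lmult T \<theta> (\<Sum>k\<in>UNIV. ?a k o\<^sub>L v x k) (udelta \<theta> b)"
    by (rule lmult_sum[symmetric]) (intro B1_compose a B2_imp_B1 v_B2 x)
  also have "(\<Sum>k\<in>UNIV. ?a k o\<^sub>L v x k) = v (\<gamma> x) i"
    by (simp add: v_grX blinfun_compose_scaleR_left pmat_eq[symmetric] pmat_v flip: scaleR_sum_right)
  finally have 2: "(\<Sum>k\<in>UNIV. lmult T \<theta> (?a k) (udelta \<theta> (v x k o\<^sub>L b))) =
      rmult T \<theta> (\<Sum>k\<in>UNIV. lmult T \<theta> (?a k) (udelta \<theta> (v x k))) b + lmult T \<theta> (v (\<gamma> x) i) (udelta \<theta> b)"
    by (simp add: bounded_clinear_sum[OF r])
  show ?thesis
    unfolding form_component_eq[OF x u(1)] form_component_eq[OF act_Xc[OF x b] nab_act[OF x b u(1)]]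
      v_act[OF B1_imp_Balg[OF B2_imp_B1[OF b]]] 2 bounded_clinear_diff[OF r]
    by (simp add: sum_mset_image_Pair 1)
qed

lemma form_component_Omega1:
  assumes "x \<in> Xc E" shows "form_component i x \<in> Omega1 T \<theta>"
proof -
  obtain u where u: "u \<in> nab x" "set_mset u \<subseteq> Xv T E \<times> Omega1 T \<theta>"
    using nab_subset_representative[OF assms] by blast
  have "(\<Sum>(y, \<eta>)\<in>#u. lmult T \<theta> (v y i) \<eta>) \<in> Omega1 T \<theta>"
    using u(2)
    by (induction u) (auto intro!: complex_vector.subspace_add[OF csubspace_Omega1]
        complex_vector.subspace_0[OF csubspace_Omega1] lmult_Omega1 v_B1)
  moreover have "(\<Sum>k\<in>UNIV. lmult T \<theta> (v (\<gamma> (x\<^sub>v k)) i) (udelta \<theta> (v x k))) \<in> Omega1 T \<theta>"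
    by (intro complex_vector.subspace_sum[OF csubspace_Omega1] lmult_Omega1 v_grX_frame_B1
        udelta_Omega1 v_B2 assms)
  ultimately show ?thesis
    unfolding form_component_eq[OF assms u(1)] by (rule complex_vector.subspace_diff[OF csubspace_Omega1])
qed

lemma form_component_expansion:
  assumes "x \<in> Xc E"
  shows "form_component i x = (\<Sum>j\<in>UNIV. rmult T \<theta> (\<omega> i j) (v x j))"
proof -
  have "form_component i x = form_component i (\<Sum>j\<in>UNIV. act E (x\<^sub>v j) (v x j))"
    using frame_expansion[of x] by simp
  also have "\<dots> = (\<Sum>j\<in>UNIV. form_component i (act E (x\<^sub>v j) (v x j)))"
    by (intro form_component_sum act_Xc frame_in_Xc v_B2 assms)
  also have "\<dots> = (\<Sum>j\<in>UNIV. rmult T \<theta> (\<omega> i j) (v x j))"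
    by (simp add: form_component_act frame_in_Xc v_B2 assms form_matrix_eq)
  finally show ?thesis .
qed

lemma form_matrix_Omega1: "\<omega> i j \<in> Omega1 T \<theta>"
  by (simp add: form_matrix_eq form_component_Omega1 frame_in_Xc)

lemma piD_form_component:
  assumes "x \<in> Xc E"
  shows "piD T \<theta> (form_component i x) = (\<Sum>j\<in>UNIV. piD T \<theta> (\<omega> i j) o\<^sub>L v x j)"
  unfolding form_component_expansion[OF assms]
  by (simp add: bounded_clinear_sum[OF bounded_clinear_piD] piD_rmult_Omega1 form_matrix_Omega1 v_B2 assms)

lemma bounded_clinear_piD2: "bounded_clinear (\<lambda>\<eta>. piD2 T \<theta> \<eta> h)"
  unfolding piD2_eq by (rule bounded_clinear_apply[OF bounded_clinear_piD2R])

lemma piD2_form_component: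
  assumes "x \<in> Xc E" "h \<in> Dom T"
  shows "piD2 T \<theta> (form_component i x) h = (\<Sum>j\<in>UNIV. piD2 T \<theta> (\<omega> i j) (v x j h))"
  unfolding form_component_expansion[OF assms(1)]
  by (simp add: bounded_clinear_sum[OF bounded_clinear_piD2] piD2_rmult_Omega1 form_matrix_Omega1 v_B2 assms)

text \<open>One computation covers both \<open>\<pi>\<^sub>D\<close> and \<open>\<pi>\<^bsub>D\<^sup>2\<^esub>\<close>: a left module map \<open>L\<close> on one-forms can be
  pulled through the coefficients \<open>v y\<close> of a tensor \<open>y \<otimes> \<eta>\<close>. For \<open>\<pi>\<^sub>D\<close> the map \<open>g\<close> is the
  identity and \<open>c = 1\<close>; for \<open>\<pi>\<^bsub>D\<^sup>2\<^esub>\<close>, which enters as \<open>\<gamma> \<otimes> \<pi>\<^bsub>D\<^sup>2\<^esub>\<close>, they are the grading and the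
  parity.\<close>

lemma
  fixes L :: "'w \<Rightarrow> 'h" and g :: "'x \<Rightarrow> 'x" and c :: "'n + 'n \<Rightarrow> real"
  assumes L: "bounded_clinear L" "\<And>a \<eta>. a \<in> B1 T \<Longrightarrow> L (lmult T \<theta> a \<eta>) = a (L \<eta>)"
    and g: "\<And>x y. g (x + y) = g x + g y" "\<And>x r. r \<in> B1 T \<Longrightarrow> g (act E x r) = act E (g x) r"
      "\<And>x i. v (g x) i = c i *\<^sub>R v x i"
  shows balanced_\<tau>: "balanced (\<lambda>y \<eta>. \<tau> (g y) (L \<eta>))"
    and V_tensor_lift_conn_form: "x \<in> Xc E \<Longrightarrow>
      V (tensor_lift (\<lambda>y \<eta>. \<tau> (g y) (L \<eta>)) (conn_form T E \<theta> nab x)) = (\<chi> i. c i *\<^sub>R L (form_component i x))"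
proof -
  show bal: "balanced (\<lambda>y \<eta>. \<tau> (g y) (L \<eta>))"
    unfolding balanced_def
    by (simp add: g L(2) bounded_clinear_add_apply[OF L(1)] \<tau>_add_left \<tau>_add_right \<tau>_act B1_imp_Balg)
  assume x: "x \<in> Xc E"
  obtain u where u: "u \<in> nab x" "set_mset u \<subseteq> Xv T E \<times> Omega1 T \<theta>"
    using nab_subset_representative[OF x] by blast
  show "V (tensor_lift (\<lambda>y \<eta>. \<tau> (g y) (L \<eta>)) (conn_form T E \<theta> nab x)) = (\<chi> i. c i *\<^sub>R L (form_component i x))"
    unfolding vec_eq_iff
  proof
    fix i
    have Vi: "bounded_clinear (\<lambda>\<zeta>. V \<zeta> $ i)"
      by (rule bounded_clinear_compose[OF bounded_clinear_vec_nth clinear_op_V])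
    have V\<tau>: "V (\<tau> (g y) (L \<eta>)) $ i = of_real (c i) *\<^sub>C L (lmult T \<theta> (v y i) \<eta>)" if "v y i \<in> B1 T" for y \<eta>
      by (simp add: V_\<tau> g(3) blinfun.scaleR_left L(2)[OF that] scaleC_of_real)
    note cL = bounded_clinear_scale[OF L(1), of "of_real (c i)"]
    have mB: "v (- \<gamma> (x\<^sub>v k)) i \<in> B1 T" for k
      by (intro B2_imp_B1 v_B2 Xc_neg grX_Xc frame_in_Xc)
    have "V (tensor_lift (\<lambda>y \<eta>. \<tau> (g y) (L \<eta>)) (conn_form T E \<theta> nab x)) $ i =
        (\<Sum>(y, \<eta>)\<in>#u. V (\<tau> (g y) (L \<eta>)) $ i) +
        (\<Sum>k\<in>UNIV. V (\<tau> (g (- \<gamma> (x\<^sub>v k))) (L (udelta \<theta> (v x k)))) $ i)"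
      unfolding tensor_lift_conn_form[OF bal x u(1)]
      by (simp only: bounded_clinear_add_apply[OF Vi] bounded_clinear_sum_mset_Pair[OF Vi]
          bounded_clinear_sum[OF Vi])
    also have "(\<Sum>(y, \<eta>)\<in>#u. V (\<tau> (g y) (L \<eta>)) $ i) =
        (\<Sum>(y, \<eta>)\<in>#u. of_real (c i) *\<^sub>C L (lmult T \<theta> (v y i) \<eta>))"
      using u(2) by (intro sum_mset_Pair_cong V\<tau>) (auto intro: v_B1)
    also have "\<dots> = of_real (c i) *\<^sub>C L (\<Sum>(y, \<eta>)\<in>#u. lmult T \<theta> (v y i) \<eta>)"
      by (rule bounded_clinear_sum_mset_Pair[OF cL, symmetric])
    also have "(\<Sum>k\<in>UNIV. V (\<tau> (g (- \<gamma> (x\<^sub>v k))) (L (udelta \<theta> (v x k)))) $ i) =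
        of_real (c i) *\<^sub>C L (\<Sum>k\<in>UNIV. lmult T \<theta> (v (- \<gamma> (x\<^sub>v k)) i) (udelta \<theta> (v x k)))"
      by (simp only: V\<tau>[OF mB] bounded_clinear_sum[OF cL])
    finally show "V (tensor_lift (\<lambda>y \<eta>. \<tau> (g y) (L \<eta>)) (conn_form T E \<theta> nab x)) $ i =
        (\<chi> i. c i *\<^sub>R L (form_component i x)) $ i"
      unfolding form_component_def tensor_lift_conn_form[OF balanced_component x u(1)]
      by (simp add: bounded_clinear_add_apply[OF L(1)] scaleC_of_real scaleR_add_right)
  qed
qed

end

section \<open>The curvature\<close>

context connection
begin

definition DomN :: "('h ^ ('n + 'n)) set"
  where "DomN = {\<xi>. \<forall>i. \<xi> $ i \<in> Dom T}"

definition Dom2N :: "('h ^ ('n + 'n)) set"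
  where "Dom2N = {\<xi>. \<forall>i. \<xi> $ i \<in> Dom2 T}"

text \<open>This is \<open>\<gamma> \<otimes> D\<close> on \<open>H\<^sup>2\<^sup>N\<close>.\<close>

definition DN :: "('h ^ ('n + 'n)) \<Rightarrow> ('h ^ ('n + 'n))"
  where "DN \<xi> = (\<chi> i. parity i *\<^sub>R D (\<xi> $ i))"

abbreviation P :: "('h ^ ('n + 'n)) \<Rightarrow>\<^sub>L ('h ^ ('n + 'n))"
  where "P \<equiv> matrix_op (pmat E)"

text \<open>The operator \<open>v \<omega>\<^sub>D v\<^sup>*\<close>.\<close>

definition M :: "('h ^ ('n + 'n)) \<Rightarrow>\<^sub>L ('h ^ ('n + 'n))"
  where "M = matrix_op (\<lambda>i j. piD T \<theta> (\<omega> i j))"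

text \<open>The matrix of \<open>(\<gamma> \<otimes> \<pi>\<^bsub>D\<^sup>2\<^esub>)(\<omega>)\<close> in the frame, an unbounded operator with values meaningful
  on \<open>DomN\<close>.\<close>

definition M2 :: "('h ^ ('n + 'n)) \<Rightarrow> ('h ^ ('n + 'n))"
  where "M2 \<xi> = (\<chi> i. parity i *\<^sub>R (\<Sum>j\<in>UNIV. piD2 T \<theta> (\<omega> i j) (\<xi> $ j)))"

lemma csubspace_DomN: "csubspace DomN"
  unfolding complex_vector.subspace_def
  by (simp add: DomN_def Dom_0 Dom_add Dom_scaleC scaleC_vec_def)

lemma csubspace_Dom2N: "csubspace Dom2N"
  unfolding complex_vector.subspace_def
  by (simp add: Dom2N_def Dom2_add Dom2_scaleC complex_vector.subspace_0[OF csubspace_Dom2] scaleC_vec_def)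

lemma Dom2N_DomN: "\<xi> \<in> Dom2N \<Longrightarrow> \<xi> \<in> DomN" "\<xi> \<in> Dom2N \<Longrightarrow> DN \<xi> \<in> DomN"
  by (simp_all add: Dom2N_def DomN_def Dom2_iff DN_def Dom_scaleR)

lemma DN_add: "\<xi> \<in> DomN \<Longrightarrow> \<eta> \<in> DomN \<Longrightarrow> DN (\<xi> + \<eta>) = DN \<xi> + DN \<eta>"
  by (simp add: DN_def DomN_def vec_eq_iff D_add scaleR_add_right)

lemma DN_scaleC: "\<xi> \<in> DomN \<Longrightarrow> DN (c *\<^sub>C \<xi>) = c *\<^sub>C DN \<xi>"
  by (simp add: DN_def DomN_def vec_eq_iff scaleC_vec_def D_scaleC scaleR_scaleC scaleC_scaleC mult.commute)

lemma DN_0: "DN 0 = 0"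
  by (simp add: DN_def vec_eq_iff)

lemma DN_diff: "\<xi> \<in> DomN \<Longrightarrow> \<eta> \<in> DomN \<Longrightarrow> DN (\<xi> - \<eta>) = DN \<xi> - DN \<eta>"
  by (simp add: DN_def DomN_def vec_eq_iff D_diff scaleR_diff_right)

lemma DN_symmetric: "\<xi> \<in> DomN \<Longrightarrow> \<eta> \<in> DomN \<Longrightarrow> cinner (DN \<xi>) \<eta> = cinner \<xi> (DN \<eta>)"
  by (simp add: DN_def DomN_def cinner_vec_def scaleR_scaleC cinner_scaleC_left cinner_scaleC_right
      D_symmetric)

lemma dense_DomN: "closure DomN = UNIV"
proof -
  have "\<xi> \<in> closure DomN" for \<xi> :: "'h ^ ('n + 'n)"
  proof -
    have "\<exists>s. (\<forall>n. s n \<in> Dom T) \<and> s \<longlonglongrightarrow> \<xi> $ i" for i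
      using dense_Dom closure_sequential[of "\<xi> $ i" "Dom T"] by simp
    then obtain s where s: "\<And>i n. s i n \<in> Dom T" "\<And>i. s i \<longlonglongrightarrow> \<xi> $ i" by metis
    have "(\<lambda>n. \<chi> i. s i n) \<longlonglongrightarrow> \<xi>"
      by (rule vec_tendstoI) (simp add: s(2))
    moreover have "(\<chi> i. s i n) \<in> DomN" for n by (simp add: DomN_def s(1))
    ultimately show ?thesis unfolding closure_sequential by (intro exI[of _ "\<lambda>n. \<chi> i. s i n"]) simp
  qed
  then show ?thesis by blast
qed

lemma V_\<tau>_DomN: "x \<in> Xc E \<Longrightarrow> h \<in> Dom T \<Longrightarrow> V (\<tau> x h) \<in> DomN"
  by (simp add: DomN_def V_\<tau> C1_op_Dom C1_op_B2 v_B2)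

lemma V_\<tau>_Dom2N: "x \<in> Xc E \<Longrightarrow> h \<in> Dom2 T \<Longrightarrow> V (\<tau> x h) \<in> Dom2N"
  by (simp add: Dom2N_def V_\<tau> C2_op_Dom2 C2_op_B2 v_B2)

lemma U_P: "U (P \<xi>) = U \<xi>"
  by (simp add: U_V flip: V_U)

lemma P_V: "P (V \<zeta>) = V \<zeta>"
  by (simp add: U_V flip: V_U)

lemma P_P: "P (P \<xi>) = P \<xi>"
  by (simp add: U_V flip: V_U)

lemma P_DomN: "\<xi> \<in> DomN \<Longrightarrow> P \<xi> \<in> DomN"
  by (simp add: DomN_def matrix_op_apply Dom_sum C1_op_Dom C1_op_B2 pmat_B2)

subsection \<open>The commutator with the projection\<close>

lemma commDp_eq: "commDp T E = matrix_op (\<lambda>i j. parity i *\<^sub>R comm1 T (pmat E i j))"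
  and commDp_apply: "\<xi> \<in> DomN \<Longrightarrow> commDp T E \<xi> = DN (P \<xi>) - P (DN \<xi>)"
proof -
  let ?C = "matrix_op (\<lambda>i j. parity i *\<^sub>R comm1 T (pmat E i j))"
  have C: "?C \<xi> = DN (P \<xi>) - P (DN \<xi>)" if \<xi>: "\<xi> \<in> DomN" for \<xi>
    unfolding vec_eq_iff
  proof
    fix i
    have "(DN (P \<xi>)) $ i = parity i *\<^sub>R D (\<Sum>j\<in>UNIV. pmat E i j (\<xi> $ j))"
      by (simp add: DN_def matrix_op_apply)
    also have "\<dots> = (\<Sum>j\<in>UNIV. parity i *\<^sub>R D (pmat E i j (\<xi> $ j)))"
      using \<xi> by (simp add: D_sum C1_op_Dom C1_op_B2 pmat_B2 DomN_def scaleR_sum_right)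
    also have "\<dots> = (\<Sum>j\<in>UNIV. parity i *\<^sub>R pmat E i j (D (\<xi> $ j)) + parity i *\<^sub>R comm1 T (pmat E i j) (\<xi> $ j))"
      using \<xi> by (simp add: comm1_apply C1_op_B2 pmat_B2 DomN_def scaleR_add_right)
    also have "\<dots> = (\<Sum>j\<in>UNIV. (parity i *\<^sub>R pmat E i j) (D (\<xi> $ j))) +
        (\<Sum>j\<in>UNIV. parity i *\<^sub>R comm1 T (pmat E i j) (\<xi> $ j))"
      by (simp add: sum.distrib blinfun.scaleR_left)
    also have "(\<Sum>j\<in>UNIV. (parity i *\<^sub>R pmat E i j) (D (\<xi> $ j))) = (P (DN \<xi>)) $ i"
      unfolding parity_pmat by (simp add: matrix_op_apply DN_def blinfun.scaleR_left blinfun.scaleR_right)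
    finally show "?C \<xi> $ i = (DN (P \<xi>) - P (DN \<xi>)) $ i"
      by (simp add: matrix_op_apply blinfun.scaleR_left)
  qed
  show eq: "commDp T E = ?C"
    unfolding commDp_def DN_def[symmetric] DomN_def[symmetric]
    by (rule bcomm_eqI[OF dense_DomN C])
  show "commDp T E \<xi> = DN (P \<xi>) - P (DN \<xi>)" if "\<xi> \<in> DomN"
    unfolding eq by (rule C[OF that])
qed

lemma clinear_op_commDp: "clinear_op (commDp T E)"
  unfolding commDp_eq
  by (intro clinear_op_matrix_op clinear_op_scaleR clinear_op_comm1 C1_op_B2 pmat_B2)

text \<open>For \<open>\<xi>\<close> in the range of \<open>p\<close>, \<open>[D, p] \<xi> = (1 - p) D \<xi>\<close>, and \<open>p [D, p] = - p D (1 - p)\<close> on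
  the range of \<open>1 - p\<close>.\<close>

lemma U_commDp_commDp:
  assumes \<xi>: "\<xi> \<in> Dom2N" "P \<xi> = \<xi>"
  shows "U (commDp T E (commDp T E \<xi>)) = U (DN (P (DN \<xi>))) - U (DN (DN \<xi>))"
proof -
  \<comment> \<open>\<open>\<kappa> = (1 - p) D \<xi> = [D, p] \<xi>\<close>\<close>
  define \<kappa> where "\<kappa> = DN \<xi> - P (DN \<xi>)"
  have dom: "DN \<xi> \<in> DomN" "P (DN \<xi>) \<in> DomN" using Dom2N_DomN[OF \<xi>(1)] P_DomN by blast+
  have \<kappa>: "\<kappa> \<in> DomN" unfolding \<kappa>_def by (intro complex_vector.subspace_diff[OF csubspace_DomN] dom)
  have "P \<kappa> = 0" by (simp add: \<kappa>_def blinfun.diff_right P_P)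
  then have "commDp T E \<kappa> = - P (DN \<kappa>)" by (simp add: commDp_apply[OF \<kappa>] DN_0)
  moreover have "commDp T E \<xi> = \<kappa>"
    by (simp add: commDp_apply[OF Dom2N_DomN(1)[OF \<xi>(1)]] \<xi>(2) \<kappa>_def)
  moreover have "DN \<kappa> = DN (DN \<xi>) - DN (P (DN \<xi>))" unfolding \<kappa>_def by (rule DN_diff[OF dom])
  ultimately show ?thesis by (simp add: blinfun.minus_right U_P blinfun.diff_right)
qed

subsection \<open>The operators induced by the connection form\<close>

lemma clinear_op_M: "clinear_op M"
  unfolding M_def by (intro clinear_op_matrix_op clinear_op_piD)

lemma V_omega_action:
  assumes "x \<in> Xc E"
  shows "V (tensor_lift (\<lambda>y \<eta>. \<tau> y (piD T \<theta> \<eta> h)) (conn_form T E \<theta> nab x)) = M (V (\<tau> x h))"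
proof -
  have "V (tensor_lift (\<lambda>y \<eta>. \<tau> y (piD T \<theta> \<eta> h)) (conn_form T E \<theta> nab x)) =
      (\<chi> i. 1 *\<^sub>R piD T \<theta> (form_component i x) h)"
    by (rule V_tensor_lift_conn_form[where g = "\<lambda>y. y" and L = "\<lambda>\<eta>. piD T \<theta> \<eta> h"])
      (simp_all add: bounded_clinear_apply bounded_clinear_piD piD_lmult assms)
  also have "\<dots> = M (V (\<tau> x h))"
    by (simp add: vec_eq_iff M_def matrix_op_apply V_\<tau> piD_form_component assms blinfun.sum_left)
  finally show ?thesis .
qed

lemma omega_action:
  assumes "x \<in> Xc E"
  shows "tensor_lift (\<lambda>y \<eta>. \<tau> y (piD T \<theta> \<eta> h)) (conn_form T E \<theta> nab x) = U (M (V (\<tau> x h)))"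
  unfolding V_omega_action[OF assms, symmetric] U_V ..

lemma omegaD_eq: "omegaD T E \<theta> \<tau> nab = U o\<^sub>L M o\<^sub>L V"
  unfolding omegaD_def
proof (rule the_equality)
  show "A = U o\<^sub>L M o\<^sub>L V"
    if "\<forall>x\<in>Xc E. \<forall>h. A (\<tau> x h) = tensor_lift (\<lambda>y \<eta>. \<tau> y (piD T \<theta> \<eta> h)) (conn_form T E \<theta> nab x)"
    for A :: "'k \<Rightarrow>\<^sub>L 'k"
    by (rule blinfun_eq_on_\<tau>) (simp add: that omega_action)
qed (simp add: omega_action)

text \<open>The columns of \<open>v \<omega> v\<^sup>*\<close> lie in the range of \<open>p\<close>, being of the form \<open>v \<omega>(x\<^sub>j)\<close>.\<close>

lemma P_M_V: "P (M (V \<zeta>)) = M (V \<zeta>)"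
proof -
  have "P o\<^sub>L M o\<^sub>L V = M o\<^sub>L V"
  proof (rule blinfun_eq_on_\<tau>)
    fix x h assume x: "x \<in> Xc E"
    show "(P o\<^sub>L M o\<^sub>L V) (\<tau> x h) = (M o\<^sub>L V) (\<tau> x h)"
      by (simp add: P_V flip: V_omega_action[OF x])
  qed
  then have "(P o\<^sub>L M o\<^sub>L V) \<zeta> = (M o\<^sub>L V) \<zeta>" by simp
  then show ?thesis by simp
qed

text \<open>Right linearity of \<open>\<omega>\<close>, applied to the expansion of \<open>x\<^sub>k\<close> in the frame.\<close>

lemma M_P: "M (P \<xi>) = M \<xi>"
proof -
  have "(\<Sum>j\<in>UNIV. piD T \<theta> (\<omega> i j) (\<Sum>k\<in>UNIV. pmat E j k (\<xi> $ k))) = (\<Sum>k\<in>UNIV. piD T \<theta> (\<omega> i k) (\<xi> $ k))"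
    for i
  proof -
    have "(\<Sum>j\<in>UNIV. piD T \<theta> (\<omega> i j) (\<Sum>k\<in>UNIV. pmat E j k (\<xi> $ k))) =
        (\<Sum>k\<in>UNIV. \<Sum>j\<in>UNIV. piD T \<theta> (\<omega> i j) (pmat E j k (\<xi> $ k)))"
      unfolding blinfun.sum_right by (rule sum.swap)
    also have "\<dots> = (\<Sum>k\<in>UNIV. piD T \<theta> (\<omega> i k) (\<xi> $ k))"
      by (simp add: form_matrix_eq[of _ k for k] piD_form_component frame_in_Xc pmat_eq blinfun.sum_left)
    finally show ?thesis .
  qed
  then show ?thesis by (simp add: M_def matrix_op_apply vec_eq_iff)
qed

lemma M_DomN: "\<xi> \<in> Dom2N \<Longrightarrow> M \<xi> \<in> DomN"
  by (simp add: M_def matrix_op_apply DomN_def Dom2N_def Dom_sum D_piD(1))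

text \<open>The matrix form of \<open>D \<pi>\<^sub>D(\<eta>) + \<pi>\<^sub>D(\<eta>) D = \<pi>\<^sub>D(\<delta>(\<eta>)) + \<pi>\<^bsub>D\<^sup>2\<^esub>(\<eta>)\<close>. The signs agree because
  \<open>v \<omega> v\<^sup>*\<close> commutes with the grading.\<close>

lemma DN_M:
  assumes "\<xi> \<in> Dom2N"
  shows "DN (M \<xi>) + M (DN \<xi>) = piD_delta_form T E \<theta> nab \<xi> + M2 \<xi>"
  unfolding vec_eq_iff
proof
  fix i
  have dom: "\<xi> $ j \<in> Dom2 T" for j using assms by (simp add: Dom2N_def)
  have "(DN (M \<xi>)) $ i = (\<Sum>j\<in>UNIV. parity i *\<^sub>R D (piD T \<theta> (\<omega> i j) (\<xi> $ j)))"
    by (simp add: DN_def M_def matrix_op_apply D_sum D_piD(1) dom scaleR_sum_right)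
  moreover have "(M (DN \<xi>)) $ i = (\<Sum>j\<in>UNIV. piD T \<theta> (parity j *\<^sub>R \<omega> i j) (D (\<xi> $ j)))"
    by (simp add: M_def matrix_op_apply DN_def blinfun.scaleR_right blinfun.scaleR_left
        linear_simps[OF bounded_clinear_linear[OF bounded_clinear_piD]])
  moreover have "piD T \<theta> (parity j *\<^sub>R \<omega> i j) = parity i *\<^sub>R piD T \<theta> (\<omega> i j)" for j
    unfolding parity_form_matrix[of j i]
    by (rule linear_simps(5)[OF bounded_clinear_linear[OF bounded_clinear_piD]])
  ultimately have "(DN (M \<xi>) + M (DN \<xi>)) $ i =
      (\<Sum>j\<in>UNIV. parity i *\<^sub>R (D (piD T \<theta> (\<omega> i j) (\<xi> $ j)) + piD T \<theta> (\<omega> i j) (D (\<xi> $ j))))"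
    by (simp add: sum.distrib scaleR_add_right blinfun.scaleR_left)
  also have "\<dots> = (\<Sum>j\<in>UNIV. parity i *\<^sub>R
      (piD_delta T \<theta> (\<omega> i j) (\<xi> $ j) + piD2 T \<theta> (\<omega> i j) (\<xi> $ j)))"
    by (simp only: D_piD(2)[OF dom])
  also have "\<dots> = (piD_delta_form T E \<theta> nab \<xi> + M2 \<xi>) $ i"
    by (simp add: piD_delta_form_def matrix_op_apply M2_def sum.distrib scaleR_add_right
        blinfun.scaleR_left scaleR_sum_right)
  finally show "(DN (M \<xi>) + M (DN \<xi>)) $ i = (piD_delta_form T E \<theta> nab \<xi> + M2 \<xi>) $ i" .
qed

lemma clinear_op_piD_delta_form: "clinear_op (piD_delta_form T E \<theta> nab)"
  unfolding piD_delta_form_def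
  by (intro clinear_op_matrix_op clinear_op_scaleR clinear_op_piD_delta)

subsection \<open>The unbounded operators\<close>

abbreviation W :: "'k \<Rightarrow>\<^sub>L 'k"
  where "W \<equiv> omegaD T E \<theta> \<tau> nab"

definition conn_D :: "'k \<Rightarrow> 'k"
  where "conn_D \<zeta> = U (DN (V \<zeta>)) + W \<zeta>"

definition conn_D2 :: "'k \<Rightarrow> 'k"
  where "conn_D2 \<zeta> = U (DN (DN (V \<zeta>))) + U (M2 (V \<zeta>))"

lemma clinear_op_W: "clinear_op W"
  unfolding omegaD_eq by (intro clinear_op_compose clinear_op_U clinear_op_M clinear_op_V)

text \<open>\<open>1 \<otimes>\<^sub>\<nabla> D = v\<^sup>* D v + \<omega>\<^sub>D\<close>: the Grassmann part of \<open>\<nabla>\<close> gives \<open>v\<^sup>* D v\<close>, by the Leibniz rule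
  \<open>\<langle>x\<^sub>i, x\<rangle> D + [D, \<langle>x\<^sub>i, x\<rangle>] = D \<langle>x\<^sub>i, x\<rangle>\<close>.\<close>

lemma conn_D_\<tau>:
  assumes x: "x \<in> Xc E" and h: "h \<in> Dom T"
  shows "\<tau> (\<gamma> x) (D h) + nablaD T \<theta> \<tau> nab x h = conn_D (\<tau> x h)"
proof -
  let ?f = "\<lambda>y \<eta>. \<tau> y (piD T \<theta> \<eta> h)"
  have bal: "balanced ?f"
    by (rule balanced_\<tau>[where g = "\<lambda>y. y" and L = "\<lambda>\<eta>. piD T \<theta> \<eta> h" and c = "\<lambda>_. 1"])
      (simp_all add: bounded_clinear_apply bounded_clinear_piD piD_lmult)
  obtain u where u: "u \<in> nab x" using nab_subset_representative[OF x] by blast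
  have "nablaD T \<theta> \<tau> nab x h = (\<Sum>(y, \<eta>)\<in>#u. ?f y \<eta>)"
    unfolding nablaD_def by (rule tensor_lift_nab[OF bal x u])
  also have "\<dots> = W (\<tau> x h) + (\<Sum>i\<in>UNIV. \<tau> (\<gamma> (x\<^sub>v i)) (comm1 T (v x i) h))"
    using tensor_lift_conn_form[OF bal x u] omega_action[OF x, of h]
    by (simp add: omegaD_eq piD_udelta v_B2 x \<tau>_minus_left sum_negf algebra_simps)
  finally have nab: "nablaD T \<theta> \<tau> nab x h = \<dots>" .
  have "\<tau> (\<gamma> x) (D h) = (\<Sum>i\<in>UNIV. \<tau> (\<gamma> (x\<^sub>v i)) (v x i (D h)))"
  proof -
    have "\<gamma> x = \<gamma> (\<Sum>i\<in>UNIV. act E (x\<^sub>v i) (v x i))" using frame_expansion[of x] by simp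
    also have "\<dots> = (\<Sum>i\<in>UNIV. act E (\<gamma> (x\<^sub>v i)) (v x i))" by (simp add: grX_sum grX_act v_Balg)
    finally show ?thesis by (simp add: \<tau>_sum_left \<tau>_act v_Balg)
  qed
  then have "\<tau> (\<gamma> x) (D h) + nablaD T \<theta> \<tau> nab x h = (\<Sum>i\<in>UNIV. \<tau> (\<gamma> (x\<^sub>v i)) (v x i (D h))) +
      (\<Sum>i\<in>UNIV. \<tau> (\<gamma> (x\<^sub>v i)) (comm1 T (v x i) h)) + W (\<tau> x h)"
    by (simp only: nab add_ac)
  also have "(\<Sum>i\<in>UNIV. \<tau> (\<gamma> (x\<^sub>v i)) (v x i (D h))) + (\<Sum>i\<in>UNIV. \<tau> (\<gamma> (x\<^sub>v i)) (comm1 T (v x i) h)) =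
      (\<Sum>i\<in>UNIV. \<tau> (\<gamma> (x\<^sub>v i)) (D (v x i h)))"
    by (simp add: comm1_apply C1_op_B2 v_B2 x h \<tau>_add_right sum.distrib)
  also have "\<dots> = U (DN (V (\<tau> x h)))"
    by (simp add: U_apply DN_def V_\<tau> grX_frame \<tau>_scaleR_left \<tau>_scaleR_right)
  finally show ?thesis by (simp add: conn_D_def)
qed

text \<open>As for \<open>D\<close>, with \<open>[D\<^sup>2, \<langle>x\<^sub>i, x\<rangle>]\<close>; the grading of \<open>\<nabla>\<^bsub>D\<^sup>2\<^esub>\<close> cancels that of the Grassmann
  connection.\<close>

lemma conn_D2_\<tau>:
  assumes x: "x \<in> Xc E" and h: "h \<in> Dom2 T"
  shows "\<tau> x (D (D h)) + nablaD2 T E \<theta> \<tau> nab x h = conn_D2 (\<tau> x h)"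
proof -
  let ?f = "\<lambda>y \<eta>. \<tau> (\<gamma> y) (piD2 T \<theta> \<eta> h)"
  note L = bounded_clinear_piD2[of h] piD2_lmult grX_add grX_act[OF B1_imp_Balg] v_grX
  have bal: "balanced ?f" by (rule balanced_\<tau>[OF L])
  obtain u where u: "u \<in> nab x" using nab_subset_representative[OF x] by blast
  have hD: "h \<in> Dom T" using h by (simp add: Dom2_iff)
  have "V (tensor_lift ?f (conn_form T E \<theta> nab x)) = (\<chi> i. parity i *\<^sub>R piD2 T \<theta> (form_component i x) h)"
    by (rule V_tensor_lift_conn_form[OF L x])
  also have "\<dots> = M2 (V (\<tau> x h))"
    by (simp add: M2_def V_\<tau> piD2_form_component x hD)
  finally have "U (V (tensor_lift ?f (conn_form T E \<theta> nab x))) = U (M2 (V (\<tau> x h)))" by simp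
  then have form: "tensor_lift ?f (conn_form T E \<theta> nab x) = U (M2 (V (\<tau> x h)))" by (simp only: U_V)
  have "nablaD2 T E \<theta> \<tau> nab x h = (\<Sum>(y, \<eta>)\<in>#u. ?f y \<eta>)"
    unfolding nablaD2_def by (rule tensor_lift_nab[OF bal x u])
  also have "\<dots> = U (M2 (V (\<tau> x h))) + (\<Sum>i\<in>UNIV. \<tau> (x\<^sub>v i) (D (D (v x i h)) - v x i (D (D h))))"
    using tensor_lift_conn_form[OF bal x u]
    by (simp add: form piD2_udelta v_B2 x h grX_minus grX_grX \<tau>_minus_left sum_negf algebra_simps)
  also have "(\<Sum>i\<in>UNIV. \<tau> (x\<^sub>v i) (D (D (v x i h)) - v x i (D (D h)))) =
      (\<Sum>i\<in>UNIV. \<tau> (x\<^sub>v i) (D (D (v x i h)))) - U (V (\<tau> x (D (D h))))"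
    by (simp add: \<tau>_diff_right sum_subtractf U_apply V_\<tau>)
  also have "(\<Sum>i\<in>UNIV. \<tau> (x\<^sub>v i) (D (D (v x i h)))) = U (DN (DN (V (\<tau> x h))))"
  proof -
    have "D (v x i h) \<in> Dom T" for i
      using C2_op_Dom2[OF C2_op_B2[OF v_B2[OF x]] h] by (simp add: Dom2_iff)
    then show ?thesis by (simp add: U_apply DN_def V_\<tau> D_scaleR)
  qed
  finally show ?thesis by (simp add: conn_D2_def U_V)
qed

abbreviation "domD \<equiv> cspan {\<tau> x h | x h. x \<in> Xc E \<and> h \<in> Dom T}"
abbreviation "domD2 \<equiv> curvature_dom T E \<tau>"

lemma csubspace_V_vimage: "csubspace S \<Longrightarrow> csubspace {\<zeta>. V \<zeta> \<in> S}"
  unfolding complex_vector.subspace_def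
  by (simp add: blinfun.add_right bounded_clinear_scaleC[OF clinear_op_V])

lemma V_DomN: "\<zeta> \<in> domD \<Longrightarrow> V \<zeta> \<in> DomN"
  and V_Dom2N: "\<zeta> \<in> domD2 \<Longrightarrow> V \<zeta> \<in> Dom2N"
proof -
  have "domD \<subseteq> {\<zeta>. V \<zeta> \<in> DomN}"
    by (rule complex_vector.span_minimal[OF _ csubspace_V_vimage[OF csubspace_DomN]])
      (auto simp: V_\<tau>_DomN)
  then show "\<zeta> \<in> domD \<Longrightarrow> V \<zeta> \<in> DomN" by blast
  have "domD2 \<subseteq> {\<zeta>. V \<zeta> \<in> Dom2N}"
    unfolding curvature_dom_def
    by (rule complex_vector.span_minimal[OF _ csubspace_V_vimage[OF csubspace_Dom2N]])
      (auto simp: V_\<tau>_Dom2N)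
  then show "\<zeta> \<in> domD2 \<Longrightarrow> V \<zeta> \<in> Dom2N" by blast
qed

lemma U_in_domD: "\<kappa> \<in> DomN \<Longrightarrow> U \<kappa> \<in> domD"
  unfolding U_apply DomN_def
  by (intro complex_vector.span_sum complex_vector.span_base) (auto intro: frame_in_Xc)

lemma tensor_D_eq: "tensor_D T E \<theta> \<tau> nab = closure {(\<zeta>, conn_D \<zeta>) |\<zeta>. \<zeta> \<in> domD}"
proof -
  have "{(\<tau> x h, \<tau> (\<gamma> x) (D h) + nablaD T \<theta> \<tau> nab x h) |x h. x \<in> Xc E \<and> h \<in> Dom T} =
      {(z, conn_D z) |z. z \<in> {\<tau> x h | x h. x \<in> Xc E \<and> h \<in> Dom T}}"
    using conn_D_\<tau> by (auto; metis)
  moreover have "cspan \<dots> = {(\<zeta>, conn_D \<zeta>) |\<zeta>. \<zeta> \<in> domD}"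
  proof (rule cspan_graph[OF csubspace_V_vimage[OF csubspace_DomN]])
    fix c z y assume "z \<in> {\<zeta>. V \<zeta> \<in> DomN}" "y \<in> {\<zeta>. V \<zeta> \<in> DomN}"
    then show "conn_D (c *\<^sub>C z + y) = c *\<^sub>C conn_D z + conn_D y"
      by (simp add: conn_D_def blinfun.add_right DN_add DN_scaleC complex_vector.subspace_scale[OF csubspace_DomN]
          clinear_op_V clinear_op_U clinear_op_W bounded_clinear_scaleC scaleC_add_right)
  qed (use V_\<tau>_DomN in blast)
  ultimately show ?thesis unfolding tensor_D_def by simp
qed

lemma conn_D_in_tensor_D: "\<zeta> \<in> domD \<Longrightarrow> (\<zeta>, conn_D \<zeta>) \<in> tensor_D T E \<theta> \<tau> nab"
  unfolding tensor_D_eq by (rule subsetD[OF closure_subset]) blast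

text \<open>\<open>v\<^sup>* D v\<close> is symmetric and \<open>\<omega>\<^sub>D\<close> bounded, so that \<open>1 \<otimes>\<^sub>\<nabla> D\<close> is closable.\<close>

lemma tensor_D_weak:
  assumes "(\<zeta>, \<alpha>) \<in> tensor_D T E \<theta> \<tau> nab" "\<psi> \<in> domD"
  shows "cinner \<psi> \<alpha> = cinner (U (DN (V \<psi>))) \<zeta> + cinner \<psi> (W \<zeta>)"
proof -
  let ?S = "{p. cinner \<psi> (snd p) = cinner (U (DN (V \<psi>))) (fst p) + cinner \<psi> (W (fst p))}"
  have "{(\<zeta>, conn_D \<zeta>) |\<zeta>. \<zeta> \<in> domD} \<subseteq> ?S"
    using V_DomN assms(2)
    by (auto simp: conn_D_def cinner_add_right cinner_U cinner_V[symmetric] DN_symmetric)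
  moreover have "closed ?S" by (intro closed_Collect_eq continuous_intros)
  ultimately have "tensor_D T E \<theta> \<tau> nab \<subseteq> ?S" unfolding tensor_D_eq by (rule closure_minimal)
  with assms(1) show ?thesis by auto
qed

text \<open>A vector is determined by its inner products with a dense subspace, and the weak formula
  expresses these through \<open>\<zeta>\<close> alone.\<close>

lemma tensor_D_unique:
  "(\<zeta>, \<alpha>) \<in> tensor_D T E \<theta> \<tau> nab \<Longrightarrow> (\<zeta>, \<alpha>') \<in> tensor_D T E \<theta> \<tau> nab \<Longrightarrow> \<alpha> = \<alpha>'"
  by (rule cinner_eqI[OF dense_\<tau>_core[OF dense_Dom]]) (simp add: tensor_D_weak)

lemma M2_add: "M2 (\<xi> + \<eta>) = M2 \<xi> + M2 \<eta>" if "\<xi> \<in> DomN" "\<eta> \<in> DomN"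
proof -
  have "piD2 T \<theta> w (\<xi> $ j + \<eta> $ j) = piD2 T \<theta> w (\<xi> $ j) + piD2 T \<theta> w (\<eta> $ j)" for w j
  proof -
    have "D (\<xi> $ j + \<eta> $ j) + \<i> *\<^sub>C (\<xi> $ j + \<eta> $ j) = (D (\<xi> $ j) + \<i> *\<^sub>C \<xi> $ j) + (D (\<eta> $ j) + \<i> *\<^sub>C \<eta> $ j)"
      using that by (simp add: DomN_def D_add scaleC_add_right)
    then show ?thesis unfolding piD2_eq by (simp only: blinfun.add_right)
  qed
  then show ?thesis by (simp add: M2_def vec_eq_iff sum.distrib scaleR_add_right)
qed

lemma M2_scaleC: "M2 (c *\<^sub>C \<xi>) = c *\<^sub>C M2 \<xi>" if "\<xi> \<in> DomN"
proof -
  have "piD2 T \<theta> w (c *\<^sub>C \<xi> $ j) = c *\<^sub>C piD2 T \<theta> w (\<xi> $ j)" for w j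
  proof -
    have "D (c *\<^sub>C \<xi> $ j) + \<i> *\<^sub>C c *\<^sub>C \<xi> $ j = c *\<^sub>C (D (\<xi> $ j) + \<i> *\<^sub>C \<xi> $ j)"
      using that unfolding scaleC_add_right scaleC_scaleC mult.commute[of c] by (simp add: DomN_def D_scaleC)
    then show ?thesis unfolding piD2_eq by (simp only: bounded_clinear_scaleC[OF clinear_op_piD2R])
  qed
  then show ?thesis
    by (simp add: M2_def vec_eq_iff scaleC_vec_def complex_vector.scale_sum_right scaleR_scaleC
        scaleC_scaleC mult.commute)
qed

lemma tensor_D2_eq: "tensor_D2 T E \<theta> \<tau> nab = {(\<zeta>, conn_D2 \<zeta>) |\<zeta>. \<zeta> \<in> domD2}"
proof -
  have "{(\<tau> x h, \<tau> x (D (D h)) + nablaD2 T E \<theta> \<tau> nab x h) |x h. x \<in> Xc E \<and> h \<in> Dom2 T} =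
      {(z, conn_D2 z) |z. z \<in> {\<tau> x h | x h. x \<in> Xc E \<and> h \<in> Dom2 T}}"
    using conn_D2_\<tau> by (auto; metis)
  moreover have "cspan \<dots> = {(\<zeta>, conn_D2 \<zeta>) |\<zeta>. \<zeta> \<in> domD2}"
    unfolding curvature_dom_def
  proof (rule cspan_graph[OF csubspace_V_vimage[OF csubspace_Dom2N]])
    fix c z y assume "z \<in> {\<zeta>. V \<zeta> \<in> Dom2N}" "y \<in> {\<zeta>. V \<zeta> \<in> Dom2N}"
    then have dom: "V z \<in> DomN" "DN (V z) \<in> DomN" "V y \<in> DomN" "DN (V y) \<in> DomN"
      using Dom2N_DomN by blast+
    note cdom = dom(1,2)[THEN complex_vector.subspace_scale[OF csubspace_DomN, of _ c]]
    show "conn_D2 (c *\<^sub>C z + y) = c *\<^sub>C conn_D2 z + conn_D2 y"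
      by (simp add: conn_D2_def blinfun.add_right bounded_clinear_scaleC[OF clinear_op_V]
          bounded_clinear_scaleC[OF clinear_op_U] DN_add DN_scaleC dom cdom M2_add M2_scaleC scaleC_add_right)
  qed (use V_\<tau>_Dom2N in blast)
  ultimately show ?thesis unfolding tensor_D2_def by simp
qed

lemma domD2_subset: "domD2 \<subseteq> domD"
  unfolding curvature_dom_def by (rule complex_vector.span_mono) (auto simp: Dom2_iff)

lemma conn_D_eq_U: "conn_D \<zeta> = U (DN (V \<zeta>) + M (V \<zeta>))"
  by (simp add: conn_D_def omegaD_eq blinfun.add_right)

text \<open>Since \<open>\<omega>\<^sub>D \<zeta> = v\<^sup>* (v \<omega>\<^sub>D \<zeta>)\<close>, it suffices that the components of \<open>v \<omega>\<^sub>D \<zeta>\<close> lie in the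
  domain of \<open>D\<close>, although the module elements in a representative of \<open>\<omega>(x)\<close> lie only in \<open>X\<^sub>v\<close>.\<close>

lemma conn_D_in_domD: "\<zeta> \<in> domD2 \<Longrightarrow> conn_D \<zeta> \<in> domD"
  unfolding conn_D_eq_U
  by (intro U_in_domD complex_vector.subspace_add[OF csubspace_DomN] Dom2N_DomN M_DomN V_Dom2N)

lemma curvature_eq: "curvature T E \<theta> \<tau> nab = {(\<zeta>, conn_D (conn_D \<zeta>) - conn_D2 \<zeta>) |\<zeta>. \<zeta> \<in> domD2}"
proof -
  have comp: "(\<zeta>, \<alpha>) \<in> tensor_D T E \<theta> \<tau> nab O tensor_D T E \<theta> \<tau> nab \<longleftrightarrow> \<alpha> = conn_D (conn_D \<zeta>)"
    if "\<zeta> \<in> domD2" for \<zeta> \<alpha>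
  proof -
    have 1: "(\<zeta>, conn_D \<zeta>) \<in> tensor_D T E \<theta> \<tau> nab"
      by (rule conn_D_in_tensor_D[OF subsetD[OF domD2_subset that]])
    have 2: "(conn_D \<zeta>, conn_D (conn_D \<zeta>)) \<in> tensor_D T E \<theta> \<tau> nab"
      by (rule conn_D_in_tensor_D[OF conn_D_in_domD[OF that]])
    show ?thesis
    proof
      assume "(\<zeta>, \<alpha>) \<in> tensor_D T E \<theta> \<tau> nab O tensor_D T E \<theta> \<tau> nab"
      then obtain \<eta> where \<eta>: "(\<zeta>, \<eta>) \<in> tensor_D T E \<theta> \<tau> nab" "(\<eta>, \<alpha>) \<in> tensor_D T E \<theta> \<tau> nab" by blast
      have "\<eta> = conn_D \<zeta>" by (rule tensor_D_unique[OF \<eta>(1) 1])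
      with \<eta>(2) show "\<alpha> = conn_D (conn_D \<zeta>)" by (intro tensor_D_unique[OF _ 2]) simp
    qed (use 1 2 in blast)
  qed
  show ?thesis
  proof (intro equalityI subsetI)
    fix p assume "p \<in> curvature T E \<theta> \<tau> nab"
    then obtain \<zeta> \<alpha> \<beta> where p: "p = (\<zeta>, \<alpha> - \<beta>)" "\<zeta> \<in> domD2"
      "(\<zeta>, \<alpha>) \<in> tensor_D T E \<theta> \<tau> nab O tensor_D T E \<theta> \<tau> nab" "\<beta> = conn_D2 \<zeta>"
      unfolding curvature_def tensor_D2_eq by blast
    then show "p \<in> {(\<zeta>, conn_D (conn_D \<zeta>) - conn_D2 \<zeta>) |\<zeta>. \<zeta> \<in> domD2}"
      using comp[OF p(2), of \<alpha>] by blast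
  next
    fix p assume "p \<in> {(\<zeta>, conn_D (conn_D \<zeta>) - conn_D2 \<zeta>) |\<zeta>. \<zeta> \<in> domD2}"
    then obtain \<zeta> where "p = (\<zeta>, conn_D (conn_D \<zeta>) - conn_D2 \<zeta>)" "\<zeta> \<in> domD2" by blast
    then show "p \<in> curvature T E \<theta> \<tau> nab"
      unfolding curvature_def tensor_D2_eq using comp
      by (intro CollectI exI[of _ \<zeta>] exI[of _ "conn_D (conn_D \<zeta>)"] exI[of _ "conn_D2 \<zeta>"]) simp
  qed
qed

definition curvature_op :: "'k \<Rightarrow>\<^sub>L 'k"
  where "curvature_op = (cadj V o\<^sub>L commDp T E o\<^sub>L commDp T E o\<^sub>L V) + (W o\<^sub>L W)
    + (cadj V o\<^sub>L piD_delta_form T E \<theta> nab o\<^sub>L V)"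

lemma clinear_op_curvature: "clinear_op curvature_op"
  unfolding curvature_op_def cadj_V
  by (intro clinear_op_add clinear_op_compose clinear_op_U clinear_op_V clinear_op_W clinear_op_commDp
      clinear_op_piD_delta_form)

lemma curvature_apply:
  assumes "\<zeta> \<in> domD2"
  shows "conn_D (conn_D \<zeta>) - conn_D2 \<zeta> = curvature_op \<zeta>"
proof -
  define \<xi> where "\<xi> = V \<zeta>"
  have \<xi>: "\<xi> \<in> Dom2N" "P \<xi> = \<xi>" unfolding \<xi>_def using V_Dom2N[OF assms] P_V by blast+
  have PM: "P (M \<xi>) = M \<xi>" unfolding \<xi>_def by (rule P_M_V)
  note dom = Dom2N_DomN[OF \<xi>(1)] M_DomN[OF \<xi>(1)]
  have "V (conn_D \<zeta>) = P (DN \<xi>) + M \<xi>"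
    unfolding conn_D_eq_U V_U \<xi>_def[symmetric] by (simp add: blinfun.add_right PM)
  then have "conn_D (conn_D \<zeta>) = U (DN (P (DN \<xi>)) + DN (M \<xi>) + M (P (DN \<xi>)) + M (M \<xi>))"
    unfolding conn_D_eq_U[of "conn_D \<zeta>"] by (simp add: DN_add dom P_DomN blinfun.add_right add_ac)
  also have "\<dots> = U (DN (P (DN \<xi>))) + U (DN (M \<xi>) + M (DN \<xi>)) + U (M (M \<xi>))"
    by (simp add: M_P blinfun.add_right add_ac)
  also have "DN (M \<xi>) + M (DN \<xi>) = piD_delta_form T E \<theta> nab \<xi> + M2 \<xi>"
    by (rule DN_M[OF \<xi>(1)])
  also have "U (M (M \<xi>)) = W (W \<zeta>)"
    unfolding omegaD_eq by (simp add: V_U PM flip: \<xi>_def)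
  finally show ?thesis
    using U_commDp_commDp[OF \<xi>]
    by (simp add: curvature_op_def conn_D2_def cadj_V blinfun.add_left blinfun.add_right flip: \<xi>_def)
qed

lemma bounded_extension_curvature: "bounded_extension domD2 (curvature T E \<theta> \<tau> nab) curvature_op"
  unfolding bounded_extension_def curvature_eq using clinear_op_curvature curvature_apply by auto

lemma bounded_extension_unique:
  assumes "bounded_extension domD2 G A" "bounded_extension domD2 G A'"
  shows "A = A'"
proof (rule blinfun_eq_on_dense[OF dense_\<tau>_core[OF dense_Dom2]])
  fix \<zeta> assume "\<zeta> \<in> cspan {\<tau> x h |x h. x \<in> Xc E \<and> h \<in> Dom2 T}"
  then have "\<zeta> \<in> domD2" by (simp add: curvature_dom_def)
  moreover have "{(\<zeta>, A \<zeta>) |\<zeta>. \<zeta> \<in> domD2} = {(\<zeta>, A' \<zeta>) |\<zeta>. \<zeta> \<in> domD2}"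
    using assms by (simp add: bounded_extension_def)
  ultimately have "(\<zeta>, A \<zeta>) \<in> {(\<zeta>, A' \<zeta>) |\<zeta>. \<zeta> \<in> domD2}" by blast
  then show "A \<zeta> = A' \<zeta>" by blast
qed

end

theorem proposition3p4:
  fixes T :: "'h :: chilbert_space striple"
    and E :: "('h, 'x :: complex_banach, 'n :: finite) smodule"
    and \<theta> :: "('h \<Rightarrow>\<^sub>L 'h) \<Rightarrow> ('h \<Rightarrow>\<^sub>L 'h) \<Rightarrow> 'w :: complex_banach"
    and \<tau> :: "'x \<Rightarrow> 'h \<Rightarrow> 'k :: chilbert_space"
    and nab :: "'x \<Rightarrow> ('x \<times> 'w) multiset set"
  assumes "C2_spectral_triple T"
    and "C2_module T E"
    and "is_haagerup_tensor T \<theta>"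
    and "is_interior_tensor T E \<tau>"
    and "C2_connection T E \<theta> nab"
  shows "(\<exists>R. bounded_extension (curvature_dom T E \<tau>) (curvature T E \<theta> \<tau> nab) R) \<and>
    (\<forall>R. bounded_extension (curvature_dom T E \<tau>) (curvature T E \<theta> \<tau> nab) R \<longrightarrow>
      R = (cadj (vtensor E \<tau>) o\<^sub>L commDp T E o\<^sub>L commDp T E o\<^sub>L vtensor E \<tau>)
        + (omegaD T E \<theta> \<tau> nab o\<^sub>L omegaD T E \<theta> \<tau> nab)
        + (cadj (vtensor E \<tau>) o\<^sub>L piD_delta_form T E \<theta> nab o\<^sub>L vtensor E \<tau>))"
proof -
  interpret connection T \<theta> E \<tau> nab
    by unfold_locales (use assms in auto)
  show ?thesis
    using bounded_extension_curvature bounded_extension_unique curvature_op_def by metis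
qed

end
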